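(* Let $d\ge1$ and let $\widetilde{\mathbf{B}}(t)=(t,\mathbf{B}(t))$, $t\ge0$, where $\{\mathbf{B}(t)\}_{t\ge0}$ is a standard Brownian motion in $\mathbb{R}^{d-1}$. Then $$\mathbb{E}\Bigl[\mathrm{Vol}_d\bigl(\mathrm{conv}\,\widetilde{\mathbf{B}}[0,1]\bigr)\Bigr]=\frac{2^{(d+1)/2}\,\pi^{(d-1)/2}}{(d+1)!}.$$
   Context: $\mathrm{Vol}_d$ is $d$-dimensional Lebesgue measure, $\mathrm{conv}$ is the convex hull and $\widetilde{\mathbf{B}}[0,1]=\mathrm{cl}\{\widetilde{\mathbf{B}}(t):t\in[0,1]\}$. *)

theory Defs
  imports "HOL-Probability.Probability"
begin

text \<open>
  Vectors of \<open>\<real>\<^sup>I\<close> are the extensional functions in the space of \<open>Pi\<^sub>M I (\<lambda>_. borel)\<close>, so that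
  \<open>I = {}\<close>, the zero-dimensional case, is allowed (the type \<open>real ^ 'n\<close> never has dimension 0).
  The second parameter of \<open>normal_density\<close> is the standard deviation; the product measure in
  \<open>increment_distr\<close> is the Gaussian law with mean 0 and covariance \<open>(t - s)\<close> times the identity.
  The values of \<open>B\<close> at negative times are irrelevant.
\<close>

locale standard_brownian_motion = prob_space M
  for M :: "'w measure" and I :: "'i set" and B :: "real \<Rightarrow> 'w \<Rightarrow> 'i \<Rightarrow> real" +
  assumes finite_index: "finite I"
    and random_variable_B: "\<And>t. 0 \<le> t \<Longrightarrow> B t \<in> measurable M (Pi\<^sub>M I (\<lambda>_. borel))"
    and start_zero: "AE \<omega> in M. \<forall>i\<in>I. B 0 \<omega> i = 0"
    and increment_distr: "\<And>s t. 0 \<le> s \<Longrightarrow> s < t \<Longrightarrow>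
          distr M (Pi\<^sub>M I (\<lambda>_. borel)) (\<lambda>\<omega>. \<lambda>i\<in>I. B t \<omega> i - B s \<omega> i)
            = Pi\<^sub>M I (\<lambda>_. density lborel (normal_density 0 (sqrt (t - s))))"
    and indep_increments: "\<And>(\<tau> :: nat \<Rightarrow> real) n. 0 \<le> \<tau> 0 \<Longrightarrow> (\<forall>j<n. \<tau> j \<le> \<tau> (Suc j)) \<Longrightarrow>
          indep_vars (\<lambda>_. Pi\<^sub>M I (\<lambda>_. borel))
            (\<lambda>j \<omega>. \<lambda>i\<in>I. B (\<tau> (Suc j)) \<omega> i - B (\<tau> j) \<omega> i) {..<n}"
    and continuous_paths: "AE \<omega> in M. \<forall>i\<in>I. continuous_on {0..} (\<lambda>t. B t \<omega> i)"

text \<open>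
  The path \<open>t \<mapsto> (t, B t)\<close> in \<open>\<real>\<^sup>d\<close>, \<open>d = CARD('d)\<close>, for a process \<open>B\<close> in \<open>\<real>\<^sup>d\<^sup>-\<^sup>1\<close>: the coordinate
  \<open>k\<close> carries the time, the other \<open>d - 1\<close> coordinates, indexed by \<open>- {k}\<close>, carry \<open>B\<close>.
\<close>

definition space_time_path ::
    "'d \<Rightarrow> (real \<Rightarrow> 'w \<Rightarrow> 'd \<Rightarrow> real) \<Rightarrow> 'w \<Rightarrow> real \<Rightarrow> real ^ 'd::finite" where
  "space_time_path k B \<omega> t = (\<chi> i. if i = k then t else B t \<omega> i)"

text \<open>
  Almost every path is continuous, so almost every hull is compact and its volume finite. On the
  exceptional null set \<open>measure\<close> may return a junk value (0 for infinite volume), and the volume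
  need not be measurable with respect to \<open>M\<close> itself. Expectations are therefore to be taken over
  \<open>completion M\<close>; for functions measurable on \<open>M\<close> they agree with those over \<open>M\<close>.
\<close>

definition hull_volume ::
    "'d::finite \<Rightarrow> (real \<Rightarrow> 'w \<Rightarrow> 'd \<Rightarrow> real) \<Rightarrow> 'w \<Rightarrow> real" where
  "hull_volume k B \<omega> =
     measure lebesgue (convex hull (closure (space_time_path k B \<omega> ` {0..1})))"

end

theory Submission
  imports Defs
begin

text \<open>
  Let \<open>S\<close> be a walk with exchangeable increments, \<open>s = S m\<close>, and \<open>K i\<close> the hull of the \<open>m\<close> points
  \<open>S i, \<dots>, S (i + m - 1)\<close> of its periodic extension, \<open>S (i + m) = S i + s\<close>. Adding \<open>S (i + m)\<close> to \<open>K i\<close>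
  replaces its upper boundary, seen along \<open>s\<close>, by that of \<open>K (i + 1)\<close> and keeps the lower one. Over one period
  the volume increments therefore telescope to the volume between \<open>K 0\<close> and \<open>K 0 + s\<close>, which is
  \<open>vol (K 0 + [0, s]) - vol (K 0)\<close>. Averaging over the \<open>m\<close> cyclic shifts and iterating \<open>d\<close> times gives
  \<open>E vol (conv {S 0, \<dots>, S n}) = \<Sum> E |det (S j\<^sub>1, \<dots>, S j\<^sub>d)| / (j\<^sub>1 \<cdots> j\<^sub>d)\<close> over \<open>n \<ge> j\<^sub>1 > \<cdots> > j\<^sub>d \<ge> 1\<close>.

  For space-time Brownian motion at times \<open>0 = t\<^sub>0 < t\<^sub>1 < \<cdots> < t\<^sub>d\<close> the increment matrix has one deterministic
  column of norm \<open>sqrt t\<^sub>d\<close> and \<open>d - 1\<close> standard Gaussian ones, up to the factors \<open>sqrt (t\<^sub>i - t\<^sub>i\<^sub>-\<^sub>1)\<close> of its rows, so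
  rotation invariance evaluates the determinants by means of chi distributions. Along refining grids the sums
  converge to iterated Beta integrals, and the volumes increase to that of the hull of the whole path.
\<close>

section \<open>Volume between upper boundaries\<close>

text \<open>One cyclic average turns a mean hull volume into mean increments of the volume under
  adding \<open>seg s\<close>. To iterate, all mixed differences \<open>mdiff\<close> are treated at
  once, and two facts keep the recursion going: the inclusions behind the telescoping survive the
  addition of a common segment, and the directions already split off are positions of the walk at
  times at least \<open>m\<close>, which rotating the first \<open>m\<close> increments leaves
  fixed. After \<open>d\<close> steps the body no longer matters, because volume has degree
  \<open>d\<close> under Minkowski addition; only parallelepipeds remain.

  For \<open>d = 1\<close> there are no Gaussian columns, so products over the empty index set have
  to be covered. The volume of the full hull is known to be measurable only as an almost sure limit,
  which brings in the completion.

  The constant comes from \<open>chi_mean m * Beta (real m / 2) (3 / 2) = sqrt (2 * pi) / (real m +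
  1)\<close>: chi means from the determinants and Beta values from the sums meet in pairs, and their
  Gamma functions cancel.\<close>

abbreviation vol :: "'a::euclidean_space set \<Rightarrow> real" where
  "vol \<equiv> measure lebesgue"

text \<open>The Minkowski sum of \<open>A\<close> and the ray spanned by \<open>-s\<close>. Upward
  closures need no notion of their own: they are \<open>down (-s) A\<close>.\<close>

definition down :: "'a::euclidean_space \<Rightarrow> 'a set \<Rightarrow> 'a set" where
  "down s A = {x. \<exists>t\<ge>0. x + t *\<^sub>R s \<in> A}"

lemma downI: "x + t *\<^sub>R s \<in> A \<Longrightarrow> 0 \<le> t \<Longrightarrow> x \<in> down s A"
  by (auto simp: down_def)

lemma downE:
  assumes "x \<in> down s A" obtains t where "0 \<le> t" "x + t *\<^sub>R s \<in> A"
  using assms by (auto simp: down_def)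

lemma subset_down: "A \<subseteq> down s A"
  by (auto intro: downI[where t=0])

lemma down_down: "down s (down s A) = down s A"
proof
  show "down s (down s A) \<subseteq> down s A"
  proof
    fix x assume "x \<in> down s (down s A)"
    then obtain t u where "0 \<le> t" "0 \<le> u" "x + t *\<^sub>R s + u *\<^sub>R s \<in> A"
      by (auto elim!: downE)
    then show "x \<in> down s A" by (intro downI[where t="t+u"]) (auto simp: algebra_simps)
  qed
qed (rule subset_down)

lemma down_mono: "A \<subseteq> B \<Longrightarrow> down s A \<subseteq> down s B"
  by (auto simp: down_def)

lemma down_subset_down: "A \<subseteq> down s B \<Longrightarrow> down s A \<subseteq> down s B"
  using down_mono[of A "down s B" s] by (simp add: down_down)

lemma convex_down:
  assumes "convex A" shows "convex (down s A)"
  unfolding convex_def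
proof (intro ballI allI impI)
  fix a b and u v :: real assume "a \<in> down s A" "b \<in> down s A" and uv: "0 \<le> u" "0 \<le> v" "u + v = 1"
  then obtain t r where tr: "0 \<le> t" "a + t *\<^sub>R s \<in> A" "0 \<le> r" "b + r *\<^sub>R s \<in> A"
    by (auto elim!: downE)
  have "u *\<^sub>R (a + t *\<^sub>R s) + v *\<^sub>R (b + r *\<^sub>R s) \<in> A"
    using assms tr uv unfolding convex_def by blast
  then show "u *\<^sub>R a + v *\<^sub>R b \<in> down s A"
    using tr uv by (intro downI[where t="u * t + v * r"]) (auto simp: algebra_simps)
qed

lemma closed_down:
  assumes "compact A" shows "closed (down s A)"
proof (cases "s = 0")
  case True then have "down s A = A" by (auto simp: down_def)
  then show ?thesis using assms by (simp add: compact_imp_closed)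
next
  case False
  have cl: "closed ((\<lambda>t. t *\<^sub>R (-s)) ` {0..})"
    using False by (intro closed_injective_linear_image) (auto simp: inj_on_def linear_iff algebra_simps)
  have "down s A = (\<Union>x\<in>A. \<Union>y\<in>(\<lambda>t. t *\<^sub>R (-s)) ` {0..}. {x + y})"
  proof (intro set_eqI iffI)
    fix x assume "x \<in> down s A"
    then obtain t where "0 \<le> t" "x + t *\<^sub>R s \<in> A" by (rule downE)
    then show "x \<in> (\<Union>x\<in>A. \<Union>y\<in>(\<lambda>t. t *\<^sub>R (-s)) ` {0..}. {x + y})"
      by (auto intro!: bexI[of _ "x + t *\<^sub>R s"] bexI[of _ t])
  next
    fix x assume "x \<in> (\<Union>x\<in>A. \<Union>y\<in>(\<lambda>t. t *\<^sub>R (-s)) ` {0..}. {x + y})"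
    then obtain a t where "a \<in> A" "0 \<le> t" "x = a + t *\<^sub>R (-s)" by auto
    then show "x \<in> down s A" by (intro downI[where t=t]) auto
  qed
  then show ?thesis using compact_closed_sums[OF assms cl] by simp
qed

text \<open>A point of both sets lies on a segment parallel to \<open>s\<close> with its ends
  \<open>x + t *\<^sub>R s\<close> and \<open>x - r *\<^sub>R s\<close> in \<open>A\<close>; the
  weights \<open>r / (t + r)\<close> and \<open>t / (t + r)\<close> make the two displacements
  cancel.\<close>

lemma down_Int_up:
  assumes "convex A" shows "down s A \<inter> down (-s) A = A"
proof
  show "down s A \<inter> down (- s) A \<subseteq> A"
  proof
    fix x assume "x \<in> down s A \<inter> down (- s) A"
    then obtain t r where tr: "0 \<le> t" "x + t *\<^sub>R s \<in> A" "0 \<le> r" "x - r *\<^sub>R s \<in> A"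
      by (auto elim!: downE)
    show "x \<in> A"
    proof (cases "t + r = 0")
      case True with tr have "t = 0" by linarith
      with tr show ?thesis by simp
    next
      case False
      with tr have pos: "t + r > 0" by simp
      have "(r/(t+r)) *\<^sub>R (x + t *\<^sub>R s) + (t/(t+r)) *\<^sub>R (x - r *\<^sub>R s) \<in> A"
        using assms tr pos by (intro convexD) (auto simp: add_divide_distrib[symmetric] add.commute)
      also have "(r/(t+r)) *\<^sub>R (x + t *\<^sub>R s) + (t/(t+r)) *\<^sub>R (x - r *\<^sub>R s)
          = (r/(t+r) + t/(t+r)) *\<^sub>R x + (r/(t+r)*t - t/(t+r)*r) *\<^sub>R s"
        by (simp add: algebra_simps)
      also have "\<dots> = x" using pos by (simp add: add_divide_distrib[symmetric] add.commute)
      finally show ?thesis .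
    qed
  qed
qed (auto intro: subset_down[THEN subsetD])

text \<open>When \<open>below s A B\<close> holds, \<open>A\<close> and \<open>B\<close> have the same shadow along \<open>s\<close> and the upper boundary of \<open>B\<close>
  lies above that of \<open>A\<close>; \<open>gap\<close> is the volume between the two upper boundaries.\<close>

definition below :: "'a::euclidean_space \<Rightarrow> 'a set \<Rightarrow> 'a set \<Rightarrow> bool" where
  "below s A B \<longleftrightarrow> A \<subseteq> down s B \<and> B \<subseteq> down (-s) A"

definition gap :: "'a::euclidean_space \<Rightarrow> 'a set \<Rightarrow> 'a set \<Rightarrow> real" where
  "gap s A B = vol (down s B - down s A)"

text \<open>Down sets have infinite volume in general, so their difference is rewritten as a
  difference of bounded sets. A point under \<open>B\<close> but not under \<open>A\<close> is above
  \<open>A\<close>: the descent \<open>r\<close> from its point of \<open>B\<close> into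
  \<open>A\<close> cannot stop before \<open>x\<close>, hence \<open>r \<ge> t\<close>.\<close>

lemma below_diff:
  assumes "below s A B" "convex A"
  shows "down s B \<inter> down (-s) A - A = down s B - down s A"
proof -
  have "x \<in> down (-s) A" if x: "x \<in> down s B" "x \<notin> down s A" for x
  proof -
    obtain t where t: "0 \<le> t" "x + t *\<^sub>R s \<in> B" using x by (auto elim: downE)
    then have "x + t *\<^sub>R s \<in> down (-s) A" using assms by (auto simp: below_def)
    then obtain r where r: "0 \<le> r" "x + t *\<^sub>R s - r *\<^sub>R s \<in> A" by (auto elim!: downE)
    have "r \<ge> t"
    proof (rule ccontr)
      assume "\<not> r \<ge> t"
      then have "x \<in> down s A" using r by (intro downI[where t="t-r"]) (auto simp: algebra_simps)
      then show False using x by simp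
    qed
    then show ?thesis using r by (intro downI[where t="r-t"]) (auto simp: algebra_simps)
  qed
  then show ?thesis using down_Int_up[OF assms(2), of s] by blast
qed

text \<open>Enlarging both bodies to the convex hull of their union turns the intersection into that
  hull, by \<open>down_Int_up\<close>.\<close>

lemma bounded_down_Int_up:
  assumes "compact A" "compact B" shows "bounded (down s B \<inter> down (-s) A)"
proof -
  have "bounded (convex hull (A \<union> B))"
    using assms by (simp add: bounded_convex_hull compact_imp_bounded)
  moreover have "down s B \<inter> down (-s) A \<subseteq> convex hull (A \<union> B)"
  proof -
    have "down s B \<inter> down (-s) A \<subseteq> down s (convex hull (A \<union> B)) \<inter> down (-s) (convex hull (A \<union> B))"
      by (intro Int_mono down_mono) (auto intro: hull_inc)
    then show ?thesis using down_Int_up[of "convex hull (A \<union> B)" s] by simp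
  qed
  ultimately show ?thesis using bounded_subset by blast
qed

lemma lmeasurable_down_Int_up:
  assumes "compact A" "compact B" shows "down s B \<inter> down (-s) A \<in> lmeasurable"
proof -
  have "closed (down s B \<inter> down (-s) A)"
    by (intro closed_Int closed_down assms)
  then show ?thesis
    using bounded_down_Int_up[OF assms] by (intro lmeasurable_compact) (simp add: compact_eq_bounded_closed)
qed

lemma lmeasurable_gap:
  assumes "below s A B" "convex A" "compact A" "compact B"
  shows "down s B - down s A \<in> lmeasurable"
  unfolding below_diff[OF assms(1,2), symmetric]
  by (intro fmeasurable.Diff lmeasurable_down_Int_up lmeasurable_compact assms)

lemma vol_below:
  assumes "below s A B" "convex A" "compact A" "compact B"
  shows "vol (down s B \<inter> down (-s) A) = vol A + gap s A B"
proof -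
  have sub: "A \<subseteq> down s B \<inter> down (-s) A"
    using assms(1) subset_down[of A "-s"] by (auto simp: below_def)
  have "gap s A B = vol (down s B \<inter> down (-s) A - A)"
    by (simp add: gap_def below_diff[OF assms(1,2)])
  also have "\<dots> = vol (down s B \<inter> down (-s) A) - vol A"
    using sub assms by (intro measurable_measure_Diff lmeasurable_down_Int_up lmeasurable_compact)
      (auto intro: fmeasurableD lmeasurable_compact)
  finally show ?thesis by simp
qed

lemma below_down_mono: "below s A B \<Longrightarrow> down s A \<subseteq> down s B"
  unfolding below_def by (blast dest: down_subset_down)

lemma below_trans:
  assumes "below s A B" "below s B C" shows "below s A C"
proof -
  have "A \<subseteq> down s C"
    using assms(1) below_down_mono[OF assms(2)] by (auto simp: below_def)
  moreover have "down (-s) B \<subseteq> down (-s) A"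
    using assms(1) by (intro down_subset_down) (simp add: below_def)
  then have "C \<subseteq> down (-s) A" using assms(2) by (auto simp: below_def)
  ultimately show ?thesis by (simp add: below_def)
qed

lemma gap_trans:
  assumes "below s A B" "below s B C" "convex A" "compact A" "convex B" "compact B" "compact C"
  shows "gap s A C = gap s A B + gap s B C"
proof -
  have "down s C - down s A = (down s B - down s A) \<union> (down s C - down s B)"
    using below_down_mono[OF assms(1)] below_down_mono[OF assms(2)] by blast
  then have "gap s A C = vol ((down s B - down s A) \<union> (down s C - down s B))"
    by (simp add: gap_def)
  also have "\<dots> = gap s A B + gap s B C"
    unfolding gap_def by (rule measure_Un2[THEN trans])
      (use assms in \<open>auto intro!: lmeasurable_gap arg_cong[where f=vol]\<close>)
  finally show ?thesis .
qed

lemma down_plus: "down s ((+) a ` A) = (+) a ` down s A"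
proof (intro set_eqI iffI)
  fix x assume "x \<in> down s ((+) a ` A)"
  then obtain t y where "0 \<le> t" "x + t *\<^sub>R s = a + y" "y \<in> A" by (auto elim!: downE)
  then have "x - a \<in> down s A" by (intro downI[where t=t]) (auto simp: algebra_simps)
  then show "x \<in> (+) a ` down s A" by (auto intro!: image_eqI[of _ _ "x - a"])
qed (auto elim!: downE intro!: downI simp: add.assoc)

lemma gap_plus: "gap s ((+) a ` A) ((+) a ` B) = gap s A B"
proof -
  have "(+) a ` down s B - (+) a ` down s A = (+) a ` (down s B - down s A)"
    by (rule image_set_diff[symmetric]) simp
  then show ?thesis unfolding gap_def down_plus by (simp add: measure_translation)
qed

lemma below_plus: "below s ((+) a ` A) ((+) a ` B) \<longleftrightarrow> below s A B"
  unfolding below_def down_plus by (auto simp: inj_image_subset_iff)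

section \<open>Mixed differences of the volume\<close>

abbreviation seg :: "'a::euclidean_space \<Rightarrow> 'a set" where
  "seg \<equiv> closed_segment 0"

text \<open>Iterated finite differences of the volume under Minkowski addition of segments. Since
  volume is polynomial of degree \<open>d\<close> for that addition, \<open>d\<close> differences
  give \<open>d!\<close> times the mixed volume of the segments.\<close>

fun mdiff :: "'a::euclidean_space list \<Rightarrow> 'a set \<Rightarrow> real" where
  "mdiff [] A = vol A"
| "mdiff (s # ss) A = mdiff ss (A + seg s) - mdiff ss A"

definition body :: "'a::euclidean_space set \<Rightarrow> bool" where
  "body A \<longleftrightarrow> compact A \<and> convex A"

lemma body_hull: "finite S \<Longrightarrow> body (convex hull S)"
  by (simp add: body_def compact_convex_hull finite_imp_compact)

lemma body_seg: "body (seg s)"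
  by (simp add: body_def)

lemma body_singleton: "body {a}"
  by (simp add: body_def)

lemma body_plus:
  assumes "body A" "body B" shows "body (A + B)"
proof -
  have "A + B = {x + y | x y. x \<in> A \<and> y \<in> B}" by (auto simp: set_plus_def)
  then have "compact (A + B)" using assms compact_sums[of A B] by (simp add: body_def)
  then show ?thesis using assms by (simp add: body_def convex_set_plus)
qed

lemma singleton_plus: "{a} + A = (+) a ` A" for A :: "'a::euclidean_space set"
  by (auto simp: set_plus_def)

lemma mem_seg: "x \<in> seg s \<longleftrightarrow> (\<exists>u. 0 \<le> u \<and> u \<le> 1 \<and> x = u *\<^sub>R s)"
  by (auto simp: in_segment)

lemma mdiff_swap: "mdiff (s # t # ss) A = mdiff (t # s # ss) A"
  by (simp add: ac_simps)

lemma mdiff_translate: "mdiff ss ({a} + A) = mdiff ss A"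
proof (induction ss arbitrary: A)
  case Nil
  then show ?case by (simp add: singleton_plus measure_translation)
next
  case (Cons s ss)
  then show ?case by (simp add: add.assoc)
qed

text \<open>This inclusion lets the hypotheses of the telescoping survive the addition of a segment
  to all bodies.\<close>

lemma down_set_plus: "down s A + C \<subseteq> down s (A + C)"
  by (auto simp: down_def set_plus_def algebra_simps) (metis add.assoc add.commute)

lemma below_translate: "below s A ({s} + A)"
  unfolding below_def singleton_plus by (auto intro: downI[where t=1])

text \<open>The body \<open>A + seg s\<close> has the lower boundary of \<open>A\<close> and the
  upper boundary of its translate, so \<open>vol_below\<close> applies to this pair.\<close>

lemma mdiff_single:
  assumes "body A" shows "mdiff [s] A = gap s A ({s} + A)"
proof -
  have "down s ({s} + A) \<inter> down (-s) A = A + seg s"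
  proof
    show "down s ({s} + A) \<inter> down (-s) A \<subseteq> A + seg s"
    proof
      fix x assume x: "x \<in> down s ({s} + A) \<inter> down (-s) A"
      then obtain t a where t: "0 \<le> t" "x + t *\<^sub>R s = s + a" "a \<in> A"
        by (auto elim!: downE simp: singleton_plus)
      show "x \<in> A + seg s"
      proof (cases "t \<le> 1")
        case True
        then have "x = a + (1 - t) *\<^sub>R s" "(1 - t) *\<^sub>R s \<in> seg s"
          using t by (auto simp: algebra_simps mem_seg intro!: exI[of _ "1-t"])
        then show ?thesis using t by (auto simp: set_plus_def)
      next
        \<comment> \<open>More than one step \<open>s\<close> below a point of the translate means
          already below \<open>A\<close>; being above \<open>A\<close> too, the point lies in
          \<open>A\<close>.\<close>
        case False
        then have "x \<in> down s A" using t by (intro downI[where t="t-1"]) (auto simp: algebra_simps)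
        then have "x \<in> A" using x down_Int_up[of A s] assms by (auto simp: body_def)
        then have "x + 0 \<in> A + seg s" by (intro set_plus_intro) auto
        then show ?thesis by simp
      qed
    qed
    show "A + seg s \<subseteq> down s ({s} + A) \<inter> down (-s) A"
    proof
      fix x assume "x \<in> A + seg s"
      then obtain a u where u: "a \<in> A" "0 \<le> u" "u \<le> 1" "x = a + u *\<^sub>R s"
        by (auto simp: set_plus_def mem_seg)
      then show "x \<in> down s ({s} + A) \<inter> down (-s) A"
        by (auto intro!: downI[where t="1-u" and s=s] downI[where t=u and s="-s"]
            simp: singleton_plus algebra_simps)
    qed
  qed
  then show ?thesis
    using vol_below[OF below_translate[of s A]] assms body_plus[OF body_singleton assms, of s]
    by (simp add: body_def)
qed

text \<open>The inclusions pin \<open>H i\<close> down as the body with the lower boundary of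
  \<open>A i\<close> and the upper boundary of \<open>A (Suc i)\<close>, so each summand is a gap,
  and gaps add up. They are stated as inclusions, not through hulls, because this form is stable
  under adding segments.\<close>

lemma vol_telescope:
  assumes body: "\<And>i. body (A i)" "\<And>i. body (H i)"
    and sub: "\<And>i. A i \<subseteq> H i" "\<And>i. A (Suc i) \<subseteq> H i"
      "\<And>i. H i \<subseteq> down s (A (Suc i))" "\<And>i. H i \<subseteq> down (-s) (A i)"
    and period: "A n = {s} + A 0"
  shows "(\<Sum>i<n. vol (H i) - vol (A i)) = mdiff [s] (A 0)"
proof -
  have bel: "below s (A i) (A (Suc i))" for i
    using sub unfolding below_def by blast
  have H: "H i = down s (A (Suc i)) \<inter> down (-s) (A i)" for i
  proof
    have "down s (A (Suc i)) \<inter> down (-s) (A i) \<subseteq> down s (H i) \<inter> down (-s) (H i)"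
      using sub by (intro Int_mono down_mono) auto
    also have "\<dots> = H i" using down_Int_up[of "H i" s] body by (simp add: body_def)
    finally show "down s (A (Suc i)) \<inter> down (-s) (A i) \<subseteq> H i" .
  qed (use sub in auto)
  have "vol (H i) - vol (A i) = gap s (A i) (A (Suc i))" for i
    unfolding H using vol_below[OF bel[of i]] body by (simp add: body_def)
  moreover have "below s (A 0) (A m) \<and> gap s (A 0) (A m) = (\<Sum>i<m. gap s (A i) (A (Suc i)))" for m
  proof (induction m)
    case 0
    have "below s (A 0) (A 0)" using subset_down by (auto simp: below_def)
    then show ?case by (simp add: gap_def)
  next
    case (Suc m)
    then show ?case
      using gap_trans[of s "A 0" "A m" "A (Suc m)"] bel[of m] below_trans body by (auto simp: body_def)
  qed
  ultimately have "(\<Sum>i<n. vol (H i) - vol (A i)) = gap s (A 0) (A n)" by simp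
  also have "\<dots> = mdiff [s] (A 0)" unfolding period by (rule mdiff_single[symmetric, OF body(1)])
  finally show ?thesis .
qed

text \<open>Each further direction \<open>t\<close> uses the induction hypothesis twice, for the
  given bodies and for their sums with \<open>seg t\<close>, and subtracts.\<close>

lemma mdiff_telescope:
  assumes body: "\<And>i. body (A i)" "\<And>i. body (H i)"
    and sub: "\<And>i. A i \<subseteq> H i" "\<And>i. A (Suc i) \<subseteq> H i"
      "\<And>i. H i \<subseteq> down s (A (Suc i))" "\<And>i. H i \<subseteq> down (-s) (A i)"
    and period: "A n = {s} + A 0"
  shows "(\<Sum>i<n. mdiff ss (H i) - mdiff ss (A i)) = mdiff (s # ss) (A 0)"
  using assms
proof (induction ss arbitrary: A H)
  case Nil
  then show ?case using vol_telescope[of A H s n] by simp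
next
  case (Cons t ss)
  have "(\<Sum>i<n. mdiff ss (H i + seg t) - mdiff ss (A i + seg t)) = mdiff (s # ss) (A 0 + seg t)"
  proof (rule Cons.IH)
    fix i
    show "body (A i + seg t)" "body (H i + seg t)"
      using Cons.prems by (auto intro: body_plus body_seg)
    show "A i + seg t \<subseteq> H i + seg t" "A (Suc i) + seg t \<subseteq> H i + seg t"
      by (intro set_plus_mono2 order_refl Cons.prems)+
    show "H i + seg t \<subseteq> down s (A (Suc i) + seg t)" "H i + seg t \<subseteq> down (- s) (A i + seg t)"
      using Cons.prems set_plus_mono2[OF _ order_refl, of "H i" _ "seg t"] down_set_plus
      by (meson order_trans)+
    show "A n + seg t = {s} + (A 0 + seg t)" using Cons.prems(7) by (simp add: add.assoc)
  qed
  moreover have "(\<Sum>i<n. mdiff ss (H i) - mdiff ss (A i)) = mdiff (s # ss) (A 0)"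
    using Cons.prems by (rule Cons.IH)
  ultimately have "(\<Sum>i<n. mdiff (t # ss) (H i) - mdiff (t # ss) (A i)) = mdiff (t # s # ss) (A 0)"
    by (simp add: sum_subtractf)
  then show ?case by (simp only: mdiff_swap)
qed

text \<open>\<open>A i\<close> and \<open>A (Suc i)\<close> arise from \<open>H i\<close> by
  dropping \<open>T (i + n)\<close> or \<open>T i\<close>. These two points differ by
  \<open>s\<close>, so the dropped one stays above, respectively below, a kept one, and the
  telescoping applies.\<close>

lemma mdiff_cyclic:
  fixes T :: "nat \<Rightarrow> 'a::euclidean_space"
  assumes period: "\<And>i. T (i + n) = T i + s" and n: "0 < n"
  shows "(\<Sum>i<n. mdiff ss (convex hull (T ` {i..i+n})) - mdiff ss (convex hull (T ` {i..<i+n})))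
    = mdiff (s # ss) (convex hull (T ` {0..<n}))"
proof -
  define A where "A i = convex hull (T ` {i..<i+n})" for i
  define H where "H i = convex hull (T ` {i..i+n})" for i
  have "(\<Sum>i<n. mdiff ss (H i) - mdiff ss (A i)) = mdiff (s # ss) (A 0)"
  proof (rule mdiff_telescope)
    fix i
    show "body (A i)" "body (H i)" by (simp_all add: A_def H_def body_hull)
    show "A i \<subseteq> H i" "A (Suc i) \<subseteq> H i" unfolding A_def H_def by (intro hull_mono image_mono; auto)+
    have cx: "convex (A i)" for i by (simp add: A_def)
    have mem: "T j \<in> A i" if "i \<le> j" "j < i + n" for i j
      using that unfolding A_def by (intro hull_inc) auto
    have "T j \<in> down s (A (Suc i))" if "i \<le> j" "j \<le> i + n" for j
    proof (cases "j = i")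
      case True
      then show ?thesis using period[of i] n by (intro downI[where t=1]) (auto intro!: mem simp flip: period)
    next
      case False
      then show ?thesis using that subset_down[of "A (Suc i)" s] mem[of "Suc i" j] by auto
    qed
    then show "H i \<subseteq> down s (A (Suc i))"
      unfolding H_def by (intro hull_minimal convex_down cx) auto
    have "T j \<in> down (-s) (A i)" if "i \<le> j" "j \<le> i + n" for j
    proof (cases "j = i + n")
      case True
      then show ?thesis using period[of i] n by (intro downI[where t=1]) (auto intro!: mem)
    next
      case False
      then show ?thesis using that subset_down[of "A i" "-s"] mem[of i j] by auto
    qed
    then show "H i \<subseteq> down (-s) (A i)"
      unfolding H_def by (intro hull_minimal convex_down cx) auto
  next
    have "T ` {n..<n + n} = (+) s ` T ` {0..<n}"
    proof -
      have "{n..<n + n} = (\<lambda>i. i + n) ` {0..<n}" by (simp add: image_add_atLeastLessThan')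
      then have "T ` {n..<n + n} = (\<lambda>i. T (i + n)) ` {0..<n}" by (simp only: image_image)
      also have "(\<lambda>i. T (i + n)) = (\<lambda>i. s + T i)" by (simp only: period add.commute)
      finally show ?thesis by (simp only: image_image)
    qed
    then show "A n = {s} + A 0" by (simp add: A_def convex_hull_translation singleton_plus)
  qed
  then show ?thesis by (simp add: A_def H_def)
qed

section \<open>Bounded displacements along the differencing directions\<close>

definition eqmod :: "'a::euclidean_space \<Rightarrow> 'a set \<Rightarrow> 'a set \<Rightarrow> bool" where
  "eqmod s A B \<longleftrightarrow> (\<exists>N. (\<forall>a\<in>A. \<exists>t. \<bar>t\<bar> \<le> N \<and> a + t *\<^sub>R s \<in> B) \<and> (\<forall>b\<in>B. \<exists>t. \<bar>t\<bar> \<le> N \<and> b + t *\<^sub>R s \<in> A))"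

lemma eqmod_plus:
  assumes "eqmod s A B" shows "eqmod s (A + C) (B + C)"
proof -
  have *: "\<exists>t. \<bar>t\<bar> \<le> N \<and> x + t *\<^sub>R s \<in> B + C"
    if *: "\<forall>a\<in>A. \<exists>t. \<bar>t\<bar> \<le> N \<and> a + t *\<^sub>R s \<in> B" "x \<in> A + C" for N x and A B :: "'a set"
  proof -
    obtain a c where ac: "x = a + c" "a \<in> A" "c \<in> C" using \<open>x \<in> A + C\<close> by (rule set_plus_elim)
    then obtain t where "\<bar>t\<bar> \<le> N" "a + t *\<^sub>R s \<in> B" using *(1) by blast
    then show ?thesis using ac set_plus_intro[of "a + t *\<^sub>R s" B c C]
      by (auto simp: algebra_simps intro!: exI[of _ t])
  qed
  obtain N where N: "\<forall>a\<in>A. \<exists>t. \<bar>t\<bar> \<le> N \<and> a + t *\<^sub>R s \<in> B"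
    "\<forall>b\<in>B. \<exists>t. \<bar>t\<bar> \<le> N \<and> b + t *\<^sub>R s \<in> A"
    using assms unfolding eqmod_def by blast
  show ?thesis unfolding eqmod_def
    by (intro exI[of _ N] conjI ballI *[OF N(1)] *[OF N(2)])
qed

lemma gap_translate: "gap s ({a} + A) ({a} + B) = gap s A B"
  unfolding singleton_plus by (rule gap_plus)

text \<open>Going from \<open>A\<close> up to \<open>{s} + B'\<close> through \<open>B'\<close> or
  through \<open>{s} + A\<close> crosses the same total gap. The gaps from \<open>A\<close> to
  \<open>B'\<close> and from \<open>{s} + A\<close> to \<open>{s} + B'\<close> are translates of
  each other, so the other two agree.\<close>

lemma mdiff_single_eqmod:
  assumes "eqmod s A B" "body A" "body B" shows "mdiff [s] A = mdiff [s] B"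
proof -
  obtain N where N: "\<And>a. a \<in> A \<Longrightarrow> \<exists>t. \<bar>t\<bar> \<le> N \<and> a + t *\<^sub>R s \<in> B"
    "\<And>b. b \<in> B \<Longrightarrow> \<exists>t. \<bar>t\<bar> \<le> N \<and> b + t *\<^sub>R s \<in> A"
    using assms(1) unfolding eqmod_def by blast
  \<comment> \<open>All displacements are at most \<open>N\<close>, so this shift puts
    \<open>B'\<close> above \<open>A\<close>, as \<open>below s A B'\<close> demands; gaps do not
    notice translations.\<close>
  define B' where "B' = {N *\<^sub>R s} + B"
  have bodies: "body A" "body B'" "body ({s} + A)" "body ({s} + B')"
    unfolding B'_def by (intro assms body_plus body_singleton)+
  have "A \<subseteq> down s B'"
  proof
    fix a assume "a \<in> A"
    then obtain t where "\<bar>t\<bar> \<le> N" "a + t *\<^sub>R s \<in> B" using N by blast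
    moreover from this have "N *\<^sub>R s + (a + t *\<^sub>R s) \<in> B'"
      unfolding B'_def by (intro set_plus_intro) auto
    ultimately show "a \<in> down s B'"
      by (intro downI[where t="t+N"]) (auto simp: algebra_simps)
  qed
  moreover have "B' \<subseteq> down (-s) A"
  proof
    fix x assume "x \<in> B'"
    then obtain b where b: "b \<in> B" "x = N *\<^sub>R s + b" by (auto simp: B'_def singleton_plus)
    then obtain t where "\<bar>t\<bar> \<le> N" "b + t *\<^sub>R s \<in> A" using N by blast
    then show "x \<in> down (-s) A" using b
      by (intro downI[where t="N-t"]) (auto simp: algebra_simps)
  qed
  ultimately have AB: "below s A B'" by (simp add: below_def)
  have AB': "below s ({s} + A) ({s} + B')"
    using AB unfolding singleton_plus below_plus .
  have "gap s A B' + gap s B' ({s} + B') = gap s A ({s} + B')"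
    by (rule gap_trans[symmetric]) (use AB below_translate bodies in \<open>auto simp: body_def\<close>)
  also have "\<dots> = gap s A ({s} + A) + gap s ({s} + A) ({s} + B')"
    by (rule gap_trans) (use AB' below_translate bodies in \<open>auto simp: body_def\<close>)
  finally have "gap s B' ({s} + B') = gap s A ({s} + A)"
    by (simp add: gap_translate)
  moreover have "gap s B' ({s} + B') = gap s ({N *\<^sub>R s} + B) ({N *\<^sub>R s} + ({s} + B))"
    by (simp add: B'_def ac_simps)
  ultimately show ?thesis using assms by (simp add: mdiff_single gap_translate del: mdiff.simps)
qed

lemma mdiff_Cons_eqmod:
  assumes "eqmod s A B" "body A" "body B" shows "mdiff (s # ss) A = mdiff (s # ss) B"
  using assms
proof (induction ss arbitrary: A B)
  case Nil
  then show ?case by (rule mdiff_single_eqmod)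
next
  case (Cons t ss)
  have "mdiff (s # ss) (A + seg t) = mdiff (s # ss) (B + seg t)"
    using Cons.prems by (intro Cons.IH eqmod_plus body_plus body_seg)
  moreover have "mdiff (s # ss) A = mdiff (s # ss) B" using Cons.prems by (rule Cons.IH)
  ultimately have "mdiff (t # s # ss) A = mdiff (t # s # ss) B" by simp
  then show ?case by (simp only: mdiff_swap)
qed

lemma mdiff_remove1: "s \<in> set ss \<Longrightarrow> mdiff ss A = mdiff (s # remove1 s ss) A"
proof (induction ss arbitrary: A)
  case (Cons t ss)
  show ?case
  proof (cases "s = t")
    case False
    then have "mdiff (t # ss) A = mdiff (t # s # remove1 s ss) A"
      using Cons.IH[of "A + seg t"] Cons.IH[of A] Cons.prems by (simp del: mdiff.simps(2) add: mdiff.simps(2)[of t])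
    also have "\<dots> = mdiff (s # t # remove1 s ss) A" by (rule mdiff_swap)
    finally show ?thesis using False by (simp del: mdiff.simps)
  qed simp
qed simp

lemma mdiff_eqmod:
  assumes "eqmod s A B" "body A" "body B" "s \<in> set ss" shows "mdiff ss A = mdiff ss B"
proof -
  have "mdiff ss A = mdiff (s # remove1 s ss) A" by (rule mdiff_remove1[OF assms(4)])
  also have "\<dots> = mdiff (s # remove1 s ss) B" by (rule mdiff_Cons_eqmod[OF assms(1-3)])
  also have "\<dots> = mdiff ss B" by (rule mdiff_remove1[OF assms(4), symmetric])
  finally show ?thesis .
qed

text \<open>Adding \<open>c *\<^sub>R y\<close> to the direction moves the points of the segment
  along \<open>y\<close> by factors of size at most \<open>\<bar>c\<bar>\<close>. As
  \<open>y\<close> is one of the differencing directions, \<open>mdiff_eqmod\<close>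
  applies.\<close>

lemma mdiff_plus_seg_span:
  assumes "x \<in> span (set ss)" "body A"
  shows "mdiff ss (A + seg (w + x)) = mdiff ss (A + seg w)"
  using assms(1)
proof (induction arbitrary: w rule: span_induct_alt)
  case base
  then show ?case by simp
next
  case (step c y x)
  have *: "eqmod y (seg (w + c *\<^sub>R y + x)) (seg (w + x))"
    unfolding eqmod_def
  proof (rule exI[of _ "\<bar>c\<bar>"], intro conjI ballI)
    fix a assume "a \<in> seg (w + c *\<^sub>R y + x)"
    then obtain u where "0 \<le> u" "u \<le> 1" "a = u *\<^sub>R (w + c *\<^sub>R y + x)" by (auto simp: mem_seg)
    then show "\<exists>t. \<bar>t\<bar> \<le> \<bar>c\<bar> \<and> a + t *\<^sub>R y \<in> seg (w + x)"
      by (intro exI[of _ "-u*c"]) (auto simp: mem_seg algebra_simps abs_mult mult_left_le_one_le intro!: exI[of _ u])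
  next
    fix a assume "a \<in> seg (w + x)"
    then obtain u where "0 \<le> u" "u \<le> 1" "a = u *\<^sub>R (w + x)" by (auto simp: mem_seg)
    then show "\<exists>t. \<bar>t\<bar> \<le> \<bar>c\<bar> \<and> a + t *\<^sub>R y \<in> seg (w + c *\<^sub>R y + x)"
      by (intro exI[of _ "u*c"]) (auto simp: mem_seg algebra_simps abs_mult mult_left_le_one_le intro!: exI[of _ u])
  qed
  have "mdiff ss (seg (w + c *\<^sub>R y + x) + A) = mdiff ss (seg (w + x) + A)"
    using step.hyps(1) by (intro mdiff_eqmod[OF eqmod_plus[OF *]] body_plus body_seg assms)
  then have "mdiff ss (A + seg (w + (c *\<^sub>R y + x))) = mdiff ss (A + seg (w + x))"
    by (simp only: add.assoc add.commute[of A])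
  then show ?case using step.IH[of w] by (simp only:)
qed

section \<open>Zonotopes\<close>

primrec zon :: "'a::euclidean_space list \<Rightarrow> 'a set" where
  "zon [] = {0}"
| "zon (s # ss) = seg s + zon ss"

lemma plus_singleton_0: "A + {0} = A" "{0} + A = A" for A :: "'a::euclidean_space set"
  by (auto simp: set_plus_def)

lemma zon_append: "zon (ss @ ts) = zon ss + zon ts"
  by (induction ss) (simp_all add: plus_singleton_0 add.assoc)

lemma zon_subset_span: "zon ss \<subseteq> span (set ss)"
proof (induction ss)
  case (Cons s ss)
  show ?case
  proof
    fix x assume "x \<in> zon (s # ss)"
    then obtain a b where ab: "x = a + b" "a \<in> seg s" "b \<in> zon ss"
      by (auto elim: set_plus_elim)
    have "a \<in> span (set (s # ss))"
      using ab(2) by (auto simp: mem_seg intro: span_scale span_base)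
    moreover have "b \<in> span (set (s # ss))"
      using ab(3) Cons.IH span_mono[of "set ss" "set (s # ss)"] by auto
    ultimately show "x \<in> span (set (s # ss))" using ab(1) by (simp add: span_add)
  qed
qed simp

lemma vol_zon_lowdim:
  fixes ss :: "'a::euclidean_space list"
  assumes "length ss < DIM('a)" shows "vol (zon ss) = 0"
proof -
  have "dim (zon ss) \<le> card (set ss)"
    using zon_subset_span[of ss] by (intro dim_le_card) auto
  also have "\<dots> \<le> length ss" by (rule card_length)
  finally have "negligible (zon ss)" using assms by (intro negligible_lowdim) simp
  then show ?thesis by (simp add: negligible_imp_measure0)
qed

lemma mdiff_zon_lowdim:
  fixes ss :: "'a::euclidean_space list"
  assumes "length ss + length ts < DIM('a)" shows "mdiff ss (zon ts) = 0"
  using assms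
proof (induction ss arbitrary: ts)
  case Nil
  then show ?case by (simp add: vol_zon_lowdim)
next
  case (Cons s ss)
  then show ?case using Cons.IH[of "s # ts"] Cons.IH[of ts] by (simp add: add.commute)
qed

text \<open>In the expansion of the differences only the term with every segment added has
  \<open>d\<close> generators; the others vanish by \<open>mdiff_zon_lowdim\<close>.\<close>

lemma mdiff_zon:
  fixes ss :: "'a::euclidean_space list"
  assumes "length ss + length ts = DIM('a)" shows "mdiff ss (zon ts) = vol (zon (ss @ ts))"
  using assms
proof (induction ss arbitrary: ts)
  case (Cons s ss)
  then show ?case using Cons.IH[of "s # ts"] mdiff_zon_lowdim[of ss ts]
    by (simp add: zon_append ac_simps)
qed simp

lemma mdiff_singleton_lowdim:
  fixes ss :: "'a::euclidean_space list"
  assumes "length ss < DIM('a)" shows "mdiff ss {a} = 0"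
  using mdiff_zon_lowdim[of ss "[]"] assms mdiff_translate[of ss a "{0}"] by (simp add: plus_singleton_0)

lemma mdiff_0:
  fixes ss :: "'a::euclidean_space list"
  assumes "length ss = DIM('a)" shows "mdiff ss {0} = vol (zon ss)"
  using mdiff_zon[of ss "[]"] assms by simp

lemma mdiff_Cons_span:
  assumes "x \<in> span (set ss)" "body A"
  shows "mdiff ((s + x) # ss) A = mdiff (s # ss) A"
  using mdiff_plus_seg_span[OF assms, of s] by simp

section \<open>Mixed differences of full length\<close>

lemma mdiff_dependent:
  assumes "a \<in> set ss" "a \<in> span (set (remove1 a ss))" "body A"
  shows "mdiff ss A = 0"
proof -
  have "mdiff ss A = mdiff ((0 + a) # remove1 a ss) A"
    using mdiff_remove1[OF assms(1)] by (simp del: mdiff.simps)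
  also have "\<dots> = mdiff (0 # remove1 a ss) A" by (rule mdiff_Cons_span[OF assms(2,3)])
  finally show ?thesis by (simp add: plus_singleton_0)
qed

text \<open>The coordinates of the body with respect to the basis are erased one after another.
  Erasing the coordinate along \<open>y\<close> displaces points boundedly along \<open>y\<close>,
  which is a differencing direction, and in the end \<open>K\<close> has shrunk to the
  origin.\<close>

lemma mdiff_basis:
  assumes ind: "independent B" and sp: "span B = UNIV" and B: "B = set ss" and K: "body K" "K \<noteq> {}"
  shows "mdiff ss K = mdiff ss {0}"
proof -
  define pr where "pr S x = x - (\<Sum>y\<in>S. representation B x y *\<^sub>R y)" for S x
  have lin1: "linear (\<lambda>x. representation B x y)" for y
    by (rule linearI) (simp_all add: representation_add representation_scale ind sp)
  have lin: "linear (pr S)" for S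
    by (rule linearI) (simp_all add: pr_def representation_add representation_scale ind sp sum.distrib
        scaleR_left_distrib scaleR_sum_right algebra_simps)
  have bd: "body (pr S ` K)" for S
    using K lin[of S] unfolding body_def
    by (auto intro!: convex_linear_image compact_continuous_image linear_continuous_on linear_conv_bounded_linear[THEN iffD1])
  have fin: "finite B" by (simp add: B)
  have "mdiff ss (pr S ` K) = mdiff ss K" if "S \<subseteq> B" for S
    using finite_subset[OF that fin] that
  proof (induction S rule: finite_induct)
    case empty
    then show ?case by (simp add: pr_def)
  next
    case (insert y S)
    have "bounded ((\<lambda>x. representation B x y) ` K)"
      using K lin1 by (intro bounded_linear_image) (auto simp: body_def compact_imp_bounded linear_conv_bounded_linear)
    then obtain N where N: "\<And>x. x \<in> K \<Longrightarrow> \<bar>representation B x y\<bar> \<le> N"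
      by (auto simp: bounded_iff)
    have step: "pr (insert y S) x = pr S x - representation B x y *\<^sub>R y" for x
      using insert.hyps by (simp add: pr_def algebra_simps)
    have "eqmod y (pr (insert y S) ` K) (pr S ` K)"
      unfolding eqmod_def
    proof (rule exI[of _ N], intro conjI ballI)
      fix a assume "a \<in> pr (insert y S) ` K"
      then obtain x where "x \<in> K" "a = pr (insert y S) x" by auto
      then show "\<exists>t. \<bar>t\<bar> \<le> N \<and> a + t *\<^sub>R y \<in> pr S ` K"
        using N by (intro exI[of _ "representation B x y"]) (auto simp: step)
    next
      fix a assume "a \<in> pr S ` K"
      then obtain x where "x \<in> K" "a = pr S x" by auto
      then show "\<exists>t. \<bar>t\<bar> \<le> N \<and> a + t *\<^sub>R y \<in> pr (insert y S) ` K"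
        using N by (intro exI[of _ "-representation B x y"]) (auto simp: step)
    qed
    then have "mdiff ss (pr (insert y S) ` K) = mdiff ss (pr S ` K)"
      using insert.prems B by (intro mdiff_eqmod bd) auto
    then show ?case using insert by simp
  qed
  from this[of B] have "mdiff ss (pr B ` K) = mdiff ss K" by simp
  moreover have "pr B x = 0" for x
    using sum_representation_eq[OF ind, of x B] fin by (simp add: pr_def sp)
  then have "pr B ` K = {0}" using K by auto
  ultimately show ?thesis by simp
qed

text \<open>If the directions are dependent, both sides vanish; otherwise they form a basis.\<close>

lemma mdiff_full:
  fixes ss :: "'a::euclidean_space list"
  assumes "length ss = DIM('a)" "body K" "K \<noteq> {}"
  shows "mdiff ss K = vol (zon ss)"
proof (cases "\<exists>a\<in>set ss. a \<in> span (set (remove1 a ss))")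
  case True
  then obtain a where a: "a \<in> set ss" "a \<in> span (set (remove1 a ss))" by blast
  show ?thesis
    using mdiff_dependent[OF a assms(2)] mdiff_dependent[OF a body_singleton[of 0]] mdiff_0[OF assms(1)] by simp
next
  case False
  \<comment> \<open>\<open>remove1\<close> deletes one occurrence only, so a repeated direction
    would already count as dependent.\<close>
  have d: "distinct ss"
  proof (rule ccontr)
    assume "\<not> distinct ss"
    then obtain xs y ys zs where "ss = xs @ [y] @ ys @ [y] @ zs" using not_distinct_decomp by blast
    then have "y \<in> set ss" "y \<in> set (remove1 y ss)" by (auto simp: remove1_append)
    then show False using False span_base by blast
  qed
  have ind: "independent (set ss)"
    unfolding dependent_def using False d by (auto simp: set_remove1_eq)
  have "dim (set ss) = DIM('a)"
    using ind d assms(1) by (simp add: dim_eq_card_independent distinct_card)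
  then have "span (set ss) = UNIV" by (simp add: dim_eq_full)
  then show ?thesis using mdiff_basis[OF ind _ refl assms(2,3)] mdiff_0[OF assms(1)] by simp
qed

lemma vol_zon_Cons_span:
  fixes ss :: "'a::euclidean_space list"
  assumes "x \<in> span (set ss)" "Suc (length ss) = DIM('a)"
  shows "vol (zon ((s + x) # ss)) = vol (zon (s # ss))"
  using mdiff_Cons_span[OF assms(1) body_singleton, of s 0] assms(2) by (simp add: mdiff_0 del: mdiff.simps zon.simps)

primrec psums :: "'a::monoid_add \<Rightarrow> 'a list \<Rightarrow> 'a list" where
  "psums a [] = []"
| "psums a (x # xs) = (a + x) # psums (a + x) xs"

lemma length_psums [simp]: "length (psums a xs) = length xs"
  by (induction xs arbitrary: a) auto

text \<open>Column operations: each partial sum is the next increment plus the preceding partial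
  sum, which lies in the span of the generators already treated. The list \<open>ts\<close> collects
  these generators.\<close>

lemma vol_zon_psums:
  fixes ts :: "'a::euclidean_space list"
  assumes "a \<in> span (set ts)" "length ts + length xs = DIM('a)"
  shows "vol (zon (ts @ psums a xs)) = vol (zon (ts @ xs))"
  using assms
proof (induction xs arbitrary: a ts)
  case (Cons x xs)
  have "vol (zon (ts @ psums a (x # xs))) = vol (zon ((ts @ [a + x]) @ psums (a + x) xs))"
    by simp
  also have "\<dots> = vol (zon ((ts @ [a + x]) @ xs))"
    using Cons.prems by (intro Cons.IH) (auto intro: span_base)
  also have "\<dots> = vol (zon ((x + a) # ts @ xs))" by (simp add: zon_append plus_singleton_0 ac_simps)
  also have "\<dots> = vol (zon (x # ts @ xs))"
    using Cons.prems span_mono[of "set ts" "set (ts @ xs)"] by (intro vol_zon_Cons_span) auto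
  also have "\<dots> = vol (zon (ts @ x # xs))" by (simp add: zon_append plus_singleton_0 ac_simps)
  finally show ?case .
qed simp

section \<open>Random convex bodies\<close>

text \<open>Measurability is imposed on support functions, since there a finite hull acts as a
  maximum and an added segment as a summand \<open>max 0\<close>, while membership, and with it the
  volume, can be recovered from countably many of them.\<close>

definition rbody :: "'w measure \<Rightarrow> ('w \<Rightarrow> 'a::euclidean_space set) \<Rightarrow> bool" where
  "rbody N K \<longleftrightarrow> (\<forall>x\<in>space N. body (K x) \<and> K x \<noteq> {}) \<and>
    (\<forall>u. (\<lambda>x. SUP z\<in>K x. u \<bullet> z) \<in> borel_measurable N)"

lemma bdd_above_inner: "compact K \<Longrightarrow> bdd_above ((\<lambda>z. u \<bullet> z) ` K)"
  by (intro bounded_imp_bdd_above compact_imp_bounded compact_continuous_image continuous_intros)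

lemma SUP_inner_hull:
  fixes S :: "'a::euclidean_space set"
  assumes "finite S" "S \<noteq> {}"
  shows "(SUP z\<in>convex hull S. u \<bullet> z) = Max ((\<lambda>z. u \<bullet> z) ` S)"
proof (rule antisym)
  have "convex hull S \<subseteq> {z. u \<bullet> z \<le> Max ((\<lambda>z. u \<bullet> z) ` S)}"
    using assms by (intro hull_minimal convex_halfspace_le) auto
  then show "(SUP z\<in>convex hull S. u \<bullet> z) \<le> Max ((\<lambda>z. u \<bullet> z) ` S)"
    using assms by (intro cSUP_least) auto
  show "Max ((\<lambda>z. u \<bullet> z) ` S) \<le> (SUP z\<in>convex hull S. u \<bullet> z)"
    using assms body_hull[of S]
    by (auto intro!: cSUP_upper bdd_above_inner hull_inc simp: body_def)
qed

lemma rbody_hull: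
  assumes "finite J" "J \<noteq> {}" "\<And>j. j \<in> J \<Longrightarrow> p j \<in> borel_measurable N"
  shows "rbody N (\<lambda>x. convex hull ((\<lambda>j. p j x) ` J))"
  unfolding rbody_def
proof (intro conjI allI ballI)
  fix u
  have "(\<lambda>x. SUP z\<in>convex hull ((\<lambda>j. p j x) ` J). u \<bullet> z) = (\<lambda>x. Max ((\<lambda>j. u \<bullet> p j x) ` J))"
    using assms by (simp add: SUP_inner_hull image_image)
  then show "(\<lambda>x. SUP z\<in>convex hull ((\<lambda>j. p j x) ` J). u \<bullet> z) \<in> borel_measurable N"
    using assms by (simp add: borel_measurable_Max)
qed (use assms in \<open>auto intro: body_hull\<close>)

lemma SUP_inner_plus_seg:
  assumes K: "body K" "K \<noteq> {}"
  shows "(SUP z\<in>K + seg t. u \<bullet> z) = (SUP z\<in>K. u \<bullet> z) + max 0 (u \<bullet> t)"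
proof (rule antisym)
  have ne: "K + seg t \<noteq> {}" using K(2) by (auto simp: set_plus_def)
  have bdd: "bdd_above ((\<lambda>z. u \<bullet> z) ` K)" "bdd_above ((\<lambda>z. u \<bullet> z) ` (K + seg t))"
    using K(1) body_plus[OF K(1) body_seg] by (simp_all add: body_def bdd_above_inner)
  have "u \<bullet> (z + r *\<^sub>R t) \<le> (SUP z\<in>K. u \<bullet> z) + max 0 (u \<bullet> t)" if "z \<in> K" "0 \<le> r" "r \<le> 1" for z r
  proof -
    have "r * (u \<bullet> t) \<le> max 0 (u \<bullet> t)"
      using that mult_left_le_one_le[of "u \<bullet> t" r] mult_nonneg_nonpos[of r "u \<bullet> t"] by (cases "0 \<le> u \<bullet> t") auto
    moreover have "u \<bullet> z \<le> (SUP z\<in>K. u \<bullet> z)" using that bdd by (intro cSUP_upper)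
    ultimately show ?thesis by (simp add: inner_add_right)
  qed
  then show "(SUP z\<in>K + seg t. u \<bullet> z) \<le> (SUP z\<in>K. u \<bullet> z) + max 0 (u \<bullet> t)"
    using ne by (intro cSUP_least) (auto elim!: set_plus_elim simp: mem_seg)
  have "(SUP z\<in>K. u \<bullet> z) \<le> (SUP z\<in>K + seg t. u \<bullet> z) - max 0 (u \<bullet> t)"
  proof (rule cSUP_least)
    fix z assume "z \<in> K"
    \<comment> \<open>Picks the end of \<open>seg t\<close> at which the functional \<open>u\<close>
      is larger.\<close>
    define c :: real where "c = (if 0 \<le> u \<bullet> t then 1 else 0)"
    have "z + c *\<^sub>R t \<in> K + seg t"
      using \<open>z \<in> K\<close> by (intro set_plus_intro) (auto simp: c_def)
    then have "u \<bullet> (z + c *\<^sub>R t) \<le> (SUP z\<in>K + seg t. u \<bullet> z)"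
      using bdd by (intro cSUP_upper)
    then show "u \<bullet> z \<le> (SUP z\<in>K + seg t. u \<bullet> z) - max 0 (u \<bullet> t)"
      by (auto simp: c_def inner_add_right split: if_splits)
  qed (use K in simp)
  then show "(SUP z\<in>K. u \<bullet> z) + max 0 (u \<bullet> t) \<le> (SUP z\<in>K + seg t. u \<bullet> z)" by simp
qed

lemma rbody_plus_seg:
  assumes "rbody N K" "t \<in> borel_measurable N"
  shows "rbody N (\<lambda>x. K x + seg (t x))"
  unfolding rbody_def
proof (intro conjI allI ballI)
  fix u
  have "(\<lambda>x. (SUP z\<in>K x. u \<bullet> z) + max 0 (u \<bullet> t x)) \<in> borel_measurable N"
    using assms unfolding rbody_def by (intro borel_measurable_add borel_measurable_max) auto
  then show "(\<lambda>x. SUP z\<in>K x + seg (t x). u \<bullet> z) \<in> borel_measurable N"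
    using assms(1) unfolding rbody_def by (subst measurable_cong[OF SUP_inner_plus_seg]) auto
next
  fix x assume "x \<in> space N"
  then have K: "body (K x)" "K x \<noteq> {}" using assms(1) by (auto simp: rbody_def)
  show "body (K x + seg (t x))" by (intro body_plus K body_seg)
  obtain z where "z \<in> K x" using K(2) by blast
  then have "z + 0 \<in> K x + seg (t x)" by (intro set_plus_intro) auto
  then show "K x + seg (t x) \<noteq> {}" by blast
qed

text \<open>A separating hyperplane leaves a positive margin, and over a bounded body a small change
  of its normal preserves the separation. So normals from a dense set suffice, and this set may be
  taken countable.\<close>

lemma mem_body_iff:
  fixes K :: "'a::euclidean_space set"
  assumes K: "body K" "K \<noteq> {}" and D: "\<And>X::'a set. open X \<Longrightarrow> X \<noteq> {} \<Longrightarrow> \<exists>d\<in>D. d \<in> X"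
  shows "y \<in> K \<longleftrightarrow> (\<forall>u\<in>D. u \<bullet> y \<le> (SUP z\<in>K. u \<bullet> z))"
proof
  assume "y \<in> K"
  then show "\<forall>u\<in>D. u \<bullet> y \<le> (SUP z\<in>K. u \<bullet> z)"
    using K by (auto intro!: cSUP_upper bdd_above_inner simp: body_def)
next
  assume *: "\<forall>u\<in>D. u \<bullet> y \<le> (SUP z\<in>K. u \<bullet> z)"
  show "y \<in> K"
  proof (rule ccontr)
    assume "y \<notin> K"
    then obtain a b where ab: "a \<bullet> y < b" "\<And>x. x \<in> K \<Longrightarrow> b < a \<bullet> x"
      using separating_hyperplane_closed_point[of K y] K by (auto simp: body_def compact_imp_closed)
    obtain R where R: "R > 0" "\<And>x. x \<in> K \<Longrightarrow> norm x \<le> R"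
      using K bounded_pos[of K] by (auto simp: body_def compact_imp_bounded)
    \<comment> \<open>A normal within \<open>e\<close> of \<open>-a\<close> changes the values on
      \<open>K\<close> and at \<open>y\<close> by at most \<open>e * (R + norm y)\<close>
      altogether, which stays below the margin \<open>b - a \<bullet> y\<close>.\<close>
    define e where "e = (b - a \<bullet> y) / (R + norm y + 1)"
    have pos: "R + norm y + 1 > 0" using R by (simp add: add_pos_nonneg)
    have "e > 0" using ab pos by (simp add: e_def)
    then obtain u where u: "u \<in> D" "dist (-a) u < e"
      using D[of "ball (-a) e"] by auto
    define w where "w = u + a"
    have w: "norm w < e" "u = w - a" using u by (auto simp: w_def dist_norm norm_minus_commute)
    have "(SUP z\<in>K. u \<bullet> z) \<le> norm w * R - b"
    proof (rule cSUP_least)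
      fix x assume "x \<in> K"
      have "w \<bullet> x \<le> norm w * norm x" by (rule norm_cauchy_schwarz)
      also have "\<dots> \<le> norm w * R" using R \<open>x \<in> K\<close> by (intro mult_left_mono) auto
      finally show "u \<bullet> x \<le> norm w * R - b" using ab(2)[OF \<open>x \<in> K\<close>] by (simp add: w(2) inner_diff_left)
    qed (use K in simp)
    then have "u \<bullet> y \<le> norm w * R - b" using * u(1) by force
    moreover have "- (norm w * norm y) \<le> w \<bullet> y" using Cauchy_Schwarz_ineq2[of w y] by linarith
    ultimately have "b - a \<bullet> y \<le> norm w * (R + norm y)" by (simp add: w(2) inner_diff_left algebra_simps)
    also have "\<dots> \<le> e * (R + norm y)" using w R by (intro mult_right_mono) auto
    also have "\<dots> < e * (R + norm y + 1)" using \<open>e > 0\<close> by simp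
    also have "\<dots> = b - a \<bullet> y" using pos by (simp add: e_def)
    finally show False by simp
  qed
qed

text \<open>The pairs \<open>(x, y)\<close> with \<open>y\<close> in \<open>K x\<close> are cut out
  by countably many support inequalities, so they form a set measurable in the product, whose
  sections have measurable volume.\<close>

lemma borel_measurable_vol_rbody:
  fixes K :: "'w \<Rightarrow> 'a::euclidean_space set"
  assumes "rbody N K" shows "(\<lambda>x. vol (K x)) \<in> borel_measurable N"
proof -
  obtain D :: "'a set" where D: "countable D" "\<And>X. open X \<Longrightarrow> X \<noteq> {} \<Longrightarrow> \<exists>d\<in>D. d \<in> X"
    using countable_dense_exists by blast
  have "(\<lambda>x. SUP z\<in>K x. u \<bullet> z) \<in> borel_measurable N" for u
    using assms by (simp add: rbody_def)
  then have sup: "(\<lambda>p. SUP z\<in>K (fst p). u \<bullet> z) \<in> borel_measurable (N \<Otimes>\<^sub>M lborel)" for u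
    by (rule measurable_compose[OF measurable_fst])
  define Q where "Q = {p \<in> space (N \<Otimes>\<^sub>M lborel). \<forall>u\<in>D. u \<bullet> snd p \<le> (SUP z\<in>K (fst p). u \<bullet> z)}"
  have "Q \<in> sets (N \<Otimes>\<^sub>M lborel)"
    unfolding Q_def by (intro sets.sets_Collect_countable_All' D(1) borel_measurable_le sup) simp
  then have "(\<lambda>x. emeasure lborel (Pair x -` Q)) \<in> borel_measurable N"
    by (rule lborel.measurable_emeasure_Pair)
  then have "(\<lambda>x. enn2real (emeasure lborel (Pair x -` Q))) \<in> borel_measurable N"
    by measurable
  moreover have "enn2real (emeasure lborel (Pair x -` Q)) = vol (K x)" if x: "x \<in> space N" for x
  proof -
    have K: "body (K x)" "K x \<noteq> {}" using assms x by (auto simp: rbody_def)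
    have "y \<in> Pair x -` Q \<longleftrightarrow> (\<forall>u\<in>D. u \<bullet> y \<le> (SUP z\<in>K x. u \<bullet> z))" for y
      using x by (simp add: Q_def space_pair_measure)
    then have "y \<in> Pair x -` Q \<longleftrightarrow> y \<in> K x" for y
      using mem_body_iff[OF K D(2), of y] by metis
    then have "Pair x -` Q = K x" by blast
    moreover have "K x \<in> sets lborel" using K by (simp add: body_def compact_imp_closed borel_closed)
    then have "vol (K x) = measure lborel (K x)" by (rule measure_completion)
    ultimately show ?thesis by (simp only: measure_def)
  qed
  ultimately show ?thesis by (simp only: cong: measurable_cong)
qed

lemma borel_measurable_mdiff:
  assumes "rbody N K" "\<And>s. s \<in> set ss \<Longrightarrow> s \<in> borel_measurable N"
  shows "(\<lambda>x. mdiff (map (\<lambda>s. s x) ss) (K x)) \<in> borel_measurable N"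
  using assms
proof (induction ss arbitrary: K)
  case Nil
  then show ?case by (simp add: borel_measurable_vol_rbody)
next
  case (Cons s ss)
  have "(\<lambda>x. mdiff (map (\<lambda>s. s x) ss) (K x + seg (s x))) \<in> borel_measurable N"
    using Cons.prems by (intro Cons.IH rbody_plus_seg) auto
  moreover have "(\<lambda>x. mdiff (map (\<lambda>s. s x) ss) (K x)) \<in> borel_measurable N"
    using Cons.prems by (intro Cons.IH) auto
  ultimately show ?case by simp
qed

text \<open>The expansion has \<open>2 ^ length ss\<close> volumes, each of a body inside a ball of
  radius \<open>R\<close>. Only the growth in \<open>R\<close> matters later, for
  integrability.\<close>

lemma mdiff_bound:
  fixes A :: "'a::euclidean_space set"
  assumes "body A" "A \<subseteq> cball 0 r" "0 \<le> r" "r + (\<Sum>s\<leftarrow>ss. norm s) \<le> R"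
  shows "\<bar>mdiff ss A\<bar> \<le> 2 ^ length ss * (unit_ball_vol (real DIM('a)) * R ^ DIM('a))"
  using assms
proof (induction ss arbitrary: A r)
  case Nil
  then have "A \<subseteq> cball 0 R" by (simp add: subset_cball order_trans)
  then have "vol A \<le> vol (cball 0 R :: 'a set)"
    using Nil by (intro measure_mono_fmeasurable) (auto simp: body_def lmeasurable_compact intro: fmeasurableD)
  then show ?case using content_cball[of R "0::'a"] Nil by simp
next
  case (Cons s ss)
  have sub: "A + seg s \<subseteq> cball 0 (r + norm s)"
  proof
    fix x assume "x \<in> A + seg s"
    then obtain a u where a: "a \<in> A" "0 \<le> u" "u \<le> 1" "x = a + u *\<^sub>R s" by (auto simp: set_plus_def mem_seg)
    have "norm x \<le> norm a + u * norm s" using norm_triangle_ineq[of a "u *\<^sub>R s"] a by simp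
    also have "\<dots> \<le> r + norm s" using a Cons.prems(2) by (intro add_mono) (auto simp: mult_left_le_one_le)
    finally show "x \<in> cball 0 (r + norm s)" by simp
  qed
  let ?b = "2 ^ length ss * (unit_ball_vol (real DIM('a)) * R ^ DIM('a))"
  have 1: "\<bar>mdiff ss (A + seg s)\<bar> \<le> ?b"
    using Cons.prems sub by (intro Cons.IH[of _ "r + norm s"] body_plus body_seg) (auto simp: add.assoc)
  have "r + (\<Sum>s\<leftarrow>ss. norm s) \<le> R"
    using Cons.prems(4) norm_ge_zero[of s] unfolding list.map sum_list.Cons by linarith
  then have 2: "\<bar>mdiff ss A\<bar> \<le> ?b"
    using Cons.prems by (intro Cons.IH[of _ r]) auto
  have "\<bar>mdiff (s # ss) A\<bar> \<le> 2 * ?b"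
    using 1 2 unfolding mdiff.simps by linarith
  then show ?case by simp
qed

section \<open>Hulls of random walks with independent increments\<close>

definition walk :: "(nat \<Rightarrow> 'a::comm_monoid_add) \<Rightarrow> nat \<Rightarrow> 'a" where
  "walk x k = (\<Sum>j<k. x j)"

text \<open>The state of the recursion: \<open>ks\<close> records the times of the directions
  already split off, and \<open>m\<close> is the last walk position still in the hull.\<close>

definition wdiff :: "nat list \<Rightarrow> nat \<Rightarrow> (nat \<Rightarrow> 'a::euclidean_space) \<Rightarrow> real" where
  "wdiff ks m x = mdiff (map (walk x) ks) (convex hull (walk x ` {..m}))"

text \<open>Only the first \<open>m\<close> indices are permuted, so the walk is unchanged at time
  \<open>m\<close> and later.\<close>

definition rot :: "nat \<Rightarrow> nat \<Rightarrow> nat \<Rightarrow> nat" where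
  "rot m i j = (if j < m then (j + i) mod m else j)"

lemma walk_cong: "(\<And>j. j < k \<Longrightarrow> x j = y j) \<Longrightarrow> walk x k = walk y k"
  by (simp add: walk_def)

text \<open>After rotation by \<open>i\<close> the first \<open>m\<close> steps of the walk trace a
  translated window of the periodic extension \<open>T\<close>, so \<open>mdiff_cyclic\<close>
  applies. The directions at the times in \<open>ks\<close>, all at least \<open>m\<close>, are the
  same for every rotation.\<close>

lemma wdiff_cyclic:
  fixes x :: "nat \<Rightarrow> 'a::euclidean_space"
  assumes m: "0 < m" and ks: "\<And>k. k \<in> set ks \<Longrightarrow> m \<le> k"
  shows "(\<Sum>i<m. wdiff ks m (x \<circ> rot m i) - wdiff ks (m - 1) (x \<circ> rot m i)) = wdiff (m # ks) (m - 1) x"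
proof -
  define T where "T k = (\<Sum>j<k. x (j mod m))" for k
  have T_m: "T m = walk x m" by (simp add: T_def walk_def)
  have period: "T (i + m) = T i + walk x m" for i
  proof (induction i)
    case 0
    then show ?case using T_m by (simp add: T_def)
  next
    case (Suc i)
    then show ?case by (simp add: T_def)
  qed
  have le: "walk (x \<circ> rot m i) k = T (i + k) - T i" if "k \<le> m" for i k
    using that
  proof (induction k)
    case 0
    then show ?case by (simp add: walk_def)
  next
    case (Suc k)
    then show ?case by (simp add: walk_def T_def rot_def add.commute)
  qed
  have ge: "walk (x \<circ> rot m i) k = walk x k" if "m \<le> k" for i k
    using that
  proof (induction rule: dec_induct)
    case base
    then show ?case using le[of m i] period[of i] by (simp del: comp_apply add: comp_def)
  next
    case (step k)
    then show ?case by (simp add: walk_def rot_def)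
  qed
  have hull: "mdiff ss (convex hull (walk (x \<circ> rot m i) ` {..k})) = mdiff ss (convex hull (T ` {i..i+k}))"
    if "k \<le> m" for i k ss
  proof -
    have "walk (x \<circ> rot m i) ` {..k} = (\<lambda>j. - T i + T (i + j)) ` {..k}"
      using that by (intro image_cong) (auto simp: le)
    also have "\<dots> = (+) (- T i) ` T ` (+) i ` {..k}" by (simp add: image_image)
    also have "(+) i ` {..k} = {i..i+k}" by (simp add: atMost_atLeast0)
    finally have "walk (x \<circ> rot m i) ` {..k} = (+) (- T i) ` T ` {i..i+k}" .
    then show ?thesis
      by (simp only: convex_hull_translation) (simp only: mdiff_translate flip: singleton_plus)
  qed
  have map: "map (walk (x \<circ> rot m i)) ks = map (walk x) ks" for i
    using ks ge by simp
  have "{i..i + (m - 1)} = {i..<i + m}" for i using m by auto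
  then have hull': "mdiff ss (convex hull (walk (x \<circ> rot m i) ` {..m - 1})) = mdiff ss (convex hull (T ` {i..<i+m}))" for i ss
    using hull[where k="m - 1" and i=i and ss=ss] by simp
  have "(\<Sum>i<m. wdiff ks m (x \<circ> rot m i) - wdiff ks (m - 1) (x \<circ> rot m i))
     = (\<Sum>i<m. mdiff (map (walk x) ks) (convex hull (T ` {i..i+m})) - mdiff (map (walk x) ks) (convex hull (T ` {i..<i+m})))"
    by (simp only: wdiff_def map hull[OF order_refl] hull')
  also have "\<dots> = mdiff (walk x m # map (walk x) ks) (convex hull (T ` {0..<m}))"
    by (rule mdiff_cyclic[where T=T, OF period m])
  also have "T ` {0..<m} = walk x ` {..m - 1}"
    using m by (intro image_cong) (auto simp: T_def walk_def)
  finally show ?thesis by (simp only: wdiff_def list.map)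
qed

lemma rot_inj_on: "i < m \<Longrightarrow> inj_on (rot m i) A"
  by (auto simp: inj_on_def rot_def mod_if split: if_splits)

lemma rot_less: "i < m \<Longrightarrow> m \<le> n \<Longrightarrow> j < n \<Longrightarrow> rot m i j < n"
  by (auto simp: rot_def intro: order_less_le_trans[OF mod_less_divisor])

lemma sum_power_le:
  fixes a :: "'i \<Rightarrow> real"
  assumes "finite A" "\<And>j. j \<in> A \<Longrightarrow> 0 \<le> a j" "0 < d"
  shows "(\<Sum>j\<in>A. a j) ^ d \<le> real (card A) ^ d * (\<Sum>j\<in>A. a j ^ d)"
proof (cases "A = {}")
  case False
  define b where "b = Max (a ` A)"
  have "b \<in> a ` A" unfolding b_def using False assms(1) by (intro Max_in) auto
  then obtain i where i: "i \<in> A" "b = a i" by auto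
  have "(\<Sum>j\<in>A. a j) \<le> (\<Sum>j\<in>A. b)" unfolding b_def using assms(1) by (intro sum_mono Max_ge) auto
  then have "(\<Sum>j\<in>A. a j) ^ d \<le> (real (card A) * b) ^ d"
    using assms by (intro power_mono) (auto intro: sum_nonneg)
  also have "\<dots> = real (card A) ^ d * a i ^ d" by (simp add: i power_mult_distrib)
  also have "\<dots> \<le> real (card A) ^ d * (\<Sum>j\<in>A. a j ^ d)"
    using i assms by (intro mult_left_mono member_le_sum) auto
  finally show ?thesis .
qed (use assms in \<open>simp add: zero_power\<close>)

text \<open>The moment has order \<open>d\<close> because volume grows like the \<open>d\<close>-th
  power of the radius.\<close>

locale iid_product =
  fixes \<mu> :: "'a::euclidean_space measure" and n :: nat
  assumes prob: "prob_space \<mu>" and sets_mu [measurable_cong]: "sets \<mu> = sets borel"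
    and moment: "integrable \<mu> (\<lambda>x. norm x ^ DIM('a))"
begin

abbreviation P where "P \<equiv> Pi\<^sub>M {..<n} (\<lambda>_. \<mu>)"

lemma walk_measurable: "k \<le> n \<Longrightarrow> (\<lambda>x. walk x k) \<in> borel_measurable P"
  unfolding walk_def by (intro borel_measurable_sum) (auto intro!: measurable_compose[OF measurable_component_singleton] simp: measurable_ident_sets sets_mu)

lemma wdiff_measurable:
  assumes "m \<le> n" "\<And>k. k \<in> set ks \<Longrightarrow> k \<le> n"
  shows "wdiff ks m \<in> borel_measurable P"
proof -
  have "(\<lambda>x. mdiff (map (\<lambda>s. s x) (map (\<lambda>k x. walk x k) ks)) (convex hull ((\<lambda>j. walk x j) ` {..m}))) \<in> borel_measurable P"
    using assms by (intro borel_measurable_mdiff rbody_hull) (auto intro: walk_measurable)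
  then show ?thesis by (simp add: wdiff_def[abs_def] comp_def)
qed

lemma wdiff_restrict:
  assumes "m \<le> n" "\<And>k. k \<in> set ks \<Longrightarrow> k \<le> n" "\<And>j. j < n \<Longrightarrow> x j = y j"
  shows "wdiff ks m x = wdiff ks m y"
proof -
  have eq: "walk x k = walk y k" if "k \<le> n" for k
    using that assms(3) by (intro walk_cong) auto
  then have "walk x ` {..m} = walk y ` {..m}" using assms(1) by (intro image_cong) auto
  moreover have "map (walk x) ks = map (walk y) ks" using assms(2) eq by simp
  ultimately show ?thesis unfolding wdiff_def by (simp only:)
qed

lemma wdiff_integrable:
  assumes "m \<le> n" "\<And>k. k \<in> set ks \<Longrightarrow> k \<le> n"
  shows "integrable P (wdiff ks m)"
proof -
  define d where "d = DIM('a)"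
  define c where "c = 2 ^ length ks * (unit_ball_vol (real d) * ((1 + real (length ks)) ^ d * real n ^ d))"
  have ubv: "unit_ball_vol (real d) \<ge> 0" by (simp add: unit_ball_vol_nonneg)
  have bound: "\<bar>wdiff ks m x\<bar> \<le> c * (\<Sum>j<n. norm (x j) ^ d)" for x :: "nat \<Rightarrow> 'a"
  proof -
    define r where "r = (\<Sum>j<n. norm (x j))"
    have r: "0 \<le> r" by (simp add: r_def sum_nonneg)
    have walk: "norm (walk x k) \<le> r" if "k \<le> n" for k
      unfolding walk_def r_def using that
      by (intro order_trans[OF norm_sum] sum_mono2) auto
    have sum_le: "(\<Sum>s\<leftarrow>map (walk x) ks. norm s) \<le> real (length ks) * r"
      using assms(2)
    proof (induction ks)
      case (Cons k ks)
      then show ?case using walk[of k] by (simp add: algebra_simps)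
    qed simp
    have "convex hull (walk x ` {..m}) \<subseteq> cball 0 r"
      using assms walk by (intro hull_minimal) auto
    then have "\<bar>wdiff ks m x\<bar> \<le> 2 ^ length ks * (unit_ball_vol (real d) * ((1 + real (length ks)) * r) ^ d)"
      using mdiff_bound[OF body_hull, of "walk x ` {..m}" r "map (walk x) ks" "(1 + real (length ks)) * r"] r sum_le
      by (simp add: wdiff_def d_def algebra_simps)
    also have "\<dots> = 2 ^ length ks * (unit_ball_vol (real d) * (1 + real (length ks)) ^ d) * r ^ d"
      by (simp add: power_mult_distrib)
    also have "\<dots> \<le> 2 ^ length ks * (unit_ball_vol (real d) * (1 + real (length ks)) ^ d) * (real n ^ d * (\<Sum>j<n. norm (x j) ^ d))"
      unfolding r_def using ubv by (intro mult_left_mono sum_power_le[of "{..<n}", simplified]) (auto simp: d_def)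
    finally show ?thesis by (simp add: c_def ac_simps)
  qed
  have "integrable P (\<lambda>x. \<Sum>j<n. norm (x j) ^ d)"
  proof (rule Bochner_Integration.integrable_sum)
    fix j assume j: "j \<in> {..<n}"
    have "integrable (distr P \<mu> (\<lambda>x. x j)) (\<lambda>y. norm y ^ d)"
      using moment j by (subst distr_PiM_component) (auto simp: prob d_def)
    then show "integrable P (\<lambda>x. norm (x j) ^ d)"
      using j by (subst (asm) integrable_distr_eq) auto
  qed
  then have "integrable P (\<lambda>x. c * (\<Sum>j<n. norm (x j) ^ d))" by simp
  then show ?thesis
    by (rule Bochner_Integration.integrable_bound)
      (use bound wdiff_measurable[OF assms] in \<open>auto intro!: AE_I2 order_trans[OF bound]\<close>)
qed

text \<open>A product of equal factors is invariant under the permutation \<open>rot l i\<close> of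
  its coordinates.\<close>

lemma integral_wdiff_rot:
  assumes "m \<le> n" "\<And>k. k \<in> set ks \<Longrightarrow> k \<le> n" "i < l" "l \<le> n"
  shows "integrable P (\<lambda>x. wdiff ks m (x \<circ> rot l i))"
    and "(\<integral>x. wdiff ks m (x \<circ> rot l i) \<partial>P) = (\<integral>x. wdiff ks m x \<partial>P)"
proof -
  let ?t = "\<lambda>x. \<lambda>j\<in>{..<n}. x (rot l i j)"
  have t: "?t \<in> measurable P P"
    using rot_less[OF assms(3,4)] by (intro measurable_restrict measurable_component_singleton) auto
  have d: "distr P P ?t = P"
    using distr_PiM_reindex[of "{..<n}" "\<lambda>_. \<mu>" "rot l i" "{..<n}"] rot_less[OF assms(3,4)] rot_inj_on[OF assms(3)] prob
    by auto
  have eq: "wdiff ks m (?t x) = wdiff ks m (x \<circ> rot l i)" for x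
    using assms by (intro wdiff_restrict) auto
  show "integrable P (\<lambda>x. wdiff ks m (x \<circ> rot l i))"
    using wdiff_integrable[OF assms(1,2)] integrable_distr[OF t, of "wdiff ks m"] by (simp add: d eq)
  show "(\<integral>x. wdiff ks m (x \<circ> rot l i) \<partial>P) = (\<integral>x. wdiff ks m x \<partial>P)"
    using integral_distr[OF t wdiff_measurable[OF assms(1,2)]] by (simp add: d eq)
qed

text \<open>All \<open>m\<close> rotations have the same mean, so the cyclic identity integrates to
  \<open>m\<close> times one difference. This is the origin of the factors \<open>1 / j\<close> in
  the final sum.\<close>

lemma integral_wdiff_step:
  assumes "0 < m" "m \<le> n" "\<And>k. k \<in> set ks \<Longrightarrow> m \<le> k \<and> k \<le> n"
  shows "(\<integral>x. wdiff ks m x \<partial>P) = (\<integral>x. wdiff ks (m - 1) x \<partial>P) + (\<integral>x. wdiff (m # ks) (m - 1) x \<partial>P) / m"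
proof -
  have "(\<integral>x. wdiff (m # ks) (m - 1) x \<partial>P)
    = (\<integral>x. (\<Sum>i<m. wdiff ks m (x \<circ> rot m i) - wdiff ks (m - 1) (x \<circ> rot m i)) \<partial>P)"
    using assms by (subst wdiff_cyclic) auto
  also have "\<dots> = (\<Sum>i<m. (\<integral>x. wdiff ks m (x \<circ> rot m i) - wdiff ks (m - 1) (x \<circ> rot m i) \<partial>P))"
    using assms by (intro Bochner_Integration.integral_sum Bochner_Integration.integrable_diff integral_wdiff_rot) auto
  also have "\<dots> = (\<Sum>i<m. (\<integral>x. wdiff ks m x \<partial>P) - (\<integral>x. wdiff ks (m - 1) x \<partial>P))"
    using assms by (intro sum.cong refl, subst Bochner_Integration.integral_diff)
       (auto intro!: integral_wdiff_rot simp: integral_wdiff_rot(2))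
  also have "\<dots> = real m * ((\<integral>x. wdiff ks m x \<partial>P) - (\<integral>x. wdiff ks (m - 1) x \<partial>P))" by simp
  finally show ?thesis using assms(1) by (simp add: field_simps)
qed

lemma integral_wdiff_sum:
  assumes "m \<le> n" "\<And>k. k \<in> set ks \<Longrightarrow> m \<le> k \<and> k \<le> n"
  shows "(\<integral>x. wdiff ks m x \<partial>P) = (\<integral>x. wdiff ks 0 x \<partial>P) + (\<Sum>j=1..m. (\<integral>x. wdiff (j # ks) (j - 1) x \<partial>P) / j)"
  using assms
proof (induction m)
  case (Suc m)
  have "(\<integral>x. wdiff ks m x \<partial>P) = (\<integral>x. wdiff ks 0 x \<partial>P) + (\<Sum>j=1..m. (\<integral>x. wdiff (j # ks) (j - 1) x \<partial>P) / j)"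
    using Suc.prems by (intro Suc.IH) force+
  then show ?case using integral_wdiff_step[of "Suc m" ks] Suc.prems by simp
qed simp

end

text \<open>Unfolds to a sum over \<open>m >= j1 > ... > jr >= 1\<close> with weights
  \<open>1 / (j1 ... jr)\<close>. Each new, smaller index goes to the front, so an empty initial
  \<open>ks\<close> leads to increasing lists.\<close>

fun nsum :: "(nat list \<Rightarrow> real) \<Rightarrow> nat \<Rightarrow> nat list \<Rightarrow> nat \<Rightarrow> real" where
  "nsum g 0 ks m = g ks"
| "nsum g (Suc r) ks m = (\<Sum>j=1..m. nsum g r (j # ks) (j - 1) / real j)"

text \<open>The recursion ends in two ways: with fewer than \<open>d\<close> directions a single
  point contributes nothing, and with \<open>d\<close> directions the hull no longer matters and a
  parallelepiped is left.\<close>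

lemma (in iid_product) integral_wdiff_nsum:
  assumes "length ks + r = DIM('a)" "m \<le> n" "\<And>k. k \<in> set ks \<Longrightarrow> m \<le> k \<and> k \<le> n"
  shows "(\<integral>x. wdiff ks m x \<partial>P) = nsum (\<lambda>ks. \<integral>x. vol (zon (map (walk x) ks)) \<partial>P) r ks m"
    (is "_ = nsum ?g r ks m")
  using assms
proof (induction r arbitrary: ks m)
  case 0
  have "wdiff ks m x = vol (zon (map (walk x) ks))" for x :: "nat \<Rightarrow> 'a"
    unfolding wdiff_def using 0 by (intro mdiff_full body_hull) auto
  then show ?case by simp
next
  case (Suc r)
  have "wdiff ks 0 x = 0" for x :: "nat \<Rightarrow> 'a"
    unfolding wdiff_def using Suc.prems by (simp add: mdiff_singleton_lowdim)
  then have "(\<integral>x. wdiff ks m x \<partial>P) = (\<Sum>j=1..m. (\<integral>x. wdiff (j # ks) (j - 1) x \<partial>P) / j)"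
    using integral_wdiff_sum[of m ks] Suc.prems by simp
  also have "\<dots> = (\<Sum>j=1..m. nsum ?g r (j # ks) (j - 1) / j)"
  proof (rule sum.cong)
    fix j assume "j \<in> {1..m}"
    then have "(\<integral>x. wdiff (j # ks) (j - 1) x \<partial>P) = nsum ?g r (j # ks) (j - 1)"
      using Suc.prems by (intro Suc.IH) force+
    then show "(\<integral>x. wdiff (j # ks) (j - 1) x \<partial>P) / j = nsum ?g r (j # ks) (j - 1) / j"
      by simp
  qed simp
  finally show ?case by simp
qed

section \<open>Standard Gaussian vectors\<close>

lemma measure_linear_image_cart:
  fixes f :: "real^'n::finite \<Rightarrow> real^'n"
  assumes "linear f" "S \<in> lmeasurable"
  shows "f ` S \<in> lmeasurable \<and> measure lebesgue (f ` S) = \<bar>det (matrix f)\<bar> * measure lebesgue S"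
  using assms(2)
proof (induction arbitrary: S rule: induct_linear_elementary[OF assms(1)])
  case (1 f g)
  then have "g ` S \<in> lmeasurable \<and> measure lebesgue (g ` S) = \<bar>det (matrix g)\<bar> * measure lebesgue S"
    and "f ` g ` S \<in> lmeasurable \<and> measure lebesgue (f ` g ` S) = \<bar>det (matrix f)\<bar> * measure lebesgue (g ` S)"
    by blast+
  then show ?case
    using matrix_compose[OF 1(2,1)] by (simp add: image_comp abs_mult det_mul o_def)
next
  case (2 f i)
  then have "\<not> surj f" by (metis one_neq_zero surjE vec_component)
  then have "\<not> inj f" using linear_injective_imp_surjective[OF 2(1)] by blast
  then have "negligible (f ` S)" "det (matrix f) = 0"
    using negligible_linear_singular_image[OF 2(1)] det_nz_iff_inj[OF 2(1)] by auto
  then show ?case by (simp add: negligible_iff_measure)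
next
  case (3 c)
  have "matrix (\<lambda>x. \<chi> i. c i * x $ i) = (\<chi> i j. if i = j then c i else 0)"
    by (auto simp: matrix_def axis_def vec_eq_iff)
  then have "det (matrix (\<lambda>x. \<chi> i. c i * x $ i)) = prod c UNIV"
    by (simp add: det_diagonal)
  then show ?case
    using measurable_stretch[OF 3] measure_stretch[OF 3] by simp
next
  case (4 m n)
  let ?t = "Transposition.transpose m n"
  let ?h = "\<lambda>x::real^'n. \<chi> i. x $ ?t i"
  have lin: "linear ?h" by (rule linearI) (simp_all add: vec_eq_iff)
  have inv: "?h (?h x) = x" for x by (simp add: vec_eq_iff)
  have vol: "measure lebesgue (?h ` cbox a b) = measure lebesgue (cbox a b)" for a b
  proof (cases "cbox a b = {}")
    case False
    have "?h ` cbox a b = cbox (?h a) (?h b)"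
    proof
      show "cbox (?h a) (?h b) \<subseteq> ?h ` cbox a b"
      proof
        fix x assume "x \<in> cbox (?h a) (?h b)"
        then have "a $ ?t i \<le> x $ i \<and> x $ i \<le> b $ ?t i" for i by (simp add: mem_box_cart)
        from this[of "?t _"] have "?h x \<in> cbox a b" by (simp add: mem_box_cart)
        then show "x \<in> ?h ` cbox a b" using inv by (metis image_eqI)
      qed
    qed (auto simp: mem_box_cart)
    moreover have "cbox (?h a) (?h b) \<noteq> {}" using False calculation by auto
    moreover have "(\<Prod>i\<in>UNIV. ?h b $ i - ?h a $ i) = (\<Prod>i\<in>UNIV. b $ i - a $ i)"
      using prod.permute[OF permutes_swap_id[of m UNIV n], of "\<lambda>i. b $ i - a $ i"] by (simp add: o_def)
    ultimately show ?thesis using False by (simp add: content_cbox_cart)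
  qed simp
  have "matrix ?h = (\<chi> i. mat 1 $ ?t i)"
    by (auto simp: matrix_def vec_eq_iff axis_def mat_def)
  then have "\<bar>det (matrix ?h)\<bar> = 1"
    using det_permute_rows[OF permutes_swap_id[of m UNIV n], of "mat 1 :: real^'n^'n"]
    by (simp add: sign_swap_id)
  then show ?case using measure_linear_sufficient[OF lin 4(2), of 1] vol by (auto simp: measurable_linear_image_interval[OF lin])
next
  case (5 m n)
  let ?h = "\<lambda>x::real^'n. \<chi> i. if i = m then x $ m + x $ n else x $ i"
  have lin: "linear ?h" by (rule linearI) (auto simp: vec_eq_iff algebra_simps)
  have vol: "measure lebesgue (?h ` cbox a b) = measure lebesgue (cbox a b)" for a b
  proof (cases "cbox a b = {}")
    case False
    \<comment> \<open>Moving the lower corner to 0 makes the coordinate \<open>n\<close>, which the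
      shear adds to \<open>m\<close>, nonnegative on the box.\<close>
    have box: "cbox a b = (+) a ` cbox 0 (b - a)"
      using cbox_translation[of a 0 "b - a"] by simp
    then have "?h ` cbox a b = (+) (?h a) ` ?h ` cbox 0 (b - a)"
      by (simp only: image_image linear_add[OF lin])
    then have "measure lebesgue (?h ` cbox a b) = measure lebesgue (?h ` cbox 0 (b - a))"
      by (simp only: measure_translation)
    also have "\<dots> = measure lebesgue (cbox 0 (b - a))"
      using False box 5(1) by (intro measure_shear_interval) auto
    also have "\<dots> = measure lebesgue (cbox a b)" by (simp only: box measure_translation)
    finally show ?thesis .
  qed simp
  have "matrix ?h = (\<chi> k. if k = m then row m (mat 1) + 1 *s row n (mat 1) else row k (mat 1))"
    using 5(1) by (auto simp: matrix_def vec_eq_iff axis_def mat_def row_def)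
  then have "det (matrix ?h) = 1"
    using det_row_operation[OF 5(1), of "mat 1 :: real^'n^'n" 1] by simp
  then show ?case using measure_linear_sufficient[OF lin 5(2), of 1] vol by (auto simp: measurable_linear_image_interval[OF lin])
qed

lemma
  fixes f :: "real^'n::finite \<Rightarrow> real^'n"
  assumes "orthogonal_transformation f" "S \<in> lmeasurable"
  shows measurable_orthogonal_image_cart: "f ` S \<in> lmeasurable"
    and measure_orthogonal_image_cart: "measure lebesgue (f ` S) = measure lebesgue S"
  using measure_linear_image_cart[OF orthogonal_transformation_linear[OF assms(1)] assms(2)]
    orthogonal_transformation_det[OF assms(1)] by simp_all

section \<open>The Gaussian measure and its rotation invariance\<close>

abbreviation std_normal :: "real measure" where
  "std_normal \<equiv> density lborel (normal_density 0 1)"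

text \<open>The density form yields rotation invariance; \<open>gauss_eq_distr\<close> presents the
  same measure as the image of a product, the form in which independent coordinates arrive.\<close>

definition gauss :: "(real ^ 'n) measure" where
  "gauss = density lborel (\<lambda>x. \<Prod>i\<in>UNIV. ennreal (std_normal_density (x $ i)))"

lemma nn_integral_lborel_vec_prod:
  fixes f :: "'n::finite \<Rightarrow> real \<Rightarrow> ennreal"
  assumes [measurable]: "\<And>i. f i \<in> borel_measurable borel"
  shows "(\<integral>\<^sup>+x. (\<Prod>i\<in>UNIV. f i (x $ i)) \<partial>lborel) = (\<Prod>i\<in>UNIV. (\<integral>\<^sup>+t. f i t \<partial>lborel))"
proof -
  have inj: "inj (\<lambda>i::'n. axis i (1::real))" by (auto simp: inj_on_def axis_eq_axis)
  have Basis: "(Basis :: (real ^ 'n) set) = range (\<lambda>i. axis i 1)" by (auto simp: Basis_vec_def)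
  define h where "h b = f (inv (\<lambda>i. axis i (1::real)) b)" for b
  have h: "h (axis i 1) = f i" for i by (simp add: h_def inv_f_f[OF inj])
  have "(\<integral>\<^sup>+x. (\<Prod>b\<in>Basis. h b (x \<bullet> b)) \<partial>lborel) = (\<Prod>b\<in>Basis. (\<integral>\<^sup>+t. h b t \<partial>lborel))"
    by (rule nn_integral_lborel_prod) (auto simp: h_def)
  then show ?thesis
    unfolding Basis by (simp add: prod.reindex[OF inj] h inner_axis o_def)
qed

lemma prob_space_std_normal: "prob_space std_normal"
  by (rule prob_space_normal_density) simp

lemma sets_gauss [simp, measurable_cong]: "sets gauss = sets borel"
  by (simp add: gauss_def)

lemma space_gauss [simp]: "space gauss = UNIV"
  by (simp add: gauss_def)

lemma vec_nth_measurable [measurable]: "(\<lambda>x::real^'n. x $ i) \<in> borel_measurable borel"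
  by (intro borel_measurable_continuous_onI continuous_intros)

lemma vec_lambda_measurable:
  fixes f :: "'a \<Rightarrow> 'n::finite \<Rightarrow> real"
  assumes "\<And>i. (\<lambda>x. f x i) \<in> borel_measurable M"
  shows "(\<lambda>x. \<chi> i. f x i) \<in> borel_measurable M"
  by (subst borel_measurable_euclidean_space) (auto simp: Basis_vec_def inner_axis intro: assms)

lemma nn_integral_gauss_prod:
  fixes f :: "'n::finite \<Rightarrow> real \<Rightarrow> ennreal"
  assumes [measurable]: "\<And>i. f i \<in> borel_measurable borel"
  shows "(\<integral>\<^sup>+x. (\<Prod>i\<in>UNIV. f i (x $ i)) \<partial>gauss) = (\<Prod>i\<in>UNIV. (\<integral>\<^sup>+t. f i t \<partial>std_normal))"
proof -
  have "(\<integral>\<^sup>+x. (\<Prod>i\<in>UNIV. f i (x $ i)) \<partial>gauss)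
    = (\<integral>\<^sup>+x. (\<Prod>i\<in>UNIV. ennreal (std_normal_density (x $ i)) * f i (x $ i)) \<partial>lborel)"
    unfolding gauss_def by (subst nn_integral_density) (auto simp: prod.distrib)
  also have "\<dots> = (\<Prod>i\<in>UNIV. (\<integral>\<^sup>+t. ennreal (std_normal_density t) * f i t \<partial>lborel))"
    by (rule nn_integral_lborel_vec_prod) measurable
  finally show ?thesis by (simp add: nn_integral_density)
qed

lemma gauss_components:
  "distr gauss (\<Pi>\<^sub>M i\<in>UNIV. borel) (\<lambda>x. \<lambda>i\<in>UNIV. x $ i) = (\<Pi>\<^sub>M i\<in>(UNIV::'n::finite set). std_normal)"
proof -
  interpret prob_space std_normal by (rule prob_space_std_normal)
  interpret product_prob_space "\<lambda>_::'n. std_normal" by standard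
  have meas: "(\<lambda>x::real^'n. \<lambda>i\<in>UNIV. x $ i) \<in> measurable gauss (\<Pi>\<^sub>M i\<in>UNIV. borel)"
    by measurable
  show ?thesis
  proof (rule PiM_eqI)
    show "sets (distr gauss (Pi\<^sub>M UNIV (\<lambda>i. borel)) (\<lambda>x. \<lambda>i\<in>UNIV. x $ i)) = sets (Pi\<^sub>M (UNIV::'n set) (\<lambda>_. std_normal))"
      by (simp cong: sets_PiM_cong)
    fix A :: "'n \<Rightarrow> real set" assume "\<And>i. i \<in> UNIV \<Longrightarrow> A i \<in> sets std_normal"
    then have A [measurable]: "A i \<in> sets borel" for i by simp
    have "emeasure (distr gauss (Pi\<^sub>M UNIV (\<lambda>i. borel)) (\<lambda>x. \<lambda>i\<in>UNIV. x $ i)) (Pi\<^sub>E UNIV A)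
      = emeasure gauss ((\<lambda>x. \<lambda>i\<in>UNIV. x $ i) -` Pi\<^sub>E UNIV A \<inter> space gauss)"
      by (rule emeasure_distr[OF meas]) (auto intro!: sets_PiM_I_finite A)
    also have "(\<lambda>x. \<lambda>i\<in>UNIV. x $ i) -` Pi\<^sub>E UNIV A \<inter> space gauss = {x. \<forall>i. x $ i \<in> A i}"
      by auto
    also have "emeasure gauss {x. \<forall>i. x $ i \<in> A i} = (\<integral>\<^sup>+x. indicator {x. \<forall>i. x $ i \<in> A i} x \<partial>gauss)"
      by (rule nn_integral_indicator[symmetric]) simp
    also have "\<dots> = (\<integral>\<^sup>+x. (\<Prod>i\<in>UNIV. indicator (A i) (x $ i)) \<partial>gauss)"
      by (intro nn_integral_cong) (auto simp: indicator_def prod_zero_iff)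
    also have "\<dots> = (\<Prod>i\<in>UNIV. (\<integral>\<^sup>+t. indicator (A i) t \<partial>std_normal))"
      by (rule nn_integral_gauss_prod) measurable
    also have "\<dots> = (\<Prod>i\<in>UNIV. emeasure std_normal (A i))"
      by simp
    finally show "emeasure (distr gauss (Pi\<^sub>M UNIV (\<lambda>i. borel)) (\<lambda>x. \<lambda>i\<in>UNIV. x $ i)) (Pi\<^sub>E UNIV A)
      = (\<Prod>i\<in>UNIV. emeasure std_normal (A i))" .
  qed simp
qed

lemma gauss_eq_distr:
  "gauss = distr (\<Pi>\<^sub>M i\<in>(UNIV::'n::finite set). std_normal) borel (\<lambda>f. \<chi> i. f i)"
proof -
  have [measurable]: "(\<lambda>f. \<chi> i. f i) \<in> measurable (\<Pi>\<^sub>M i\<in>(UNIV::'n set). borel) (borel :: (real^'n) measure)"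
    by (rule vec_lambda_measurable) simp
  have "distr (\<Pi>\<^sub>M i\<in>(UNIV::'n set). std_normal) borel (\<lambda>f. \<chi> i. f i)
     = distr gauss borel ((\<lambda>f. \<chi> i. f i) \<circ> (\<lambda>x. \<lambda>i\<in>(UNIV::'n set). x $ i))"
    unfolding gauss_components[symmetric] by (subst distr_distr) measurable
  also have "(\<lambda>f. \<chi> i. f i) \<circ> (\<lambda>x. \<lambda>i\<in>(UNIV::'n set). x $ i) = (\<lambda>x::real^'n. x)"
    by (auto simp: vec_eq_iff)
  also have "distr gauss borel (\<lambda>x. x) = gauss" by (rule distr_id2) simp
  finally show ?thesis ..
qed

lemma prob_space_gauss: "prob_space (gauss :: (real^'n::finite) measure)"
proof
  show "emeasure (gauss :: (real^'n) measure) (space gauss) = 1"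
    using nn_integral_gauss_prod[of "\<lambda>(_::'n) _. 1"] prob_space.emeasure_space_1[OF prob_space_std_normal] by simp
qed

lemma borel_measurable_orthogonal:
  fixes Q :: "'a::euclidean_space \<Rightarrow> 'a"
  assumes "orthogonal_transformation Q" shows "Q \<in> borel_measurable borel"
  using assms by (intro borel_measurable_continuous_onI linear_continuous_on)
    (simp add: linear_conv_bounded_linear[symmetric] orthogonal_transformation_linear)

lemma lborel_orthogonal_distr:
  fixes Q :: "real^'n \<Rightarrow> real^'n"
  assumes Q: "orthogonal_transformation Q"
  shows "distr lborel borel Q = lborel"
proof (rule lborel_eqI[symmetric])
  obtain R where R: "orthogonal_transformation R" "\<And>x. R (Q x) = x" "\<And>x. Q (R x) = x"
    using orthogonal_transformation_inv[OF Q] orthogonal_transformation_bij[OF Q]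
    by (metis bij_inv_eq_iff)
  have Qm: "Q \<in> borel_measurable borel" using Q by (rule borel_measurable_orthogonal)
  fix l u :: "real^'n" assume lu: "\<And>b. b \<in> Basis \<Longrightarrow> l \<bullet> b \<le> u \<bullet> b"
  have "emeasure (distr lborel borel Q) (box l u) = emeasure lborel (Q -` box l u)"
    using Qm by (simp add: emeasure_distr)
  also have "Q -` box l u = R ` box l u" using R by (auto simp: image_iff) metis+
  also have "emeasure lborel (R ` box l u) = emeasure lebesgue (R ` box l u)"
  proof -
    have "R ` box l u \<in> sets borel"
      using measurable_sets[OF Qm[THEN measurable_completion], of "box l u"] Qm \<open>Q -` box l u = R ` box l u\<close>
      by (metis borel_open in_borel_measurable_borel lborelD open_box space_borel Int_UNIV_right sets_lborel)
    then show ?thesis by simp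
  qed
  also have "\<dots> = ennreal (measure lebesgue (R ` box l u))"
    by (rule emeasure_eq_measure2) (rule measurable_orthogonal_image_cart[OF R(1) lmeasurable_box])
  also have "measure lebesgue (R ` box l u) = measure lebesgue (box l u)"
    using R(1) by (rule measure_orthogonal_image_cart) (rule lmeasurable_box)
  also have "\<dots> = (\<Prod>b\<in>Basis. (u - l) \<bullet> b)"
    using lu by (simp add: measure_lborel_box)
  finally show "emeasure (distr lborel borel Q) (box l u) = ennreal (\<Prod>b\<in>Basis. (u - l) \<bullet> b)" .
qed simp

text \<open>Dependence on the norm alone is what makes the Gaussian measure rotation
  invariant.\<close>

lemma gauss_density_norm:
  "(\<Prod>i\<in>UNIV. ennreal (std_normal_density (x $ i))) = ennreal ((1 / sqrt (2 * pi)) ^ CARD('n) * exp (- (norm x)\<^sup>2 / 2))"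
  for x :: "real^'n::finite"
proof -
  have "(\<Prod>i\<in>UNIV. ennreal (std_normal_density (x $ i))) = ennreal (\<Prod>i\<in>UNIV. std_normal_density (x $ i))"
    by (simp add: prod_ennreal)
  also have "(\<Prod>i\<in>UNIV. std_normal_density (x $ i)) = (1 / sqrt (2 * pi)) ^ CARD('n) * exp (\<Sum>i\<in>UNIV. - (x $ i)\<^sup>2 / 2)"
    unfolding std_normal_density_def prod.distrib by (simp add: exp_sum)
  also have "(\<Sum>i\<in>UNIV. - (x $ i)\<^sup>2 / 2) = - (norm x)\<^sup>2 / 2"
    by (simp add: norm_vec_def L2_set_def sum_nonneg sum_negf sum_divide_distrib)
  finally show ?thesis .
qed

lemma gauss_orthogonal_distr:
  fixes Q :: "real^'n::finite \<Rightarrow> real^'n"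
  assumes Q: "orthogonal_transformation Q"
  shows "distr gauss borel Q = gauss"
proof -
  have Qm [measurable]: "Q \<in> borel_measurable borel" using Q by (rule borel_measurable_orthogonal)
  define p where "p x = ennreal ((1 / sqrt (2 * pi)) ^ CARD('n) * exp (- (norm x)\<^sup>2 / 2))" for x :: "real^'n"
  have [measurable]: "p \<in> borel_measurable borel" unfolding p_def by measurable
  have p: "p (Q x) = p x" for x using Q by (simp add: p_def orthogonal_transformation_norm)
  have g: "gauss = density lborel p" unfolding gauss_def gauss_density_norm p_def ..
  have "gauss = density (distr lborel borel Q) p" by (simp add: g lborel_orthogonal_distr[OF Q])
  also have "\<dots> = distr (density lborel (\<lambda>x. p (Q x))) borel Q"
    by (rule density_distr) auto
  finally show ?thesis by (simp add: p flip: g)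
qed

abbreviation gausses :: "'i set \<Rightarrow> ('i \<Rightarrow> real ^ 'n::finite) measure" where
  "gausses J \<equiv> \<Pi>\<^sub>M l\<in>J. gauss"

section \<open>The mean of the chi distribution\<close>

text \<open>The mean norm of a standard Gaussian vector in \<open>m\<close> dimensions. For
  \<open>m = 0\<close> the division by \<open>Gamma 0 = 0\<close> gives the right value 0.\<close>

definition chi_mean :: "nat \<Rightarrow> real" where
  "chi_mean m = sqrt 2 * Gamma ((real m + 1) / 2) / Gamma (real m / 2)"

lemma nn_integral_gaussian_half:
  assumes "0 < y"
  shows "(\<integral>\<^sup>+s. ennreal (indicator {0..} s * exp (- (s\<^sup>2 * y))) \<partial>lborel) = ennreal (sqrt pi / (2 * sqrt y))"
    (is "?J = _")
proof -
  let ?f = "\<lambda>s::real. ennreal (indicator {0..} s * exp (- s\<^sup>2))"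
  have "integrable lborel (\<lambda>s::real. indicator {0..} s * exp (- s\<^sup>2))"
    "integral\<^sup>L lborel (\<lambda>s::real. indicator {0..} s * exp (- s\<^sup>2)) = sqrt pi / 2"
    using gaussian_moment_0 by (auto simp: has_bochner_integral_iff)
  then have "ennreal (sqrt pi / 2) = (\<integral>\<^sup>+s. ?f s \<partial>lborel)"
    by (subst nn_integral_eq_integral) auto
  also have "\<dots> = ennreal \<bar>sqrt y\<bar> * (\<integral>\<^sup>+s. ?f (0 + sqrt y * s) \<partial>lborel)"
    using assms by (intro nn_integral_real_affine) auto
  also have "(\<lambda>s. ?f (0 + sqrt y * s)) = (\<lambda>s. ennreal (indicator {0..} s * exp (- (s\<^sup>2 * y))))"
    using assms by (auto simp: fun_eq_iff indicator_def zero_le_mult_iff power_mult_distrib mult.commute)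
  finally have eq: "ennreal (sqrt pi / 2) = ennreal (sqrt y) * ?J"
    using assms by simp
  have "?J
     = ennreal (1 / sqrt y) * (ennreal (sqrt y) * ?J)"
    using assms by (simp add: mult.assoc[symmetric] ennreal_mult[symmetric])
  also have "\<dots> = ennreal (1 / sqrt y) * ennreal (sqrt pi / 2)" by (simp only: eq)
  also have "\<dots> = ennreal (sqrt pi / (2 * sqrt y))"
    using assms by (subst ennreal_mult[symmetric]) (auto simp: field_simps)
  finally show ?thesis .
qed

lemma nn_integral_Gamma_scaled:
  assumes "0 < a" "0 < p"
  shows "(\<integral>\<^sup>+t. ennreal (indicator {0..} t * (t powr (p - 1) * exp (- (a * t)))) \<partial>lborel) = ennreal (Gamma p * a powr (-p))"
proof -
  let ?f = "\<lambda>t::real. ennreal (indicator {0..} t * t powr (p - 1) / exp t)"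
  let ?g = "\<lambda>t::real. ennreal (indicator {0..} t * (t powr (p - 1) * exp (- (a * t))))"
  have "ennreal (Gamma p) = (\<integral>\<^sup>+t. ?f t \<partial>lborel)"
    using assms by (intro Gamma_conv_nn_integral_real)
  also have "\<dots> = ennreal \<bar>a\<bar> * (\<integral>\<^sup>+t. ?f (0 + a * t) \<partial>lborel)"
    using assms by (intro nn_integral_real_affine) auto
  also have "(\<lambda>t. ?f (0 + a * t)) = (\<lambda>t. ennreal (a powr (p - 1)) * ?g t)"
    using assms by (auto simp: fun_eq_iff indicator_def zero_le_mult_iff powr_mult exp_minus field_simps
        ennreal_mult[symmetric])
  also have "(\<integral>\<^sup>+t. ennreal (a powr (p - 1)) * ?g t \<partial>lborel) = ennreal (a powr (p - 1)) * (\<integral>\<^sup>+t. ?g t \<partial>lborel)"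
    by (rule nn_integral_cmult) measurable
  finally have eq: "ennreal (Gamma p) = ennreal (a powr p) * (\<integral>\<^sup>+t. ?g t \<partial>lborel)"
    using assms by (simp add: mult.assoc[symmetric] ennreal_mult[symmetric] powr_mult_base)
  have "(\<integral>\<^sup>+t. ?g t \<partial>lborel) = ennreal (a powr (-p)) * (ennreal (a powr p) * (\<integral>\<^sup>+t. ?g t \<partial>lborel))"
    using assms by (simp add: mult.assoc[symmetric] ennreal_mult[symmetric] powr_add[symmetric])
  also have "\<dots> = ennreal (a powr (-p)) * ennreal (Gamma p)" by (simp only: eq)
  also have "\<dots> = ennreal (Gamma p * a powr (-p))"
    using assms by (simp add: ennreal_mult[symmetric] Gamma_real_nonneg mult.commute)
  finally show ?thesis .
qed

text \<open>The standard normal density times \<open>exp (- (l * x\<^sup>2))\<close> is a multiple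
  of another centred normal density, so both integrals are moments of that law.\<close>

lemma nn_integral_std_normal_exp:
  assumes "0 \<le> l"
  shows "(\<integral>\<^sup>+x. ennreal (exp (- (l * x\<^sup>2))) \<partial>std_normal) = ennreal ((1 + 2 * l) powr (- 1 / 2))" (is ?A)
    and "(\<integral>\<^sup>+x. ennreal (x\<^sup>2 * exp (- (l * x\<^sup>2))) \<partial>std_normal) = ennreal ((1 + 2 * l) powr (- 3 / 2))" (is ?B)
proof -
  \<comment> \<open>The exponents combine to \<open>- (1 + 2 * l) * x\<^sup>2 / 2\<close>, which
    belongs to the variance \<open>1 / (1 + 2 * l)\<close>.\<close>
  define \<sigma> where "\<sigma> = 1 / sqrt (1 + 2 * l)"
  have \<sigma>: "0 < \<sigma>" "\<sigma>\<^sup>2 = 1 / (1 + 2 * l)" using assms by (auto simp: \<sigma>_def power_divide)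
  have \<sigma>_powr: "\<sigma> = (1 + 2 * l) powr (- 1 / 2)" "\<sigma> * \<sigma>\<^sup>2 = (1 + 2 * l) powr (- 3 / 2)"
  proof -
    have "(1 + 2 * l) powr (- 1 / 2) = inverse ((1 + 2 * l) powr (1 / 2))"
      by (simp add: powr_minus[symmetric])
    then show 1: "\<sigma> = (1 + 2 * l) powr (- 1 / 2)"
      using assms by (simp add: \<sigma>_def powr_half_sqrt inverse_eq_divide)
    have "(1 + 2 * l) powr (- 3 / 2) = (1 + 2 * l) powr (- 1 / 2) * (1 + 2 * l) powr (- 1)"
      by (subst powr_add[symmetric]) simp
    also have "(1 + 2 * l) powr (- 1) = \<sigma>\<^sup>2"
      using assms \<sigma>(2) by (simp add: powr_minus_divide)
    finally show "\<sigma> * \<sigma>\<^sup>2 = (1 + 2 * l) powr (- 3 / 2)" by (simp only: 1)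
  qed
  have dens: "std_normal_density x * exp (- (l * x\<^sup>2)) = \<sigma> * normal_density 0 \<sigma> x" for x
  proof -
    have "\<sigma> * normal_density 0 \<sigma> x = \<sigma> / (sqrt (2 * pi) * \<sigma>) * exp (- x\<^sup>2 / (2 * \<sigma>\<^sup>2))"
      using \<sigma>(1) by (simp add: normal_density_def real_sqrt_mult)
    also have "- x\<^sup>2 / (2 * \<sigma>\<^sup>2) = - x\<^sup>2 / 2 - l * x\<^sup>2"
      unfolding \<sigma>(2) using assms by (simp add: field_simps)
    also have "\<sigma> / (sqrt (2 * pi) * \<sigma>) = 1 / sqrt (2 * pi)"
      using \<sigma>(1) by simp
    also have "1 / sqrt (2 * pi) * exp (- x\<^sup>2 / 2 - l * x\<^sup>2) = std_normal_density x * exp (- (l * x\<^sup>2))"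
      by (simp only: std_normal_density_def mult.assoc exp_add[symmetric] diff_conv_add_uminus)
    finally show ?thesis ..
  qed
  have "(\<integral>\<^sup>+x. ennreal (exp (- (l * x\<^sup>2))) \<partial>std_normal) = (\<integral>\<^sup>+x. ennreal (\<sigma> * normal_density 0 \<sigma> x) \<partial>lborel)"
    by (simp add: nn_integral_density ennreal_mult[symmetric] dens)
  also have "\<dots> = ennreal \<sigma>"
    using \<sigma>(1) by (subst nn_integral_eq_integral) auto
  finally show ?A using \<sigma>_powr by simp
  have mom: "has_bochner_integral lborel (\<lambda>x. normal_density 0 \<sigma> x * x\<^sup>2) (\<sigma>\<^sup>2)"
    using normal_moment_even[OF \<sigma>(1), of 0 1] by (simp add: fact_2 power2_eq_square)
  have "(\<integral>\<^sup>+x. ennreal (x\<^sup>2 * exp (- (l * x\<^sup>2))) \<partial>std_normal) = (\<integral>\<^sup>+x. ennreal (\<sigma> * (normal_density 0 \<sigma> x * x\<^sup>2)) \<partial>lborel)"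
  proof -
    have e: "std_normal_density x * (x\<^sup>2 * exp (- (l * x\<^sup>2))) = \<sigma> * (normal_density 0 \<sigma> x * x\<^sup>2)" for x
      using dens[of x] by (simp add: ac_simps)
    have "ennreal (std_normal_density x) * ennreal (x\<^sup>2 * exp (- (l * x\<^sup>2))) = ennreal (\<sigma> * (normal_density 0 \<sigma> x * x\<^sup>2))" for x
      by (subst ennreal_mult[symmetric], simp, simp) (simp only: e)
    then show ?thesis by (subst nn_integral_density) simp_all
  qed
  also have "\<dots> = ennreal (\<sigma> * \<sigma>\<^sup>2)"
    using \<sigma>(1) mom by (subst nn_integral_eq_integral) (auto simp: has_bochner_integral_iff)
  finally show ?B using \<sigma>_powr by simp
qed

text \<open>The value is minus the derivative in \<open>l\<close> of the Laplace transform
  \<open>(1 + 2 * l) powr (- card J / 2)\<close> of the squared norm. It is computed term by term,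
  each summand being a product over coordinates.\<close>

lemma nn_integral_gauss_sumsq_exp:
  fixes J :: "'n::finite set"
  assumes "0 \<le> l" and J: "J \<noteq> {}"
  shows "(\<integral>\<^sup>+x. ennreal ((\<Sum>i\<in>J. (x $ i)\<^sup>2) * exp (- (l * (\<Sum>i\<in>J. (x $ i)\<^sup>2)))) \<partial>gauss)
    = ennreal (card J * (1 + 2 * l) powr (- (card J / 2 + 1)))"
proof -
  have fin: "finite J" by simp
  define f where "f i j t = (if j \<notin> J then 1 else if j = i then ennreal (t\<^sup>2 * exp (- (l * t\<^sup>2))) else ennreal (exp (- (l * t\<^sup>2))))"
    for i j and t :: real
  have f_prod: "(\<Prod>j\<in>UNIV. f i j (x $ j)) = ennreal ((x $ i)\<^sup>2 * exp (- (l * (\<Sum>i\<in>J. (x $ i)\<^sup>2))))"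
    if i: "i \<in> J" for i and x :: "real^'n"
  proof -
    have "(\<Prod>j\<in>UNIV. f i j (x $ j)) = (\<Prod>j\<in>J. f i j (x $ j))"
      by (rule prod.mono_neutral_right) (auto simp: f_def)
    also have "\<dots> = ennreal ((x $ i)\<^sup>2 * exp (- (l * (x $ i)\<^sup>2))) * (\<Prod>j\<in>J-{i}. ennreal (exp (- (l * (x $ j)\<^sup>2))))"
      using i by (subst prod.remove[OF fin i]) (auto simp: f_def intro!: arg_cong2[where f="(*)"] prod.cong)
    also have "\<dots> = ennreal ((x $ i)\<^sup>2 * exp (- (l * (x $ i)\<^sup>2)) * exp (- (l * (\<Sum>j\<in>J-{i}. (x $ j)\<^sup>2))))"
      by (simp add: prod_ennreal ennreal_mult exp_sum[symmetric] sum_negf sum_distrib_left)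
    also have "(x $ i)\<^sup>2 * exp (- (l * (x $ i)\<^sup>2)) * exp (- (l * (\<Sum>j\<in>J-{i}. (x $ j)\<^sup>2)))
      = (x $ i)\<^sup>2 * exp (- (l * (\<Sum>i\<in>J. (x $ i)\<^sup>2)))"
      by (simp add: sum.remove[OF fin i] exp_add[symmetric] algebra_simps)
    finally show ?thesis .
  qed
  have f_int: "(\<Prod>j\<in>UNIV. (\<integral>\<^sup>+t. f i j t \<partial>std_normal)) = ennreal ((1 + 2 * l) powr (- (card J / 2 + 1)))" if i: "i \<in> J" for i
  proof -
    have one: "(\<integral>\<^sup>+t. 1 \<partial>std_normal) = 1"
      using prob_space.emeasure_space_1[OF prob_space_std_normal] by simp
    have "(\<Prod>j\<in>UNIV. (\<integral>\<^sup>+t. f i j t \<partial>std_normal)) = (\<Prod>j\<in>J. (\<integral>\<^sup>+t. f i j t \<partial>std_normal))"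
      using one by (intro prod.mono_neutral_right) (auto simp: f_def)
    also have "\<dots> = ennreal ((1 + 2 * l) powr (- 3 / 2)) * (\<Prod>j\<in>J-{i}. ennreal ((1 + 2 * l) powr (- 1 / 2)))"
    proof -
      have "f i i = (\<lambda>t. ennreal (t\<^sup>2 * exp (- (l * t\<^sup>2))))"
        using i by (simp add: f_def fun_eq_iff)
      moreover have "f i j = (\<lambda>t. ennreal (exp (- (l * t\<^sup>2))))" if "j \<in> J - {i}" for j
        using that by (simp add: f_def fun_eq_iff)
      ultimately show ?thesis
        using assms(1) by (subst prod.remove[OF fin i]) (simp only: nn_integral_std_normal_exp cong: prod.cong)
    qed
    also have "\<dots> = ennreal ((1 + 2 * l) powr (- 3 / 2) * ((1 + 2 * l) powr (- 1 / 2)) ^ (card J - 1))"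
      using i by (simp add: ennreal_power ennreal_mult)
    also have "(1 + 2 * l) powr (- 3 / 2) * ((1 + 2 * l) powr (- 1 / 2)) ^ (card J - 1)
       = (1 + 2 * l) powr (- 3 / 2) * (1 + 2 * l) powr ((card J - 1) * (- 1 / 2))"
      using assms(1) by (simp add: powr_power mult.commute)
    also have "\<dots> = (1 + 2 * l) powr (- 3 / 2 + (card J - 1) * (- 1 / 2))"
      by (rule powr_add[symmetric])
    also have "- 3 / 2 + real (card J - 1) * (- 1 / 2) = - (card J / 2 + 1)"
    proof -
      have "1 \<le> card J" using i fin card_gt_0_iff[of J] by auto
      then show ?thesis by (simp add: of_nat_diff field_simps)
    qed
    finally show ?thesis .
  qed
  have meas: "f i j \<in> borel_measurable borel" for i j
    unfolding f_def by (cases "j \<in> J"; cases "j = i") simp_all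
  have "(\<integral>\<^sup>+x. ennreal ((\<Sum>i\<in>J. (x $ i)\<^sup>2) * exp (- (l * (\<Sum>i\<in>J. (x $ i)\<^sup>2)))) \<partial>gauss)
    = (\<integral>\<^sup>+x. (\<Sum>i\<in>J. \<Prod>j\<in>UNIV. f i j (x $ j)) \<partial>gauss)"
    by (intro nn_integral_cong) (simp add: f_prod sum_ennreal sum_distrib_right)
  also have "\<dots> = (\<Sum>i\<in>J. \<integral>\<^sup>+x. (\<Prod>j\<in>UNIV. f i j (x $ j)) \<partial>gauss)"
    using meas by (intro nn_integral_sum borel_measurable_prod_ennreal) (auto intro!: measurable_compose[OF vec_nth_measurable])
  also have "\<dots> = (\<Sum>i\<in>J. ennreal ((1 + 2 * l) powr (- (card J / 2 + 1))))"
    using meas by (simp add: nn_integral_gauss_prod f_int)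
  finally show ?thesis by (simp add: ennreal_mult ennreal_of_nat_eq_real_of_nat)
qed

text \<open>Polar coordinates are avoided: the square root is written as a Gaussian integral over
  \<open>s\<close>, the mean over \<open>gauss\<close> becomes a power of
  \<open>1 + 2 * s\<^sup>2\<close>, this power becomes a Gamma integral over \<open>t\<close>, and
  exchanging \<open>s\<close> and \<open>t\<close> leaves a Gaussian and a Gamma integral.\<close>

lemma nn_integral_gauss_norm:
  fixes J :: "'n::finite set"
  assumes J: "J \<noteq> {}"
  shows "(\<integral>\<^sup>+x. ennreal (sqrt (\<Sum>i\<in>J. (x $ i)\<^sup>2)) \<partial>gauss) = ennreal (chi_mean (card J))"
proof -
  define m where "m = card J"
  define Y where "Y x = (\<Sum>i\<in>J. (x $ i)\<^sup>2)" for x :: "real^'n"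
  have Y0: "0 \<le> Y x" for x by (simp add: Y_def sum_nonneg)
  have Ym [measurable]: "Y \<in> borel_measurable borel" unfolding Y_def by measurable
  have m: "0 < m" using J by (simp add: m_def card_gt_0_iff)
  define p where "p = real m / 2 + 1"
  have p: "0 < p" by (simp add: p_def add_nonneg_pos)
  interpret G: prob_space "gauss :: (real^'n) measure" by (rule prob_space_gauss)
  interpret GL: pair_sigma_finite "gauss :: (real^'n) measure" "lborel :: real measure" by standard
  let ?I = "\<lambda>s::real. indicator {0..} s :: real"
  let ?f = "\<lambda>s x. ennreal (2 / sqrt pi * ?I s * (Y x * exp (- (s\<^sup>2 * Y x))))"
  let ?h = "\<lambda>s t. ennreal (2 / sqrt pi * m / Gamma p * (?I s * ?I t * (t powr (p - 1) * exp (- t) * exp (- (s\<^sup>2 * (2 * t))))))"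
  let ?r = "\<lambda>t. ennreal (m / (sqrt 2 * Gamma p)) * ennreal (?I t * (t powr ((p - 1 / 2) - 1) * exp (- (1 * t))))"
  have sqrtY: "ennreal (sqrt y) = (\<integral>\<^sup>+s. ennreal (2 / sqrt pi * ?I s * (y * exp (- (s\<^sup>2 * y)))) \<partial>lborel)" if "0 \<le> y" for y
  proof (cases "y = 0")
    case False
    then have y: "0 < y" using that by simp
    have "(\<integral>\<^sup>+s. ennreal (2 / sqrt pi * ?I s * (y * exp (- (s\<^sup>2 * y)))) \<partial>lborel)
        = (\<integral>\<^sup>+s. ennreal (2 / sqrt pi * y) * ennreal (?I s * exp (- (s\<^sup>2 * y))) \<partial>lborel)"
      using y by (intro nn_integral_cong) (simp add: ennreal_mult[symmetric] ac_simps)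
    also have "\<dots> = ennreal (2 / sqrt pi * y) * ennreal (sqrt pi / (2 * sqrt y))"
      using y by (simp add: nn_integral_cmult nn_integral_gaussian_half)
    also have "\<dots> = ennreal (sqrt y)"
      using y by (simp add: ennreal_mult[symmetric] field_simps real_sqrt_mult_self)
    finally show ?thesis ..
  qed simp
  have "(\<integral>\<^sup>+x. ennreal (sqrt (Y x)) \<partial>gauss)
      = (\<integral>\<^sup>+x. \<integral>\<^sup>+s. ?f s x \<partial>lborel \<partial>gauss)"
    using Y0 by (simp add: sqrtY)
  also have "\<dots> = (\<integral>\<^sup>+s. \<integral>\<^sup>+x. ?f s x \<partial>gauss \<partial>lborel)"
    by (rule GL.Fubini'[symmetric]) measurable
  also have "\<dots> = (\<integral>\<^sup>+s. ennreal (2 / sqrt pi * ?I s) * (\<integral>\<^sup>+x. ennreal (Y x * exp (- (s\<^sup>2 * Y x))) \<partial>gauss) \<partial>lborel)"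
  proof (intro nn_integral_cong)
    fix s :: real
    have "(\<integral>\<^sup>+x. ?f s x \<partial>gauss)
      = (\<integral>\<^sup>+x. ennreal (2 / sqrt pi * ?I s) * ennreal (Y x * exp (- (s\<^sup>2 * Y x))) \<partial>gauss)"
      using Y0 by (intro nn_integral_cong ennreal_mult) auto
    also have "\<dots> = ennreal (2 / sqrt pi * ?I s) * (\<integral>\<^sup>+x. ennreal (Y x * exp (- (s\<^sup>2 * Y x))) \<partial>gauss)"
      by (rule nn_integral_cmult) measurable
    finally show "(\<integral>\<^sup>+x. ?f s x \<partial>gauss)
      = ennreal (2 / sqrt pi * ?I s) * (\<integral>\<^sup>+x. ennreal (Y x * exp (- (s\<^sup>2 * Y x))) \<partial>gauss)" .
  qed
  also have "\<dots> = (\<integral>\<^sup>+s. ennreal (2 / sqrt pi * ?I s * (m * (1 + 2 * s\<^sup>2) powr (- p))) \<partial>lborel)"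
    unfolding Y_def by (intro nn_integral_cong, subst nn_integral_gauss_sumsq_exp[OF _ J], simp,
        subst ennreal_mult[symmetric]) (simp_all add: m_def p_def)
  also have "\<dots> = (\<integral>\<^sup>+s. \<integral>\<^sup>+t. ?h s t \<partial>lborel \<partial>lborel)"
  proof (intro nn_integral_cong)
    fix s :: real
    have pos: "0 < 1 + 2 * s\<^sup>2" by (simp add: add_pos_nonneg)
    have "(\<integral>\<^sup>+t. ?h s t \<partial>lborel)
      = (\<integral>\<^sup>+t. ennreal (2 / sqrt pi * m / Gamma p * ?I s) * ennreal (?I t * (t powr (p - 1) * exp (- ((1 + 2 * s\<^sup>2) * t)))) \<partial>lborel)"
      using p by (intro nn_integral_cong, subst ennreal_mult[symmetric])
        (auto simp: Gamma_real_nonneg exp_add[symmetric] algebra_simps intro!: arg_cong[where f=ennreal])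
    also have "\<dots> = ennreal (2 / sqrt pi * m / Gamma p * ?I s) * ennreal (Gamma p * (1 + 2 * s\<^sup>2) powr (-p))"
      using nn_integral_Gamma_scaled[OF pos p] by (subst nn_integral_cmult) auto
    also have "\<dots> = ennreal (2 / sqrt pi * ?I s * (m * (1 + 2 * s\<^sup>2) powr (- p)))"
      using Gamma_real_pos[OF p] by (subst ennreal_mult[symmetric]) (auto intro!: arg_cong[where f=ennreal])
    finally show "ennreal (2 / sqrt pi * ?I s * (m * (1 + 2 * s\<^sup>2) powr (- p)))
      = (\<integral>\<^sup>+t. ?h s t \<partial>lborel)" ..
  qed
  also have "\<dots> = (\<integral>\<^sup>+t. \<integral>\<^sup>+s. ?h s t \<partial>lborel \<partial>lborel)"
    by (rule lborel_pair.Fubini') measurable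
  also have "\<dots> = (\<integral>\<^sup>+t. ?r t \<partial>lborel)"
  proof (rule nn_integral_cong_AE)
    have "AE t in lborel. t \<noteq> (0::real)" by (rule AE_lborel_singleton)
    then show "AE t in lborel. (\<integral>\<^sup>+s. ?h s t \<partial>lborel)
        = ?r t"
    proof eventually_elim
      fix t :: real assume t0: "t \<noteq> 0"
      show "(\<integral>\<^sup>+s. ?h s t \<partial>lborel)
        = ?r t"
      proof (cases "0 < t")
        case True
        have "(\<integral>\<^sup>+s. ?h s t \<partial>lborel)
          = (\<integral>\<^sup>+s. ennreal (2 / sqrt pi * m / Gamma p * (t powr (p - 1) * exp (- t))) * ennreal (?I s * exp (- (s\<^sup>2 * (2 * t)))) \<partial>lborel)"
          using p True Gamma_real_pos[OF p] by (intro nn_integral_cong, subst ennreal_mult[symmetric])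
            (auto intro!: arg_cong[where f=ennreal])
        also have "\<dots> = ennreal (2 / sqrt pi * m / Gamma p * (t powr (p - 1) * exp (- t))) * ennreal (sqrt pi / (2 * sqrt (2 * t)))"
          using nn_integral_gaussian_half[of "2 * t"] True by (subst nn_integral_cmult) auto
        also have "\<dots> = ennreal (m / (sqrt 2 * Gamma p) * (t powr (p - 1) / sqrt t * exp (- t)))"
          using Gamma_real_pos[OF p] True
          by (subst ennreal_mult[symmetric]) (auto simp: real_sqrt_mult field_simps intro!: arg_cong[where f=ennreal])
        also have "t powr (p - 1) / sqrt t = t powr ((p - 1 / 2) - 1)"
          using True by (simp add: powr_half_sqrt[symmetric] powr_diff[symmetric] algebra_simps)
        also have "ennreal (m / (sqrt 2 * Gamma p) * (t powr ((p - 1 / 2) - 1) * exp (- t)))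
          = ?r t"
          using True Gamma_real_pos[OF p] by (subst ennreal_mult[symmetric]) auto
        finally show ?thesis .
      next
        case False
        then have "?I t = 0" using t0 by (simp add: indicator_def)
        then show ?thesis by simp
      qed
    qed
  qed
  also have "\<dots> = ennreal (m / (sqrt 2 * Gamma p)) * ennreal (Gamma (p - 1 / 2))"
    using nn_integral_Gamma_scaled[of 1 "p - 1/2"] m by (subst nn_integral_cmult) (auto simp: p_def add_nonneg_pos)
  also have "\<dots> = ennreal (m / (sqrt 2 * Gamma p) * Gamma (p - 1 / 2))"
    using Gamma_real_pos[OF p] m by (intro ennreal_mult[symmetric]) (auto simp: p_def intro!: Gamma_real_nonneg)
  also have "m / (sqrt 2 * Gamma p) * Gamma (p - 1 / 2) = chi_mean m"
  proof -
    have "real m / 2 \<notin> \<int>\<^sub>\<le>\<^sub>0" using m nonpos_Ints_nonpos[of "real m / 2"] by fastforce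
    then have g: "Gamma p = real m / 2 * Gamma (real m / 2)"
      using m Gamma_plus1[of "real m / 2"] by (simp add: p_def add.commute)
    have q: "p - 1 / 2 = (real m + 1) / 2" by (simp add: p_def field_simps)
    have "real m / (sqrt 2 * (real m / 2 * y)) * x = sqrt 2 * x / y" for x y :: real
    proof -
      have "real m / (sqrt 2 * (real m / 2 * y)) = (2 / sqrt 2) / y" using m by simp
      also have "2 / sqrt 2 = sqrt (2::real)" by (rule real_div_sqrt) simp
      finally show ?thesis by simp
    qed
    then show ?thesis unfolding q g chi_mean_def .
  qed
  finally show ?thesis by (simp add: Y_def m_def)
qed

section \<open>Determinants with Gaussian columns\<close>

text \<open>The Householder reflection in the hyperplane orthogonal to \<open>v\<close>; for
  \<open>v = 0\<close> it is the identity.\<close>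

definition reflect :: "'a::real_inner \<Rightarrow> 'a \<Rightarrow> 'a" where
  "reflect v x = x - (2 * (x \<bullet> v) / (v \<bullet> v)) *\<^sub>R v"

lemma orthogonal_transformation_reflect: "orthogonal_transformation (reflect v)"
  for v :: "'a::euclidean_space"
proof (cases "v = 0")
  case True
  then have "reflect v = id" by (auto simp: reflect_def)
  then show ?thesis by (simp add: orthogonal_transformation_def linear_iff)
next
  case False
  have "linear (reflect v)"
    by (rule linearI) (simp_all add: reflect_def inner_add_left algebra_simps add_divide_distrib)
  moreover have "reflect v x \<bullet> reflect v y = x \<bullet> y" for x y
    using False by (simp add: reflect_def inner_diff_left inner_diff_right inner_commute field_simps)
  ultimately show ?thesis by (simp add: orthogonal_transformation_def)
qed

lemma reflect_swap:
  fixes x y :: "'a::euclidean_space"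
  assumes "norm x = norm y" shows "reflect (x - y) x = y"
proof (cases "x = y")
  case False
  have "(x - y) \<bullet> (x - y) = 2 * (x \<bullet> (x - y))"
    using assms by (simp add: inner_diff_left inner_diff_right inner_commute norm_eq_sqrt_inner)
  moreover have "(x - y) \<bullet> (x - y) \<noteq> 0" using False by simp
  ultimately have "2 * (x \<bullet> (x - y)) / ((x - y) \<bullet> (x - y)) = 1" by (metis divide_self)
  then have "reflect (x - y) x = x - 1 *\<^sub>R (x - y)" unfolding reflect_def by (simp only:)
  then show ?thesis by simp
qed (simp add: reflect_def)

lemma reflect_orthogonal: "x \<bullet> v = 0 \<Longrightarrow> reflect v x = x"
  by (simp add: reflect_def)

text \<open>The axis columns stand for coordinates already eliminated, so every stage of the
  elimination keeps the same matrix type. Under \<open>transpose\<close> the columns are written as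
  rows, to which the determinant rules apply.\<close>

definition colmat :: "'n::finite set \<Rightarrow> 'n \<Rightarrow> real^'n \<Rightarrow> ('n \<Rightarrow> real^'n) \<Rightarrow> real^'n^'n" where
  "colmat J c x g = transpose (\<chi> l. if l = c then x else if l \<in> J then g l else axis l 1)"

lemma row_vec_lambda: "row j (\<chi> l. f l) = f j"
  by (simp add: row_def vec_eq_iff)

definition gdet :: "'n::finite set \<Rightarrow> 'n \<Rightarrow> real^'n \<Rightarrow> ennreal" where
  "gdet J c x = (\<integral>\<^sup>+g. ennreal \<bar>det (colmat J c x g)\<bar> \<partial>(gausses J))"

definition keep :: "'n::finite set \<Rightarrow> real^'n \<Rightarrow> real^'n" where
  "keep J x = (\<chi> i. if i \<in> J then x $ i else 0)"

lemma det_measurable: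
  fixes A :: "'a \<Rightarrow> real^'n::finite^'n"
  assumes "\<And>i j. (\<lambda>x. A x $ i $ j) \<in> borel_measurable M"
  shows "(\<lambda>x. det (A x)) \<in> borel_measurable M"
  unfolding det_def using assms by (intro borel_measurable_sum borel_measurable_times borel_measurable_prod) auto

lemma colmat_measurable:
  assumes "\<And>l. l \<in> J \<Longrightarrow> (\<lambda>w. g w l) \<in> borel_measurable M" "x \<in> borel_measurable M"
  shows "(\<lambda>w. ennreal \<bar>det (colmat J c (x w) (g w))\<bar>) \<in> borel_measurable M"
proof -
  have "(\<lambda>w. colmat J c (x w) (g w) $ i $ j) \<in> borel_measurable M" for i j
    using measurable_compose[OF assms(1) vec_nth_measurable] measurable_compose[OF assms(2) vec_nth_measurable]
    by (cases "j = c"; cases "j \<in> J") (simp_all add: colmat_def transpose_def)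
  then have [measurable]: "(\<lambda>w. det (colmat J c (x w) (g w))) \<in> borel_measurable M" by (rule det_measurable)
  show ?thesis by measurable
qed

lemma PiM_gauss_component:
  "l \<in> J \<Longrightarrow> (\<lambda>g. g l) \<in> borel_measurable (\<Pi>\<^sub>M l\<in>J. (gauss :: (real^'n::finite) measure))"
  using measurable_component_singleton[of l J "\<lambda>_. gauss :: (real^'n) measure"]
  by (simp cong: measurable_cong_sets)

text \<open>Applying \<open>Q\<close> to every column keeps the absolute determinant, the joint law
  of the Gaussian columns and, by hypothesis, the axis columns; only the column \<open>x\<close>
  changes.\<close>

lemma gdet_orthogonal:
  assumes Q: "orthogonal_transformation Q"
    and fix_axis: "\<And>l. l \<notin> J \<Longrightarrow> l \<noteq> c \<Longrightarrow> Q (axis l 1) = axis l 1"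
  shows "gdet J c (Q x) = gdet J c x"
proof -
  have lin: "linear Q" using Q by (rule orthogonal_transformation_linear)
  have Qm: "Q \<in> borel_measurable borel" using Q by (rule borel_measurable_orthogonal)
  have abs_eq: "\<bar>det (colmat J c (Q x) (compose J Q g))\<bar> = \<bar>det (colmat J c x g)\<bar>" for g
  proof -
    have "matrix Q ** colmat J c x g = colmat J c (Q x) (compose J Q g)"
    proof -
      have "column j (matrix Q ** colmat J c x g) = column j (colmat J c (Q x) (compose J Q g))" for j
      proof -
        have "column j (matrix Q ** colmat J c x g) = matrix Q *v column j (colmat J c x g)"
          by (simp add: column_def matrix_matrix_mult_def matrix_vector_mult_def vec_eq_iff)
        also have "\<dots> = Q (column j (colmat J c x g))" by (simp add: matrix_works lin)
        also have "\<dots> = column j (colmat J c (Q x) (compose J Q g))"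
          using fix_axis[of j] by (simp add: colmat_def compose_def row_vec_lambda)
        finally show ?thesis .
      qed
      then show ?thesis by (simp add: column_def vec_eq_iff)
    qed
    then have "det (matrix Q) * det (colmat J c x g) = det (colmat J c (Q x) (compose J Q g))"
      by (metis det_mul)
    then show ?thesis using orthogonal_transformation_det[OF Q] by (metis abs_mult mult_1)
  qed
  have distr: "distr (gausses J) (gausses J) (compose J Q) = (gausses J)"
  proof -
    have "distr (gausses J) (gausses J) (compose J Q) = (\<Pi>\<^sub>M l\<in>J. distr gauss gauss Q)"
      using Qm by (intro distr_PiM_finite_prob_space') (auto simp: prob_space_gauss)
    also have "distr gauss gauss Q = distr gauss borel Q" by (rule distr_cong) auto
    finally show ?thesis by (simp add: gauss_orthogonal_distr[OF Q])
  qed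
  have "(\<lambda>g. Q (g l)) \<in> measurable (gausses J) gauss" if "l \<in> J" for l
    using measurable_compose[OF PiM_gauss_component[OF that] Qm] by (simp cong: measurable_cong_sets)
  then have Qc: "compose J Q \<in> measurable (gausses J) (gausses J)"
    unfolding compose_def by (rule measurable_restrict)
  have "gdet J c (Q x) = (\<integral>\<^sup>+g. ennreal \<bar>det (colmat J c (Q x) g)\<bar> \<partial>distr (gausses J) (gausses J) (compose J Q))"
    by (simp only: gdet_def distr)
  also have "\<dots> = (\<integral>\<^sup>+g. ennreal \<bar>det (colmat J c (Q x) (compose J Q g))\<bar> \<partial>(gausses J))"
    by (intro nn_integral_distr Qc colmat_measurable) (auto intro: PiM_gauss_component)
  also have "\<dots> = gdet J c x" by (simp add: abs_eq gdet_def)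
  finally show ?thesis .
qed

text \<open>The other coordinates of \<open>x\<close> are cleared by subtracting multiples of the
  axis columns.\<close>

lemma gdet_keep: "gdet J c (keep (insert c J) x) = gdet J c x"
proof -
  have "det (colmat J c x g) = det (colmat J c (keep (insert c J) x) g)" for g
  proof -
    let ?A = "\<chi> l. if l = c then keep (insert c J) x else if l \<in> J then g l else axis l (1::real)"
    let ?d = "x - keep (insert c J) x"
    have "?d = (\<Sum>l\<in>-insert c J. x $ l *\<^sub>R axis l 1)"
      by (auto simp: vec_eq_iff keep_def axis_def if_distrib cong: if_cong)
    also have "\<dots> \<in> span {row j ?A | j. j \<noteq> c}"
      by (intro span_sum span_scale span_base) (auto simp: row_def vec_eq_iff intro!: exI)
    finally have "?d \<in> vec.span {row j ?A | j. j \<noteq> c}" by (simp add: span_vec_eq)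
    then have "det (\<chi> k. if k = c then row c ?A + ?d else row k ?A) = det ?A"
      by (rule det_row_span)
    also have "(\<chi> k. if k = c then row c ?A + ?d else row k ?A) = (\<chi> l. if l = c then x else if l \<in> J then g l else axis l 1)"
      by (auto simp: vec_eq_iff row_def)
    finally show ?thesis by (simp add: colmat_def)
  qed
  then show ?thesis by (simp add: gdet_def)
qed

lemma gdet_scale: "0 \<le> a \<Longrightarrow> gdet J c (a *\<^sub>R x) = ennreal a * gdet J c x"
proof -
  assume a: "0 \<le> a"
  have "det (colmat J c (a *\<^sub>R x) g) = a * det (colmat J c x g)" for g
    using det_row_mul[of c a "\<lambda>_. x" "\<lambda>l. if l \<in> J then g l else axis l 1"]
    unfolding colmat_def scalar_mult_eq_scaleR by simp
  then have "gdet J c (a *\<^sub>R x) = (\<integral>\<^sup>+g. ennreal a * ennreal \<bar>det (colmat J c x g)\<bar> \<partial>(gausses J))"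
    using a by (simp add: gdet_def abs_mult ennreal_mult)
  also have "\<dots> = ennreal a * gdet J c x"
    unfolding gdet_def by (intro nn_integral_cmult colmat_measurable)
      (auto intro: PiM_gauss_component)
  finally show ?thesis .
qed

text \<open>A reflection takes the kept part of \<open>x\<close> to a multiple of the axis
  \<open>c\<close>. Its vector \<open>v\<close> vanishes in the eliminated coordinates, so their
  axes are fixed, as \<open>gdet_orthogonal\<close> demands.\<close>

lemma gdet_norm: "gdet J c x = ennreal (norm (keep (insert c J) x)) * gdet J c (axis c 1)"
proof -
  define z where "z = keep (insert c J) x"
  define v where "v = z - norm z *\<^sub>R axis c 1"
  have "reflect v (axis l 1) = axis l 1" if "l \<notin> J" "l \<noteq> c" for l
  proof (rule reflect_orthogonal)
    have "z $ l = 0" "axis c (1::real) $ l = 0" using that by (simp_all add: z_def keep_def axis_def)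
    then show "axis l 1 \<bullet> v = 0" by (simp add: v_def inner_axis' inner_diff_right)
  qed
  then have "gdet J c (reflect v z) = gdet J c z"
    by (intro gdet_orthogonal orthogonal_transformation_reflect)
  moreover have "reflect v z = norm z *\<^sub>R axis c 1"
    unfolding v_def by (rule reflect_swap) simp
  ultimately have "gdet J c z = ennreal (norm z) * gdet J c (axis c 1)"
    by (simp add: gdet_scale)
  then show ?thesis by (simp add: z_def gdet_keep)
qed

lemma norm_keep: "norm (keep J x) = sqrt (\<Sum>i\<in>J. (x $ i)\<^sup>2)"
proof -
  have "(\<Sum>i\<in>UNIV. (keep J x $ i)\<^sup>2) = (\<Sum>i\<in>J. (x $ i)\<^sup>2)"
    by (rule sum.mono_neutral_cong_right) (auto simp: keep_def)
  then show ?thesis by (simp add: norm_vec_def L2_set_def)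
qed

lemma chi_mean_nonneg: "0 \<le> chi_mean m"
  by (cases "m = 0") (auto simp: chi_mean_def intro!: divide_nonneg_nonneg mult_nonneg_nonneg Gamma_real_nonneg)

text \<open>With an axis in column \<open>c\<close> that coordinate is eliminated too, and a
  Gaussian column \<open>b\<close> takes over the role of the distinguished vector. Its kept part
  has \<open>card (insert b J)\<close> coordinates, which yields one chi mean per round.\<close>

lemma gdet_axis: "c \<notin> J \<Longrightarrow> gdet J c (axis c 1) = ennreal (\<Prod>m=1..card J. chi_mean m)"
proof -
  have "finite J" by simp
  then show "c \<notin> J \<Longrightarrow> gdet J c (axis c 1) = ennreal (\<Prod>m=1..card J. chi_mean m)"
  proof (induction J arbitrary: c rule: finite_induct)
    case empty
    have "colmat {} c (axis c 1) g = mat 1" for g :: "'a \<Rightarrow> real^'a"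
      by (auto simp: colmat_def transpose_def mat_def axis_def vec_eq_iff)
    then show ?case by (simp add: gdet_def PiM_empty nn_integral_count_space_finite)
  next
    case (insert b J)
    interpret prob_space "gauss :: (real^'a) measure" by (rule prob_space_gauss)
    interpret product_prob_space "\<lambda>_::'a. gauss :: (real^'a) measure" by standard
    have eq: "colmat (insert b J) c (axis c 1) (g(b := y)) = colmat J b y g" for g y
      using insert by (auto simp: colmat_def vec_eq_iff transpose_def)
    have "gdet (insert b J) c (axis c 1)
      = (\<integral>\<^sup>+y. \<integral>\<^sup>+g. ennreal \<bar>det (colmat (insert b J) c (axis c 1) (g(b := y)))\<bar> \<partial>(gausses J) \<partial>gauss)"
      unfolding gdet_def using insert.hyps
      by (intro product_nn_integral_insert_rev colmat_measurable)
        (auto intro: PiM_gauss_component)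
    also have "\<dots> = (\<integral>\<^sup>+y. gdet J b y \<partial>gauss)" by (simp only: eq gdet_def)
    also have "\<dots> = (\<integral>\<^sup>+y. ennreal (sqrt (\<Sum>i\<in>insert b J. (y $ i)\<^sup>2)) * gdet J b (axis b 1) \<partial>gauss)"
      by (intro nn_integral_cong) (subst gdet_norm, simp only: norm_keep)
    also have "\<dots> = (\<integral>\<^sup>+y. ennreal (sqrt (\<Sum>i\<in>insert b J. (y $ i)\<^sup>2)) \<partial>gauss) * gdet J b (axis b 1)"
      by (rule nn_integral_multc) measurable
    also have "\<dots> = ennreal (chi_mean (card (insert b J))) * ennreal (\<Prod>m=1..card J. chi_mean m)"
      using insert.hyps by (subst nn_integral_gauss_norm) (simp_all add: insert.IH)
    also have "\<dots> = ennreal (\<Prod>m=1..card (insert b J). chi_mean m)"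
      using insert.hyps
      by (subst ennreal_mult[symmetric])
        (auto intro!: prod_nonneg chi_mean_nonneg simp: mult.commute)
    finally show ?case .
  qed
qed

lemma gdet_value:
  "c \<notin> J \<Longrightarrow> gdet J c x = ennreal (norm (keep (insert c J) x) * (\<Prod>m=1..card J. chi_mean m))"
  by (subst gdet_norm, subst gdet_axis) (auto simp: ennreal_mult prod_nonneg chi_mean_nonneg)

section \<open>Riemann sums of power type\<close>

lemma set_integrable_powr:
  fixes p :: real
  assumes "0 < p"
  shows "integrable lborel (\<lambda>x. indicator {0<..1} x * x powr (p - 1))"
proof -
  have "integrable lborel (\<lambda>x. indicator {0..1} x *\<^sub>R (x powr (p - 1) * (1 - x) powr (1 - 1)))"
    using integrable_Beta[OF assms, of 1] by (simp add: set_integrable_def)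
  moreover have "AE x in lborel. x \<noteq> (0::real)" "AE x in lborel. x \<noteq> (1::real)"
    by (rule AE_lborel_singleton)+
  then have "AE x in lborel. indicator {0..1} x *\<^sub>R (x powr (p - 1) * (1 - x) powr (1 - 1)) = indicator {0<..1} x * x powr (p - 1)"
    by eventually_elim (auto simp: indicator_def)
  ultimately show ?thesis by (subst (asm) integrable_cong_AE) auto
qed

lemma integral_Beta_lborel:
  fixes p b :: real
  assumes "0 < p" "0 < b"
  shows "(\<integral>x. indicator {0<..1} x * (x powr (p - 1) * (1 - x) powr (b - 1)) \<partial>lborel) = Beta p b"
proof -
  have eq: "indicator {0<..1} x * (x powr (p - 1) * (1 - x) powr (b - 1))
      = indicator {0..1} x *\<^sub>R (x powr (p - 1) * (1 - x) powr (b - 1))" for x :: real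
    by (cases "x = 0") (auto simp: indicator_def)
  have "(\<integral>x. indicator {0<..1} x * (x powr (p - 1) * (1 - x) powr (b - 1)) \<partial>lborel)
      = integral {0..1} (\<lambda>x. x powr (p - 1) * (1 - x) powr (b - 1))"
    unfolding eq using set_borel_integral_eq_integral(2)[OF integrable_Beta[OF assms]]
    by (simp only: set_lebesgue_integral_def)
  then show ?thesis
    using integral_unique[OF has_integral_Beta_real[OF assms]] by simp
qed

text \<open>The sum is the integral of a step function. For \<open>p < 1\<close> the limit function
  may be unbounded near 0, so the passage to the limit is by dominated convergence.\<close>

lemma riemann_sum_powr:
  fixes a :: "nat \<Rightarrow> real" and w :: "real \<Rightarrow> real"
  assumes p: "0 < p" and w: "continuous_on {0..1} w"
    and a: "(\<lambda>j. a j / real j powr (p - 1)) \<longlonglongrightarrow> c"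
  shows "(\<lambda>n. (\<Sum>j=1..n. w (j / n) * a j) / real n powr p)
    \<longlonglongrightarrow> (\<integral>x. indicator {0<..1} x * (c * (w x * x powr (p - 1))) \<partial>lborel)"
proof -
  obtain W where "\<forall>x\<in>w ` {0..1}. norm x \<le> W"
    using compact_imp_bounded[OF compact_continuous_image[OF w compact_Icc]] unfolding bounded_iff by blast
  then have W: "\<bar>w x\<bar> \<le> W" if "x \<in> {0..1}" for x using that by auto
  obtain C where C: "\<And>j. \<bar>a j / real j powr (p - 1)\<bar> \<le> C"
    using convergent_imp_Bseq[OF convergentI[OF a]] by (auto simp: Bseq_def)
  have W0: "0 \<le> W" using W[of 0] by simp
  have C0: "0 \<le> C" using C[of 0] by simp
  define g where "g n j = w (j / n) * a j / real n powr (p - 1)" for n j :: nat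
  \<comment> \<open>Half-open cells with the value taken at the right end: \<open>j / n\<close> is
    never less than \<open>x\<close>, so a negative power of \<open>j / n\<close> is bounded by that
    of \<open>x\<close>.\<close>
  define f where "f n x = (\<Sum>j=1..n. g n j * indicator {(j - 1) / n <.. j / n} x)" for n :: nat and x :: real
  have idx: "1 \<le> nat \<lceil>n * x\<rceil>" "nat \<lceil>n * x\<rceil> \<le> n" "n * x \<le> real (nat \<lceil>n * x\<rceil>)"
    if "0 < n" "x \<in> {0<..1}" for n :: nat and x :: real
  proof -
    have "0 < n * x" using that by simp
    then have "0 < \<lceil>n * x\<rceil>" by (simp only: zero_less_ceiling)
    then show "1 \<le> nat \<lceil>n * x\<rceil>" by linarith
    show "nat \<lceil>n * x\<rceil> \<le> n" using that by (auto simp: nat_le_iff ceiling_le_iff field_simps)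
    show "n * x \<le> real (nat \<lceil>n * x\<rceil>)" by linarith
  qed
  have f_eq: "f n x = indicator {0<..1} x * g n (nat \<lceil>n * x\<rceil>)" if n: "0 < n" for n x
  proof -
    have iff: "x \<in> {(real j - 1) / n <.. j / n} \<longleftrightarrow> nat \<lceil>n * x\<rceil> = j" if "1 \<le> j" for j
    proof -
      have "x \<in> {(real j - 1) / n <.. j / n} \<longleftrightarrow> real j - 1 < n * x \<and> n * x \<le> j"
        using n by (auto simp: field_simps)
      also have "\<dots> \<longleftrightarrow> \<lceil>n * x\<rceil> = int j" by (auto simp: ceiling_eq_iff)
      also have "z = int j \<longleftrightarrow> nat z = j" for z using that by arith
      finally show ?thesis .
    qed
    have "f n x = (\<Sum>j=1..n. if nat \<lceil>n * x\<rceil> = j then g n j else 0)"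
      unfolding f_def using iff by (intro sum.cong) (auto simp: indicator_def of_nat_diff)
    also have "\<dots> = (if nat \<lceil>n * x\<rceil> \<in> {1..n} then g n (nat \<lceil>n * x\<rceil>) else 0)"
      by (rule sum.delta') simp
    also have "nat \<lceil>n * x\<rceil> \<in> {1..n} \<longleftrightarrow> x \<in> {0<..1}"
    proof -
      have "1 \<le> nat \<lceil>n * x\<rceil> \<longleftrightarrow> 0 < x"
      proof -
        have "1 \<le> nat c \<longleftrightarrow> 0 < c" for c :: int by arith
        then show ?thesis using n by (simp only: zero_less_ceiling) (simp add: zero_less_mult_iff)
      qed
      moreover have "nat \<lceil>n * x\<rceil> \<le> n \<longleftrightarrow> x \<le> 1"
        using n by (auto simp: nat_le_iff ceiling_le_iff field_simps)
      ultimately show ?thesis by auto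
    qed
    finally show ?thesis by (simp add: indicator_def)
  qed
  have f_0: "f n x = 0" if "n = 0 \<or> x \<notin> {0<..1}" for n x
  proof (cases "n = 0")
    case True
    then show ?thesis by (simp add: f_def)
  next
    case False
    then show ?thesis using that by (simp add: f_eq)
  qed
  have f_int: "(\<integral>x. f n x \<partial>lborel) = (\<Sum>j=1..n. w (j / n) * a j) / real n powr p" if n: "0 < n" for n
  proof -
    have "(\<integral>x. f n x \<partial>lborel) = (\<Sum>j=1..n. (\<integral>x. g n j * indicator {(j - 1) / n <.. j / n} x \<partial>lborel))"
      unfolding f_def by (intro Bochner_Integration.integral_sum) (simp add: emeasure_lborel_Ioc divide_right_mono)
    also have "\<dots> = (\<Sum>j=1..n. g n j * (1 / n))"
      using n by (intro sum.cong) (auto simp: measure_lborel_Ioc of_nat_diff field_simps)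
    also have "\<dots> = (\<Sum>j=1..n. w (j / n) * a j) / real n powr p"
      using n by (simp add: g_def sum_divide_distrib powr_diff)
    finally show ?thesis .
  qed
  have "(\<lambda>n. \<integral>x. f n x \<partial>lborel) \<longlonglongrightarrow> (\<integral>x. indicator {0<..1} x * (c * (w x * x powr (p - 1))) \<partial>lborel)"
  proof (rule integral_dominated_convergence)
    have "continuous_on {0<..1} w" by (rule continuous_on_subset[OF w]) auto
    then have "(\<lambda>x. indicator {0<..1} x *\<^sub>R w x) \<in> borel_measurable borel"
      by (intro borel_measurable_continuous_on_indicator) auto
    then show "(\<lambda>x. indicator {0<..1} x * (c * (w x * x powr (p - 1)))) \<in> borel_measurable lborel"
    proof -
      assume [measurable]: "(\<lambda>x. indicator {0<..1} x *\<^sub>R w x) \<in> borel_measurable borel"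
      have "(\<lambda>x. c * (indicator {0<..1} x *\<^sub>R w x) * x powr (p - 1)) \<in> borel_measurable lborel" by measurable
      then show ?thesis by (simp add: ac_simps)
    qed
    show "f n \<in> borel_measurable lborel" for n unfolding f_def by measurable
    show "integrable lborel (\<lambda>x. W * C * (indicator {0<..1} x + indicator {0<..1} x * x powr (p - 1)))"
      using set_integrable_powr[OF p] by (intro integrable_mult_right Bochner_Integration.integrable_add) auto
    show "AE x in lborel. norm (f n x) \<le> W * C * (indicator {0<..1} x + indicator {0<..1} x * x powr (p - 1))" for n
    proof (intro AE_I2)
      fix x :: real
      show "norm (f n x) \<le> W * C * (indicator {0<..1} x + indicator {0<..1} x * x powr (p - 1))"
      proof (cases "0 < n \<and> x \<in> {0<..1}")
        case True
        define j where "j = nat \<lceil>n * x\<rceil>"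
        define y where "y = real j / n"
        have j: "1 \<le> j" "j \<le> n" "n * x \<le> j"
          using True idx[of n x] by (auto simp: j_def)
        have y: "x \<le> y" "0 < y" "y \<le> 1" using j True by (auto simp: y_def field_simps)
        have "g n j = w y * (a j / real j powr (p - 1)) * y powr (p - 1)"
          using j True by (simp add: g_def y_def powr_divide)
        then have "\<bar>g n j\<bar> = \<bar>w y\<bar> * \<bar>a j / real j powr (p - 1)\<bar> * y powr (p - 1)"
          by (simp add: abs_mult)
        also have "\<dots> \<le> W * C * (1 + x powr (p - 1))"
        proof (intro mult_mono W C)
          \<comment> \<open>The summand 1 covers nonnegative exponents, where
            \<open>y \<le> 1\<close> suffices; the other covers negative ones, where
            \<open>x \<le> y\<close> does.\<close>
          show "y powr (p - 1) \<le> 1 + x powr (p - 1)"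
          proof (cases "1 \<le> p")
            case True
            then have "y powr (p - 1) \<le> 1 powr (p - 1)" using y by (intro powr_mono2) auto
            then show ?thesis by (simp add: add_increasing2)
          next
            case False
            then have "y powr (p - 1) \<le> x powr (p - 1)" using y \<open>0 < n \<and> x \<in> {0<..1}\<close> by (intro powr_mono2') auto
            then show ?thesis by simp
          qed
        qed (use y W0 C0 in auto)
        finally show ?thesis using True by (simp add: f_eq j_def)
      next
        case False
        then have "f n x = 0" using f_0[of n x] by simp
        then show ?thesis using W0 C0 by (auto intro!: mult_nonneg_nonneg add_nonneg_nonneg)
      qed
    qed
    show "AE x in lborel. (\<lambda>n. f n x) \<longlonglongrightarrow> indicator {0<..1} x * (c * (w x * x powr (p - 1)))"
    proof (intro AE_I2)
      fix x :: real
      show "(\<lambda>n. f n x) \<longlonglongrightarrow> indicator {0<..1} x * (c * (w x * x powr (p - 1)))"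
      proof (cases "x \<in> {0<..1}")
        case True
        define j where "j n = nat \<lceil>real n * x\<rceil>" for n
        have lim_y: "(\<lambda>n. real (j n) / n) \<longlonglongrightarrow> x"
        proof (rule tendsto_sandwich)
          show "\<forall>\<^sub>F n in sequentially. x \<le> real (j n) / n"
            using eventually_gt_at_top[of 0] by eventually_elim (auto simp: j_def field_simps real_nat_ceiling_ge)
          show "\<forall>\<^sub>F n in sequentially. real (j n) / n \<le> x + 1 / n"
            using eventually_gt_at_top[of 0]
          proof eventually_elim
            case (elim n)
            have "real (j n) \<le> n * x + 1" using True by (simp add: j_def)
            then show ?case using elim by (simp add: field_simps)
          qed
          show "(\<lambda>n. x + 1 / real n) \<longlonglongrightarrow> x" using tendsto_add[OF tendsto_const lim_inverse_n'] by simp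
        qed simp
        have "filterlim (\<lambda>n. real n * x) at_top sequentially"
          using True by (intro filterlim_at_top_mult_tendsto_pos[OF tendsto_const] filterlim_real_sequentially) auto
        then have "filterlim (\<lambda>n. real (j n)) at_top sequentially"
          by (rule filterlim_at_top_mono) (auto simp: j_def real_nat_ceiling_ge intro!: always_eventually)
        then have j_lim: "filterlim j at_top sequentially"
          by (simp add: filterlim_sequentially_iff_filterlim_real)
        have j_range: "\<forall>\<^sub>F n in sequentially. real (j n) / n \<in> {0..1} \<and> 1 \<le> j n \<and> 0 < n"
          using eventually_gt_at_top[of 0]
        proof eventually_elim
          case (elim n)
          then have "1 \<le> j n" "j n \<le> n" using True idx[of n x] unfolding j_def by blast+
          then show ?case using elim by simp
        qed
        have "(\<lambda>n. w (real (j n) / n)) \<longlonglongrightarrow> w x"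
          using True j_range by (intro continuous_on_tendsto_compose[OF w lim_y]) (auto elim: eventually_mono)
        moreover have "(\<lambda>n. a (j n) / real (j n) powr (p - 1)) \<longlonglongrightarrow> c"
          by (rule filterlim_compose[OF a j_lim])
        moreover have "(\<lambda>n. (real (j n) / n) powr (p - 1)) \<longlonglongrightarrow> x powr (p - 1)"
          using True lim_y by (intro tendsto_powr tendsto_const) auto
        ultimately have "(\<lambda>n. w (real (j n) / n) * (a (j n) / real (j n) powr (p - 1)) * (real (j n) / n) powr (p - 1))
          \<longlonglongrightarrow> w x * c * x powr (p - 1)"
          by (intro tendsto_mult)
        moreover have "\<forall>\<^sub>F n in sequentially. w (real (j n) / n) * (a (j n) / real (j n) powr (p - 1)) * (real (j n) / n) powr (p - 1) = f n x"
          using j_range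
        proof eventually_elim
          case (elim n)
          then show ?case using True by (simp add: f_eq g_def j_def[symmetric] powr_divide)
        qed
        ultimately have "(\<lambda>n. f n x) \<longlonglongrightarrow> w x * c * x powr (p - 1)"
          using tendsto_cong by fast
        then show ?thesis using True by (simp add: ac_simps)
      next
        case False
        then have "f n x = 0" for n using f_0[of n x] by blast
        then show ?thesis using False by simp
      qed
    qed
  qed
  moreover have "\<forall>\<^sub>F n in sequentially. (\<integral>x. f n x \<partial>lborel) = (\<Sum>j=1..n. w (j / n) * a j) / real n powr p"
    using eventually_gt_at_top[of 0] by eventually_elim (rule f_int)
  ultimately show ?thesis using tendsto_cong by fast
qed

text \<open>The sum over \<open>k > j1 > ... > jr >= 1\<close> of
  \<open>sqrt ((k - j1) (j1 - j2) ... jr) / (j1 ... jr)\<close>, which the mean determinants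
  produce.\<close>

fun root_sum :: "nat \<Rightarrow> nat \<Rightarrow> real" where
  "root_sum 0 k = sqrt k"
| "root_sum (Suc r) k = (\<Sum>j=1..k-1. sqrt (k - j) * root_sum r j / j)"

text \<open>\<open>root_sum r\<close> grows like the power \<open>(r + 1) / 2\<close>; the extra
  quotient by \<open>k\<close> is the summand shape needed by \<open>riemann_sum_powr\<close> in the
  next round. There \<open>sqrt (k - j)\<close> contributes the weight \<open>sqrt (1 - x)\<close>,
  whence the second Beta argument \<open>3 / 2\<close>.\<close>

lemma root_sum_asymp:
  "(\<lambda>k. (root_sum r k / k) / real k powr ((r + 1) / 2 - 1)) \<longlonglongrightarrow> (\<Prod>m=1..r. Beta (real m / 2) (3 / 2))"
proof (induction r)
  case 0
  have "\<forall>\<^sub>F k in sequentially. (root_sum 0 k / k) / real k powr ((0 + 1) / 2 - 1) = 1"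
    using eventually_gt_at_top[of 0]
  proof eventually_elim
    case (elim k)
    have "real k powr (1 / 2 - 1) = real k powr (1 / 2) / real k powr 1" by (rule powr_diff)
    then have "real k powr ((0 + 1) / 2 - 1) = sqrt k / k"
      using elim by (simp add: powr_half_sqrt)
    then show ?case using elim by (simp only: root_sum.simps) simp
  qed
  then show ?case by (simp add: tendsto_eventually)
next
  case (Suc r)
  define p where "p = (real r + 1) / 2"
  have p: "0 < p" by (simp add: p_def)
  define c where "c = (\<Prod>m=1..r. Beta (real m / 2) (3 / 2))"
  have "(\<lambda>n. (\<Sum>j=1..n. sqrt (1 - j / n) * (root_sum r j / j)) / real n powr p)
      \<longlonglongrightarrow> (\<integral>x. indicator {0<..1} x * (c * (sqrt (1 - x) * x powr (p - 1))) \<partial>lborel)"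
    using Suc.IH by (intro riemann_sum_powr[OF p]) (auto simp: p_def c_def intro!: continuous_intros)
  also have "(\<integral>x. indicator {0<..1} x * (c * (sqrt (1 - x) * x powr (p - 1))) \<partial>lborel)
     = c * Beta p (3 / 2)"
  proof -
    have eq: "indicator {0<..1} x * (c * (sqrt (1 - x) * x powr (p - 1)))
       = c * (indicator {0<..1} x * (x powr (p - 1) * (1 - x) powr (3 / 2 - 1)))" for x :: real
      by (auto simp: indicator_def powr_half_sqrt)
    have "(\<integral>x. indicator {0<..1} x * (x powr (p - 1) * (1 - x) powr (3 / 2 - 1)) \<partial>lborel) = Beta p (3 / 2)"
      by (rule integral_Beta_lborel[OF p]) simp
    then show ?thesis by (simp only: eq integral_mult_right_zero)
  qed
  also have "c * Beta p (3 / 2) = (\<Prod>m=1..Suc r. Beta (real m / 2) (3 / 2))"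
    by (simp add: c_def p_def add.commute)
  finally have lim: "(\<lambda>n. (\<Sum>j=1..n. sqrt (1 - j / n) * (root_sum r j / j)) / real n powr p)
     \<longlonglongrightarrow> (\<Prod>m=1..Suc r. Beta (real m / 2) (3 / 2))" .
  have "\<forall>\<^sub>F n in sequentially. (\<Sum>j=1..n. sqrt (1 - j / n) * (root_sum r j / j)) / real n powr p
     = (root_sum (Suc r) n / n) / real n powr ((real (Suc r) + 1) / 2 - 1)"
    using eventually_gt_at_top[of 0]
  proof eventually_elim
    case (elim n)
    have "sqrt n * (\<Sum>j=1..n. sqrt (1 - j / n) * (root_sum r j / j)) = (\<Sum>j=1..n. sqrt (real n - j) * root_sum r j / j)"
      unfolding sum_distrib_left
    proof (intro sum.cong refl)
      fix j assume "j \<in> {1..n}"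
      have "sqrt n * sqrt (1 - j / n) = sqrt (n * (1 - j / n))" by (rule real_sqrt_mult[symmetric])
      also have "n * (1 - j / n) = real n - j" using elim by (simp add: field_simps)
      finally show "sqrt n * (sqrt (1 - j / n) * (root_sum r j / j)) = sqrt (real n - j) * root_sum r j / j"
        by (simp add: mult.assoc[symmetric])
    qed
    \<comment> \<open>The summand with \<open>j = n\<close> vanishes, so the sums agree although
      \<open>root_sum\<close> stops at \<open>n - 1\<close>.\<close>
    also have "\<dots> = root_sum (Suc r) n"
      using elim by (simp add: sum.atLeast_Suc_atMost_Suc_shift) (cases n; simp add: of_nat_diff)
    finally have "root_sum (Suc r) n = sqrt n * (\<Sum>j=1..n. sqrt (1 - j / n) * (root_sum r j / j))" ..
    moreover have "real n * real n powr ((real (Suc r) + 1) / 2 - 1) = sqrt n * real n powr p"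
    proof -
      have "real n * real n powr ((real (Suc r) + 1) / 2 - 1) = real n powr (1 + ((real (Suc r) + 1) / 2 - 1))"
        using elim by (simp add: powr_mult_base)
      also have "1 + ((real (Suc r) + 1) / 2 - 1) = 1 / 2 + p" by (simp add: p_def field_simps)
      also have "real n powr (1 / 2 + p) = sqrt n * real n powr p"
        using elim by (simp add: powr_add powr_half_sqrt)
      finally show ?thesis by simp
    qed
    ultimately show ?case using elim by (simp del: root_sum.simps add: divide_divide_eq_left)
  qed
  then show ?case using lim tendsto_cong by fast
qed

text \<open>The outermost sum carries \<open>sqrt j\<close> instead of \<open>sqrt (n - j)\<close>.
  Its weight is therefore constant, and \<open>1 / p\<close> with \<open>p = (d + 1) / 2\<close>
  takes the place of a Beta value.\<close>

lemma root_sum_limit: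
  assumes "0 < d"
  shows "(\<lambda>n. (\<Sum>j=1..n. sqrt j * root_sum (d - 1) j / j) / real n powr ((d + 1) / 2))
    \<longlonglongrightarrow> (\<Prod>m=1..d-1. Beta (real m / 2) (3 / 2)) * 2 / (d + 1)"
proof -
  define p where "p = (real d + 1) / 2"
  have p: "0 < p" by (simp add: p_def)
  define c where "c = (\<Prod>m=1..d-1. Beta (real m / 2) (3 / 2))"
  have "(\<lambda>j. (sqrt j * root_sum (d - 1) j / j) / real j powr (p - 1)) \<longlonglongrightarrow> c"
  proof -
    have "\<forall>\<^sub>F j in sequentially. (root_sum (d - 1) j / j) / real j powr ((real (d - 1) + 1) / 2 - 1)
       = (sqrt j * root_sum (d - 1) j / j) / real j powr (p - 1)"
      using eventually_gt_at_top[of 0]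
    proof eventually_elim
      case (elim j)
      have "p - 1 = 1 / 2 + ((real (d - 1) + 1) / 2 - 1)" using assms by (simp add: p_def of_nat_diff field_simps)
      then have "real j powr (p - 1) = sqrt j * real j powr ((real (d - 1) + 1) / 2 - 1)"
        using elim by (simp only: powr_add) (simp add: powr_half_sqrt)
      then show ?case using elim by simp
    qed
    then show ?thesis using root_sum_asymp[of "d - 1"] tendsto_cong unfolding c_def by fast
  qed
  from riemann_sum_powr[OF p continuous_on_const[of _ 1] this]
  have "(\<lambda>n. (\<Sum>j=1..n. sqrt j * root_sum (d - 1) j / j) / real n powr p)
      \<longlonglongrightarrow> (\<integral>x. indicator {0<..1} x * (c * (1 * x powr (p - 1))) \<partial>lborel)" by simp
  also have "(\<integral>x. indicator {0<..1} x * (c * (1 * x powr (p - 1))) \<partial>lborel) = c * (\<integral>x. indicator {0<..1} x * x powr (p - 1) \<partial>lborel)"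
    by (simp add: mult.left_commute)
  also have "(\<integral>x. indicator {0<..1} x * x powr (p - 1) \<partial>lborel) = 1 / p"
  proof -
    have "AE x in lborel. x \<noteq> (1::real)" by (rule AE_lborel_singleton)
    then have "(\<integral>x. indicator {0<..1} x * x powr (p - 1) \<partial>lborel)
        = (\<integral>x. indicator {0<..1} x * (x powr (p - 1) * (1 - x) powr (1 - 1)) \<partial>lborel)"
      by (intro integral_cong_AE) (auto elim!: eventually_mono)
    also have "\<dots> = Beta p 1" using p by (intro integral_Beta_lborel) auto
    also have "\<dots> = 1 / p"
    proof -
      have "p \<notin> \<int>\<^sub>\<le>\<^sub>0" using p nonpos_Ints_nonpos[of p] by fastforce
      then show ?thesis using Gamma_plus1[of p] Gamma_real_pos[OF p] by (simp add: Beta_def)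
    qed
    finally show ?thesis .
  qed
  finally show ?thesis by (simp add: c_def p_def)
qed

text \<open>\<open>Gamma (m / 2)\<close> cancels, and \<open>Gamma ((m + 3) / 2)\<close> reduces to
  \<open>Gamma ((m + 1) / 2)\<close> by the functional equation. The product over \<open>m\<close>
  then is a power divided by a factorial.\<close>

lemma chi_mean_Beta:
  assumes "0 < m" shows "chi_mean m * Beta (real m / 2) (3 / 2) = sqrt (2 * pi) / (real m + 1)"
proof -
  have np: "x \<notin> \<int>\<^sub>\<le>\<^sub>0" if "0 < x" for x :: real using that nonpos_Ints_nonpos[of x] by fastforce
  have g32: "Gamma (3 / 2 :: real) = sqrt pi / 2"
    using Gamma_plus1[OF np[of "1/2"]] Gamma_one_half_real by simp
  have "Gamma (real m / 2 + 3 / 2) = (real m + 1) / 2 * Gamma ((real m + 1) / 2)"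
    using Gamma_plus1[OF np[of "(real m + 1) / 2"]] by (simp add: field_simps)
  moreover have "Gamma (real m / 2) > 0" "Gamma ((real m + 1) / 2) > 0" using assms by (auto intro!: Gamma_real_pos)
  moreover have "sqrt 2 * G / H * (H * (sqrt pi / 2) / (M / 2 * G)) = sqrt 2 * sqrt pi / M"
    if "G > 0" "H > 0" for G H M :: real
    using that by (simp add: field_simps)
  ultimately show ?thesis
    by (simp only: chi_mean_def Beta_def g32 real_sqrt_mult)
qed

section \<open>Determinants of Gaussian increments\<close>

lemma zon_map_linear:
  assumes "linear f" shows "zon (map f ss) = f ` zon ss"
proof (induction ss)
  case Nil
  then show ?case using linear_0[OF assms] by simp
next
  case (Cons s ss)
  have "seg (f s) = f ` seg s"
    using closed_segment_linear_image[OF assms, of 0 s] linear_0[OF assms] by simp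
  then show ?case using Cons
    by (auto simp: set_plus_image image_iff linear_add[OF assms] intro!: bexI)
qed

lemma zon_axes:
  assumes "distinct is"
  shows "zon (map (\<lambda>i. axis i (1::real)) is) = {x :: real^'n::finite. \<forall>i. if i \<in> set is then 0 \<le> x $ i \<and> x $ i \<le> 1 else x $ i = 0}"
  using assms
proof (induction "is")
  case Nil
  then show ?case by (auto simp: vec_eq_iff)
next
  case (Cons j js)
  show ?case
  proof (intro set_eqI iffI)
    fix x assume "x \<in> zon (map (\<lambda>i. axis i (1::real)) (j # js))"
    then obtain u y where u: "0 \<le> u" "u \<le> 1" "x = u *\<^sub>R axis j 1 + y" and y: "y \<in> zon (map (\<lambda>i. axis i (1::real)) js)"
      by (auto simp: mem_seg elim!: set_plus_elim)
    from y Cons have "\<forall>i. if i \<in> set js then 0 \<le> y $ i \<and> y $ i \<le> 1 else y $ i = 0" by auto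
    then show "x \<in> {x. \<forall>i. if i \<in> set (j # js) then 0 \<le> x $ i \<and> x $ i \<le> 1 else x $ i = 0}"
      using u Cons.prems by (auto simp: axis_def split: if_splits)
  next
    fix x :: "real^'n" assume x: "x \<in> {x. \<forall>i. if i \<in> set (j # js) then 0 \<le> x $ i \<and> x $ i \<le> 1 else x $ i = 0}"
    define y where "y = x - x $ j *\<^sub>R axis j 1"
    have "y \<in> zon (map (\<lambda>i. axis i (1::real)) js)"
      using x Cons by (auto simp: y_def axis_def split: if_splits)
    moreover have "x $ j *\<^sub>R axis j 1 \<in> seg (axis j 1 :: real^'n)"
      using x by (auto simp: mem_seg split: if_splits)
    ultimately have "x $ j *\<^sub>R axis j 1 + y \<in> seg (axis j 1) + zon (map (\<lambda>i. axis i (1::real)) js)"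
      by (intro set_plus_intro)
    then show "x \<in> zon (map (\<lambda>i. axis i (1::real)) (j # js))" by (simp add: y_def)
  qed
qed

text \<open>The zonotope is the image of the unit cube under the map sending axis \<open>l\<close>
  to \<open>s (e l)\<close>. The enumeration \<open>e\<close> mediates between numbered vectors and
  rows indexed by the type.\<close>

lemma vol_zon_det:
  fixes s :: "nat \<Rightarrow> real^'n::finite"
  assumes e: "bij_betw e (UNIV :: 'n set) {..<CARD('n)}"
  shows "vol (zon (map s [0..<CARD('n)])) = \<bar>det (\<chi> i. s (e i))\<bar>"
proof -
  define i where "i = inv_into UNIV e"
  have ei: "e (i j) = j" if "j < CARD('n)" for j
    using that e by (auto simp: i_def bij_betw_def intro: f_inv_into_f)
  have ie: "i (e l) = l" for l using e by (simp add: i_def bij_betw_def)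
  define T where "T x = (\<Sum>l\<in>UNIV. x $ l *\<^sub>R s (e l))" for x :: "real^'n"
  have lin: "linear T"
    by (rule linearI) (simp_all add: T_def scaleR_left_distrib sum.distrib scaleR_sum_right)
  have T_axis: "T (axis l 1) = s (e l)" for l
  proof -
    have "T (axis l 1) = (\<Sum>k\<in>UNIV. if k = l then s (e k) else 0)"
      unfolding T_def by (intro sum.cong) (auto simp: axis_def)
    then show ?thesis by simp
  qed
  let ?is = "map i [0..<CARD('n)]"
  have dist: "distinct ?is"
    using ei by (auto simp: distinct_map inj_on_def) metis
  have set: "set ?is = UNIV"
  proof -
    have "l \<in> set ?is" for l
      using bij_betwE[OF e] ie[of l] by (auto simp: image_iff intro!: bexI[of _ "e l"])
    then show ?thesis by blast
  qed
  have "map s [0..<CARD('n)] = map T (map (\<lambda>i. axis i 1) ?is)"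
    using ei by (simp add: T_axis)
  then have "vol (zon (map s [0..<CARD('n)])) = vol (T ` zon (map (\<lambda>i. axis i 1) ?is))"
    by (simp only: zon_map_linear[OF lin])
  also have "zon (map (\<lambda>i. axis i 1) ?is) = cbox (0::real^'n) 1"
    unfolding zon_axes[OF dist] set by (auto simp: mem_box_cart)
  also have "vol (T ` cbox 0 1) = \<bar>det (matrix T)\<bar> * vol (cbox 0 (1::real^'n))"
    using measure_linear_image_cart[OF lin lmeasurable_cbox] by blast
  also have "vol (cbox 0 (1::real^'n)) = 1"
    by (simp add: content_cbox_cart interval_ne_empty_cart)
  also have "matrix T = transpose (\<chi> i. s (e i))"
    by (simp add: matrix_def T_axis transpose_def vec_eq_iff)
  finally show ?thesis by simp
qed

text \<open>An empty product is a one-point space. The case arises for \<open>d = 1\<close>, where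
  the process has no coordinates.\<close>

lemma measure_eqI_PiM_empty:
  assumes "prob_space P" "prob_space Q" "sets P = sets (\<Pi>\<^sub>M i\<in>{}. N i)" "sets Q = sets (\<Pi>\<^sub>M i\<in>{}. N i)"
  shows "P = Q"
proof (rule measure_eqI)
  interpret P: prob_space P by fact
  interpret Q: prob_space Q by fact
  have spP: "space P = {\<lambda>_. undefined}"
    using sets_eq_imp_space_eq[OF assms(3)] by (simp only: space_PiM_empty)
  have spQ: "space Q = {\<lambda>_. undefined}"
    using sets_eq_imp_space_eq[OF assms(4)] by (simp only: space_PiM_empty)
  fix A assume "A \<in> sets P"
  then have "A \<subseteq> {\<lambda>_. undefined}" using sets.sets_into_space spP by blast
  then consider "A = {}" | "A = space P" "A = space Q"
    unfolding spP spQ by blast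
  then show "emeasure P A = emeasure Q A"
    using P.emeasure_space_1 Q.emeasure_space_1 by cases (simp, metis)
qed (simp only: assms)

lemma (in prob_space) indep_vars_distr_PiM:
  assumes "indep_vars N X I" "finite I"
  shows "distr M (\<Pi>\<^sub>M i\<in>I. N i) (\<lambda>x. \<lambda>i\<in>I. X i x) = (\<Pi>\<^sub>M i\<in>I. distr M (N i) (X i))"
proof (cases "I = {}")
  case True
  have "(\<lambda>x. \<lambda>i\<in>I. X i x) \<in> measurable M (\<Pi>\<^sub>M i\<in>I. N i)"
    using True by (intro measurable_restrict) auto
  then show ?thesis
    using True by (intro measure_eqI_PiM_empty[where N=N] prob_space_distr prob_space_PiM) (auto simp: PiM_empty)
next
  case False
  have "random_variable (N i) (X i)" if "i \<in> I" for i
    using assms(1) that by (simp add: indep_vars_def)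
  then show ?thesis using indep_vars_iff_distr_eq_PiM'[OF False] assms(1) by blast
qed

lemma normal_scale:
  assumes "0 < \<sigma>"
  shows "distr (density lborel (normal_density 0 \<sigma>)) borel (\<lambda>x. x / \<sigma>) = std_normal"
proof -
  interpret N: prob_space "density lborel (normal_density 0 \<sigma>)"
    using assms by (rule prob_space_normal_density)
  have "distributed (density lborel (normal_density 0 \<sigma>)) lborel (\<lambda>x. x) (normal_density 0 \<sigma>)"
    unfolding distributed_def by (intro conjI distr_id2) auto
  from N.normal_density_affine[OF this assms, of "1 / \<sigma>" 0]
  have "distributed (density lborel (normal_density 0 \<sigma>)) lborel (\<lambda>x. x / \<sigma>) (normal_density 0 1)"
    using assms by simp
  then have "distr (density lborel (normal_density 0 \<sigma>)) lborel (\<lambda>x. x / \<sigma>) = std_normal"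
    by (simp add: distributed_def)
  moreover have "distr (density lborel (normal_density 0 \<sigma>)) lborel (\<lambda>x. x / \<sigma>) = distr (density lborel (normal_density 0 \<sigma>)) borel (\<lambda>x. x / \<sigma>)"
    by (rule distr_cong) auto
  ultimately show ?thesis by simp
qed

lemma emeasure_PiM_prob_space:
  assumes "\<And>i. prob_space (N i)" "finite I" "\<And>i. i \<in> I \<Longrightarrow> A i \<in> sets (N i)"
  shows "emeasure (Pi\<^sub>M I N) (Pi\<^sub>E I A) = (\<Prod>i\<in>I. emeasure (N i) (A i))"
proof -
  interpret prob_space "N i" for i by fact
  interpret product_prob_space N by standard
  show ?thesis using assms(2,3) by (rule emeasure_PiM)
qed

context prob_space
begin

text \<open>Increments are independent as rows, while the determinant formula needs independent
  columns. All entries are shown to form one independent standard normal family, which is then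
  grouped the other way.\<close>

lemma gauss_columns:
  fixes D :: "nat \<Rightarrow> 'a \<Rightarrow> 'n::finite \<Rightarrow> real" and \<sigma> :: "nat \<Rightarrow> real"
  assumes indep: "indep_vars (\<lambda>_. \<Pi>\<^sub>M i\<in>L. borel) (\<lambda>j \<omega>. \<lambda>i\<in>L. D j \<omega> i) {..<CARD('n)}"
    and distr: "\<And>j. j < CARD('n) \<Longrightarrow> distr M (\<Pi>\<^sub>M i\<in>L. borel) (\<lambda>\<omega>. \<lambda>i\<in>L. D j \<omega> i)
      = (\<Pi>\<^sub>M i\<in>L. density lborel (normal_density 0 (\<sigma> j)))"
    and \<sigma>: "\<And>j. j < CARD('n) \<Longrightarrow> 0 < \<sigma> j"
    and e: "bij_betw e (UNIV :: 'n set) {..<CARD('n)}"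
  shows "distr M (gausses L) (\<lambda>\<omega>. \<lambda>c\<in>L. (\<chi> i. D (e i) \<omega> c / \<sigma> (e i)) :: real^'n) = (gausses L)"
proof -
  define Y where "Y p \<omega> = D (e (fst p)) \<omega> (snd p) / \<sigma> (e (fst p))" for p :: "'n \<times> 'n" and \<omega>
  let ?K = "(UNIV :: 'n set) \<times> L"
  let ?Y = "\<lambda>\<omega>. \<lambda>p\<in>?K. Y p \<omega>"
  let ?D = "\<lambda>j \<omega>. \<lambda>i\<in>L. D j \<omega> i"
  have e_less: "e i < CARD('n)" for i using bij_betwE[OF e] by auto
  have D_meas: "?D j \<in> measurable M (\<Pi>\<^sub>M i\<in>L. borel)" if "j < CARD('n)" for j
    using indep that by (auto simp: indep_vars_def)
  have D_meas1 [measurable]: "(\<lambda>\<omega>. D j \<omega> c) \<in> borel_measurable M" if "j < CARD('n)" "c \<in> L" for j c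
    using measurable_compose[OF D_meas[OF that(1)] measurable_component_singleton[OF that(2)]] that(2) by simp
  have Y_meas: "Y p \<in> borel_measurable M" if "p \<in> ?K" for p
    unfolding Y_def using that e_less by (intro borel_measurable_divide D_meas1) auto
  interpret S: prob_space std_normal by (rule prob_space_std_normal)
  interpret S: product_prob_space "\<lambda>_::'n \<times> 'n. std_normal" by standard
  have flat: "distr M (\<Pi>\<^sub>M p\<in>?K. borel) ?Y = (\<Pi>\<^sub>M p\<in>?K. std_normal)"
  proof (rule S.PiM_eqI)
    fix A :: "'n \<times> 'n \<Rightarrow> real set" assume "\<And>p. p \<in> ?K \<Longrightarrow> A p \<in> sets std_normal"
    then have A: "A p \<in> sets borel" if "p \<in> ?K" for p using that by simp
    define i where "i = inv_into UNIV e"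
    have ie: "i (e l) = l" for l using e by (simp add: i_def bij_betw_def)
    \<comment> \<open>Undoes the scaling, so that events for normalised entries become events for
      the increments themselves.\<close>
    define E where "E j c = (\<lambda>t. t / \<sigma> j) -` A (i j, c)" for j c
    have E: "E j c \<in> sets borel" if "c \<in> L" for j c
      using measurable_sets[of "\<lambda>t. t / \<sigma> j" borel borel "A (i j, c)"] A that by (simp add: E_def)
    have std: "emeasure (density lborel (normal_density 0 (\<sigma> j))) (E j c) = emeasure std_normal (A (i j, c))"
      if "j < CARD('n)" "c \<in> L" for j c
      unfolding normal_scale[OF \<sigma>[OF that(1)], symmetric] using A that by (subst emeasure_distr) (auto simp: E_def)
    have box: "Pi\<^sub>E L (E j) \<in> sets (\<Pi>\<^sub>M i\<in>L. borel)" for j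
      using E by (intro sets_PiM_I_finite) auto
    have prob_row: "emeasure M (?D j -` Pi\<^sub>E L (E j) \<inter> space M) = (\<Prod>c\<in>L. emeasure std_normal (A (i j, c)))"
      if j: "j < CARD('n)" for j
    proof -
      have "emeasure M (?D j -` Pi\<^sub>E L (E j) \<inter> space M)
        = emeasure (\<Pi>\<^sub>M i\<in>L. density lborel (normal_density 0 (\<sigma> j))) (Pi\<^sub>E L (E j))"
        unfolding distr[OF j, symmetric] using D_meas[OF j] box by (subst emeasure_distr) auto
      also have "\<dots> = (\<Prod>c\<in>L. emeasure (density lborel (normal_density 0 (\<sigma> j))) (E j c))"
        using E by (intro emeasure_PiM_prob_space prob_space_normal_density \<sigma> j) auto
      finally show ?thesis using std[OF j] by simp
    qed
    have "emeasure (distr M (\<Pi>\<^sub>M p\<in>?K. borel) ?Y) (Pi\<^sub>E ?K A)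
        = emeasure M (?Y -` Pi\<^sub>E ?K A \<inter> space M)"
      using Y_meas A by (intro emeasure_distr measurable_restrict sets_PiM_I_finite) auto
    also have "?Y -` Pi\<^sub>E ?K A \<inter> space M
        = (\<Inter>j\<in>{..<CARD('n)}. ?D j -` Pi\<^sub>E L (E j) \<inter> space M)"
    proof -
      have "(\<forall>j<CARD('n). \<forall>c\<in>L. D j \<omega> c / \<sigma> j \<in> A (i j, c)) \<longleftrightarrow> (\<forall>l. \<forall>c\<in>L. D (e l) \<omega> c / \<sigma> (e l) \<in> A (l, c))" for \<omega>
        using e ie by (metis bij_betw_def imageE lessThan_iff e_less)
      then have eq: "(\<forall>j\<in>{..<CARD('n)}. \<forall>c\<in>L. D j \<omega> c / \<sigma> j \<in> A (i j, c)) \<longleftrightarrow> (\<forall>l. \<forall>c\<in>L. D (e l) \<omega> c / \<sigma> (e l) \<in> A (l, c))" for \<omega>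
        by (simp only: Ball_def lessThan_iff)
      show ?thesis
      proof (intro set_eqI iffI)
        fix \<omega> assume "\<omega> \<in> ?Y -` Pi\<^sub>E ?K A \<inter> space M"
        then have "\<omega> \<in> space M" "\<forall>l. \<forall>c\<in>L. D (e l) \<omega> c / \<sigma> (e l) \<in> A (l, c)"
          by (auto simp: Y_def PiE_iff)
        then show "\<omega> \<in> (\<Inter>j\<in>{..<CARD('n)}. ?D j -` Pi\<^sub>E L (E j) \<inter> space M)"
          unfolding eq[symmetric] by (auto simp: E_def PiE_iff)
      next
        fix \<omega> assume *: "\<omega> \<in> (\<Inter>j\<in>{..<CARD('n)}. ?D j -` Pi\<^sub>E L (E j) \<inter> space M)"
        have "0 \<in> {..<CARD('n)}" by simp
        with * have sp: "\<omega> \<in> space M" by blast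
        have "(\<lambda>i\<in>L. D j \<omega> i) \<in> Pi\<^sub>E L (E j)" if "j \<in> {..<CARD('n)}" for j
          using * that by blast
        then have "\<forall>j\<in>{..<CARD('n)}. \<forall>c\<in>L. D j \<omega> c / \<sigma> j \<in> A (i j, c)"
          by (auto simp: E_def PiE_iff)
        then show "\<omega> \<in> ?Y -` Pi\<^sub>E ?K A \<inter> space M"
          using sp unfolding eq by (auto simp: Y_def PiE_iff)
      qed
    qed
    also have "emeasure M \<dots> = (\<Prod>j<CARD('n). emeasure M (?D j -` Pi\<^sub>E L (E j) \<inter> space M))"
    proof -
      have "{..<CARD('n)} \<noteq> {}" using zero_less_card_finite[where 'a='n] by (metis lessThan_iff empty_iff)
      from indep_varsD_finite[OF indep this finite_lessThan, of "\<lambda>j. Pi\<^sub>E L (E j)"] box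
      show ?thesis by (simp only: emeasure_eq_measure prod_ennreal measure_nonneg)
    qed
    also have "\<dots> = (\<Prod>j<CARD('n). \<Prod>c\<in>L. emeasure std_normal (A (i j, c)))"
      by (intro prod.cong refl prob_row) simp
    also have "\<dots> = (\<Prod>l\<in>UNIV. \<Prod>c\<in>L. emeasure std_normal (A (l, c)))"
      using prod.reindex_bij_betw[OF e, of "\<lambda>j. \<Prod>c\<in>L. emeasure std_normal (A (i j, c))"] by (simp add: ie)
    also have "\<dots> = (\<Prod>p\<in>?K. emeasure std_normal (A p))"
      by (simp add: prod.cartesian_product)
    finally show "emeasure (distr M (\<Pi>\<^sub>M p\<in>?K. borel) ?Y) (Pi\<^sub>E ?K A) = (\<Prod>p\<in>?K. emeasure std_normal (A p))" .
  qed (simp_all cong: sets_PiM_cong)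
  show ?thesis
  proof (cases "L = {}")
    case True
    have "(\<lambda>\<omega>. \<lambda>c\<in>L. (\<chi> i. D (e i) \<omega> c / \<sigma> (e i)) :: real^'n) \<in> measurable M (gausses L)"
      using True by (intro measurable_restrict) auto
    then show ?thesis
      using True by (intro measure_eqI_PiM_empty[where N="\<lambda>_. gauss"] prob_space_distr prob_space_PiM) (auto simp: PiM_empty)
  next
    case False
    have Y_distr: "distr M borel (Y p) = std_normal" if p: "p \<in> ?K" for p
    proof -
      have "distr M borel (Y p) = distr (distr M (\<Pi>\<^sub>M p\<in>?K. borel) ?Y) borel (\<lambda>f. f p)"
        using p Y_meas by (subst distr_distr) (auto intro!: distr_cong measurable_restrict simp: comp_def)
      also have "\<dots> = distr (\<Pi>\<^sub>M p\<in>?K. std_normal) std_normal (\<lambda>f. f p)"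
        unfolding flat by (rule distr_cong) auto
      also have "\<dots> = std_normal" using p by (intro distr_PiM_component prob_space_std_normal) auto
      finally show ?thesis .
    qed
    have Y_indep: "indep_vars (\<lambda>_. borel) Y ?K"
    proof (subst indep_vars_iff_distr_eq_PiM')
      have "(\<Pi>\<^sub>M p\<in>?K. distr M borel (Y p)) = (\<Pi>\<^sub>M p\<in>?K. std_normal)"
        by (intro PiM_cong refl Y_distr)
      then show "distr M (\<Pi>\<^sub>M p\<in>?K. borel) ?Y = (\<Pi>\<^sub>M p\<in>?K. distr M borel (Y p))"
        by (simp only: flat)
    qed (use False Y_meas in auto)
    let ?C = "\<lambda>c. UNIV \<times> {c} :: ('n \<times> 'n) set"
    let ?g = "\<lambda>c \<omega>. (\<chi> i. D (e i) \<omega> c / \<sigma> (e i)) :: real^'n"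
    have "indep_vars (\<lambda>c. \<Pi>\<^sub>M p\<in>?C c. borel) (\<lambda>c \<omega>. restrict (\<lambda>p. Y p \<omega>) (?C c)) L"
      by (rule indep_vars_restrict[OF Y_indep]) (auto simp: disjoint_family_on_def)
    then have "indep_vars (\<lambda>_. borel) (\<lambda>c \<omega>. (\<chi> i. restrict (\<lambda>p. Y p \<omega>) (?C c) (i, c)) :: real^'n) L"
      by (rule indep_vars_compose2) (intro vec_lambda_measurable measurable_component_singleton, simp)
    then have g_indep: "indep_vars (\<lambda>_. borel) ?g L"
      by (simp add: Y_def cong: indep_vars_cong)
    have g_distr: "distr M borel (?g c) = gauss" if c: "c \<in> L" for c
    proof -
      have m: "(\<lambda>f. \<chi> i. f (i, c)) \<in> measurable (\<Pi>\<^sub>M p\<in>?K. borel) (borel :: (real^'n) measure)"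
        using c by (intro vec_lambda_measurable measurable_component_singleton) auto
      have "distr M borel (?g c) = distr (distr M (\<Pi>\<^sub>M p\<in>?K. borel) ?Y) borel (\<lambda>f. \<chi> i. f (i, c))"
      proof -
        have "?Y \<in> measurable M (\<Pi>\<^sub>M p\<in>?K. borel)"
          by (intro measurable_restrict Y_meas)
        from distr_distr[OF m this]
        have "distr (distr M (\<Pi>\<^sub>M p\<in>?K. borel) ?Y) borel (\<lambda>f. \<chi> i. f (i, c))
          = distr M borel ((\<lambda>f. \<chi> i. f (i, c)) \<circ> ?Y)" .
        also have "(\<lambda>f. \<chi> i. f (i, c)) \<circ> ?Y = ?g c"
          using c by (simp add: comp_def Y_def fun_eq_iff)
        finally show ?thesis ..
      qed
      also have "\<dots> = distr (\<Pi>\<^sub>M p\<in>?K. std_normal) borel (\<lambda>f. \<chi> i. f (i, c))" unfolding flat ..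
      also have "\<dots> = distr (distr (\<Pi>\<^sub>M p\<in>?K. std_normal) (\<Pi>\<^sub>M i\<in>UNIV. std_normal) (\<lambda>f. \<lambda>i\<in>UNIV. f (i, c))) borel (\<lambda>f. \<chi> i. f i)"
      proof (subst distr_distr)
        show "(\<lambda>f. \<chi> i. f i) \<in> measurable (\<Pi>\<^sub>M i\<in>(UNIV::'n set). std_normal) (borel :: (real^'n) measure)"
          by (intro vec_lambda_measurable) (simp add: measurable_component_singleton[of _ UNIV "\<lambda>_. std_normal", simplified] cong: measurable_cong_sets)
        show "(\<lambda>f. \<lambda>i\<in>UNIV. f (i, c)) \<in> measurable (\<Pi>\<^sub>M p\<in>?K. std_normal) (\<Pi>\<^sub>M i\<in>(UNIV::'n set). std_normal)"
          using c by (intro measurable_restrict measurable_component_singleton) auto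
      qed (simp add: comp_def restrict_def)
      also have "distr (\<Pi>\<^sub>M p\<in>?K. std_normal) (\<Pi>\<^sub>M i\<in>UNIV. std_normal) (\<lambda>f. \<lambda>i\<in>UNIV. f (i, c)) = (\<Pi>\<^sub>M i\<in>(UNIV::'n set). std_normal)"
        using c by (intro distr_PiM_reindex prob_space_std_normal) (auto simp: inj_on_def)
      also have "distr \<dots> borel (\<lambda>f. \<chi> i. f i) = gauss" by (rule gauss_eq_distr[symmetric])
      finally show ?thesis .
    qed
    have "distr M (gausses L) (\<lambda>\<omega>. \<lambda>c\<in>L. ?g c \<omega>) = distr M (\<Pi>\<^sub>M c\<in>L. borel) (\<lambda>\<omega>. \<lambda>c\<in>L. ?g c \<omega>)"
      by (rule distr_cong) (auto cong: sets_PiM_cong)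
    also have "\<dots> = (\<Pi>\<^sub>M c\<in>L. distr M borel (?g c))"
      by (rule indep_vars_distr_PiM[OF g_indep]) simp
    also have "\<dots> = (gausses L)" by (intro PiM_cong refl g_distr)
    finally show ?thesis .
  qed
qed

end

section \<open>Grid approximations of the hull\<close>

text \<open>The last entry contributes the norm of the time column, the root of the largest time.
  The gap in front of the first entry is left out, so that prepending an index multiplies by a
  single factor.\<close>

fun gaps :: "nat list \<Rightarrow> real" where
  "gaps [] = 1"
| "gaps [k] = sqrt k"
| "gaps (j # k # ks) = sqrt (real k - real j) * gaps (k # ks)"

lemma gaps_prod:
  assumes "ks \<noteq> []"
  shows "(\<Prod>j<length ks. sqrt (real ((a # ks) ! Suc j) - real ((a # ks) ! j))) * sqrt (real (last ks))
    = sqrt (real (hd ks) - real a) * gaps ks"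
  using assms
proof (induction ks arbitrary: a)
  case (Cons k ks)
  show ?case
  proof (cases ks)
    case (Cons l ls)
    have "(\<Prod>j<length (k # ks). sqrt (real ((a # k # ks) ! Suc j) - real ((a # k # ks) ! j)))
      = sqrt (real k - real a) * (\<Prod>j<length ks. sqrt (real ((k # ks) ! Suc j) - real ((k # ks) ! j)))"
      by (simp add: prod.lessThan_Suc_shift del: prod.lessThan_Suc)
    moreover have "(\<Prod>j<length ks. sqrt (real ((k # ks) ! Suc j) - real ((k # ks) ! j))) * sqrt (real (last ks))
        = sqrt (real (hd ks) - real k) * gaps ks"
      by (rule Cons.IH) (simp add: Cons)
    moreover have "sqrt (real (hd ks) - real k) * gaps ks = gaps (k # ks)" "last (k # ks) = last ks"
      by (simp_all add: Cons)
    ultimately show ?thesis by (simp only: mult.assoc list.sel)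
  qed simp
qed simp

lemma psums_differences:
  fixes q :: "nat \<Rightarrow> 'a::ab_group_add"
  shows "psums (q a - c) (map (\<lambda>j. q ((a # ks) ! Suc j) - q ((a # ks) ! j)) [0..<length ks]) = map (\<lambda>i. q i - c) ks"
proof (induction ks arbitrary: a)
  case (Cons k ks)
  have "map (\<lambda>j. q ((a # k # ks) ! Suc j) - q ((a # k # ks) ! j)) [0..<length (k # ks)]
    = (q k - q a) # map (\<lambda>j. q ((k # ks) ! Suc j) - q ((k # ks) ! j)) [0..<length ks]"
    by (simp only: length_Cons map_upt_Suc nth_Cons_0 nth_Cons_Suc)
  then show ?case using Cons.IH[of k] by (simp only: psums.simps list.map) (simp add: algebra_simps)
qed simp

text \<open>Prepending \<open>j\<close> to \<open>k # ks\<close> multiplies \<open>gaps\<close> by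
  \<open>sqrt (k - j)\<close>, the weight in the recursion of \<open>root_sum\<close>; at the
  innermost level the factor \<open>sqrt (hd ks)\<close> of \<open>g\<close> supplies
  \<open>root_sum 0\<close>.\<close>

lemma nsum_root_sum:
  assumes g: "\<And>ks. length ks = d \<Longrightarrow> sorted_wrt (<) ks \<Longrightarrow> set ks \<subseteq> {1..n} \<Longrightarrow> g ks = C * sqrt (real (hd ks)) * gaps ks"
    and "length (k # ks) + r = d" "sorted_wrt (<) (k # ks)" "set (k # ks) \<subseteq> {1..n}"
  shows "nsum g r (k # ks) (k - 1) = C * gaps (k # ks) * root_sum r k"
  using assms(2-)
proof (induction r arbitrary: k ks)
  case 0
  then show ?case using g[of "k # ks"] by simp
next
  case (Suc r)
  have "nsum g (Suc r) (k # ks) (k - 1) = (\<Sum>j=1..k-1. nsum g r (j # k # ks) (j - 1) / real j)" by simp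
  also have "\<dots> = (\<Sum>j=1..k-1. C * gaps (k # ks) * (sqrt (real k - real j) * root_sum r j / j))"
  proof (rule sum.cong)
    fix j assume j: "j \<in> {1..k-1}"
    have "nsum g r (j # k # ks) (j - 1) = C * gaps (j # k # ks) * root_sum r j"
      using Suc.prems j by (intro Suc.IH) auto
    then show "nsum g r (j # k # ks) (j - 1) / real j = C * gaps (k # ks) * (sqrt (real k - real j) * root_sum r j / j)"
      by simp
  qed simp
  also have "\<dots> = C * gaps (k # ks) * (\<Sum>j=1..k-1. sqrt (real k - real j) * root_sum r j / j)"
    by (simp only: sum_distrib_left)
  also have "(\<Sum>j=1..k-1. sqrt (real k - real j) * root_sum r j / j) = root_sum (Suc r) k"
    by (auto intro!: sum.cong simp: of_nat_diff)
  finally show ?case .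
qed

lemma nsum_root_sum_Nil:
  assumes g: "\<And>ks. length ks = d \<Longrightarrow> sorted_wrt (<) ks \<Longrightarrow> set ks \<subseteq> {1..n} \<Longrightarrow> g ks = C * sqrt (real (hd ks)) * gaps ks"
    and "0 < d"
  shows "nsum g d [] n = C * (\<Sum>j=1..n. sqrt j * root_sum (d - 1) j / j)"
proof -
  obtain r where d: "d = Suc r" using assms(2) by (cases d) auto
  have "nsum g d [] n = (\<Sum>j=1..n. nsum g r [j] (j - 1) / j)" by (simp add: d)
  also have "\<dots> = (\<Sum>j=1..n. C * (sqrt j * root_sum (d - 1) j / j))"
  proof (rule sum.cong)
    fix j assume "j \<in> {1..n}"
    then have "nsum g r [j] (j - 1) = C * gaps [j] * root_sum r j"
      by (intro nsum_root_sum[OF g]) (auto simp: d)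
    then show "nsum g r [j] (j - 1) / j = C * (sqrt j * root_sum (d - 1) j / j)" by (simp add: d)
  qed simp
  finally show ?thesis by (simp only: sum_distrib_left)
qed

section \<open>Space-time Brownian motion at finitely many times\<close>

locale space_time_brownian = standard_brownian_motion M "- {k}" B
  for M :: "'w measure" and k :: "'d::finite" and B :: "real \<Rightarrow> 'w \<Rightarrow> 'd \<Rightarrow> real"
begin

abbreviation curve :: "'w \<Rightarrow> real \<Rightarrow> real ^ 'd" where
  "curve \<equiv> space_time_path k B"

lemma B_measurable:
  assumes "0 \<le> t" "i \<noteq> k" shows "(\<lambda>\<omega>. B t \<omega> i) \<in> borel_measurable M"
  using measurable_compose[OF random_variable_B[OF assms(1)] measurable_component_singleton[of i]] assms(2) by simp

lemma path_measurable:
  assumes "0 \<le> t" shows "(\<lambda>\<omega>. curve \<omega> t) \<in> borel_measurable M"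
  unfolding space_time_path_def
proof (rule vec_lambda_measurable)
  fix i show "(\<lambda>\<omega>. if i = k then t else B t \<omega> i) \<in> borel_measurable M"
    using B_measurable[OF assms, of i] by (cases "i = k") simp_all
qed

text \<open>Dividing row \<open>j\<close> by the standard deviation \<open>\<sigma> j\<close> leaves
  standard Gaussian columns and one time column. A time increment equals
  \<open>\<sigma> j * \<sigma> j\<close>, so that column, \<open>u\<close>, has entries
  \<open>\<sigma> j\<close>, and its squared norm telescopes.\<close>

lemma integral_vol_zon:
  fixes \<tau> :: "nat \<Rightarrow> real"
  assumes \<tau>0: "0 \<le> \<tau> 0" and \<tau>: "\<And>j. j < CARD('d) \<Longrightarrow> \<tau> j < \<tau> (Suc j)"
  shows "(\<integral>\<omega>. vol (zon (map (\<lambda>j. curve \<omega> (\<tau> (Suc j)) - curve \<omega> (\<tau> j)) [0..<CARD('d)])) \<partial>M)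
    = (\<Prod>j<CARD('d). sqrt (\<tau> (Suc j) - \<tau> j)) * sqrt (\<tau> (CARD('d)) - \<tau> 0) * (\<Prod>m=1..CARD('d) - 1. chi_mean m)"
proof -
  obtain e :: "'d \<Rightarrow> nat" where e: "bij_betw e UNIV {..<CARD('d)}"
    using ex_bij_betw_finite_nat[of "UNIV :: 'd set"] by (auto simp: atLeast0LessThan)
  have e_less: "e i < CARD('d)" for i using bij_betwE[OF e] by auto
  have \<tau>_nonneg: "0 \<le> \<tau> j" if "j \<le> CARD('d)" for j
    using that
  proof (induction j)
    case (Suc j)
    then show ?case using \<tau>[of j] by simp
  qed (use \<tau>0 in simp)
  define \<sigma> where "\<sigma> j = sqrt (\<tau> (Suc j) - \<tau> j)" for j
  have \<sigma>: "0 < \<sigma> j" "\<sigma> j * \<sigma> j = \<tau> (Suc j) - \<tau> j" if "j < CARD('d)" for j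
    using \<tau>[OF that] by (simp_all add: \<sigma>_def)
  define D where "D j \<omega> i = B (\<tau> (Suc j)) \<omega> i - B (\<tau> j) \<omega> i" for j \<omega> i
  define g where "g \<omega> = (\<lambda>c\<in>- {k}. (\<chi> i. D (e i) \<omega> c / \<sigma> (e i)) :: real^'d)" for \<omega>
  define u where "u = ((\<chi> i. \<sigma> (e i)) :: real^'d)"
  let ?det = "\<lambda>\<omega>. det (colmat (- {k}) k u (g \<omega>))"
  have g_meas: "g \<in> measurable M (gausses (- {k}))"
  proof -
    have "(\<lambda>\<omega>. \<chi> i. D (e i) \<omega> c / \<sigma> (e i)) \<in> borel_measurable M" if "c \<in> - {k}" for c
      using that e_less \<tau>_nonneg unfolding D_def
      by (intro vec_lambda_measurable borel_measurable_divide borel_measurable_diff B_measurable) (auto simp: Suc_leI less_imp_le)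
    then show ?thesis unfolding g_def[abs_def] by (intro measurable_restrict) (simp cong: measurable_cong_sets)
  qed
  have g_distr: "distr M (gausses (- {k})) g = (gausses (- {k}))"
    unfolding g_def[abs_def]
  proof (rule gauss_columns[OF _ _ _ e])
    show "indep_vars (\<lambda>_. \<Pi>\<^sub>M i\<in>- {k}. borel) (\<lambda>j \<omega>. \<lambda>i\<in>- {k}. D j \<omega> i) {..<CARD('d)}"
      unfolding D_def using \<tau>0 \<tau> by (intro indep_increments) (auto intro: less_imp_le)
    show "distr M (\<Pi>\<^sub>M i\<in>- {k}. borel) (\<lambda>\<omega>. \<lambda>i\<in>- {k}. D j \<omega> i)
        = (\<Pi>\<^sub>M i\<in>- {k}. density lborel (normal_density 0 (\<sigma> j)))" if "j < CARD('d)" for j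
      unfolding D_def \<sigma>_def using that by (intro increment_distr \<tau> \<tau>_nonneg) auto
  qed (rule \<sigma>)
  have det: "vol (zon (map (\<lambda>j. curve \<omega> (\<tau> (Suc j)) - curve \<omega> (\<tau> j)) [0..<CARD('d)]))
      = (\<Prod>j<CARD('d). \<sigma> j) * \<bar>?det \<omega>\<bar>" for \<omega>
  proof -
    have "(\<chi> i. curve \<omega> (\<tau> (Suc (e i))) - curve \<omega> (\<tau> (e i))) = (\<chi> i. \<sigma> (e i) *s (colmat (- {k}) k u (g \<omega>) $ i))"
      using \<sigma>[OF e_less]
      by (auto simp: vec_eq_iff space_time_path_def colmat_def transpose_def u_def g_def D_def less_imp_neq[symmetric])
    then have "det (\<chi> i. curve \<omega> (\<tau> (Suc (e i))) - curve \<omega> (\<tau> (e i))) = (\<Prod>i\<in>UNIV. \<sigma> (e i)) * ?det \<omega>"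
      by (simp only: det_rows_mul vec_lambda_eta)
    also have "(\<Prod>i\<in>UNIV. \<sigma> (e i)) = (\<Prod>j<CARD('d). \<sigma> j)"
      by (rule prod.reindex_bij_betw[OF e])
    finally have eq: "det (\<chi> i. curve \<omega> (\<tau> (Suc (e i))) - curve \<omega> (\<tau> (e i))) = (\<Prod>j<CARD('d). \<sigma> j) * ?det \<omega>" .
    have "\<bar>det (\<chi> i. curve \<omega> (\<tau> (Suc (e i))) - curve \<omega> (\<tau> (e i)))\<bar>
        = (\<Prod>j<CARD('d). \<sigma> j) * \<bar>?det \<omega>\<bar>"
    proof -
      have "0 \<le> (\<Prod>j<CARD('d). \<sigma> j)" using \<sigma>(1) by (intro prod_nonneg) (auto intro: less_imp_le)
      then show ?thesis by (simp add: eq abs_mult)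
    qed
    then show ?thesis by (simp only: vol_zon_det[OF e])
  qed
  have cm: "(\<lambda>g. ennreal \<bar>det (colmat (- {k}) k u g)\<bar>) \<in> borel_measurable (gausses (- {k}))"
    by (intro colmat_measurable PiM_gauss_component) auto
  have "(\<integral>\<^sup>+\<omega>. ennreal \<bar>?det \<omega>\<bar> \<partial>M) = gdet (- {k}) k u"
    unfolding gdet_def by (subst g_distr[symmetric], subst nn_integral_distr[OF g_meas]) (simp_all add: cm)
  also have "\<dots> = ennreal (norm u * (\<Prod>m=1..CARD('d) - 1. chi_mean m))"
  proof -
    have "card (- {k}) = CARD('d) - 1" by (simp add: Compl_eq_Diff_UNIV card_Diff_singleton)
    moreover have "insert k (- {k}) = UNIV" by auto
    moreover have "keep UNIV u = u" by (simp add: keep_def vec_eq_iff)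
    ultimately show ?thesis using gdet_value[of k "- {k}" u] by simp
  qed
  also have "norm u = sqrt (\<tau> (CARD('d)) - \<tau> 0)"
  proof -
    have "(\<Sum>i\<in>UNIV. (\<sigma> (e i))\<^sup>2) = (\<Sum>j<CARD('d). (\<sigma> j)\<^sup>2)"
      by (rule sum.reindex_bij_betw[OF e])
    also have "\<dots> = (\<Sum>j<CARD('d). \<tau> (Suc j) - \<tau> j)"
      by (intro sum.cong) (auto simp: \<sigma> power2_eq_square)
    finally show ?thesis by (simp add: norm_vec_def L2_set_def u_def sum_lessThan_telescope)
  qed
  finally have nn: "(\<integral>\<^sup>+\<omega>. ennreal \<bar>?det \<omega>\<bar> \<partial>M)
     = ennreal (sqrt (\<tau> (CARD('d)) - \<tau> 0) * (\<Prod>m=1..CARD('d) - 1. chi_mean m))" .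
  have "(\<lambda>\<omega>. \<bar>?det \<omega>\<bar>) \<in> borel_measurable M"
    using measurable_compose[OF g_meas borel_measurable_enn2real[OF cm]] by simp
  then have "(\<integral>\<omega>. \<bar>?det \<omega>\<bar> \<partial>M) = enn2real (\<integral>\<^sup>+\<omega>. ennreal \<bar>?det \<omega>\<bar> \<partial>M)"
    by (intro integral_eq_nn_integral) auto
  also have "\<dots> = sqrt (\<tau> (CARD('d)) - \<tau> 0) * (\<Prod>m=1..CARD('d) - 1. chi_mean m)"
  proof -
    have "\<tau> 0 \<le> \<tau> j" if "j \<le> CARD('d)" for j
      using that
    proof (induction j)
      case (Suc j)
      then show ?case using \<tau>[of j] by simp
    qed simp
    then show ?thesis unfolding nn by (intro enn2real_ennreal mult_nonneg_nonneg prod_nonneg) (auto simp: chi_mean_nonneg)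
  qed
  finally show ?thesis by (simp add: det \<sigma>_def)
qed

end

lemma sqrt_power_powr:
  assumes "0 < x" shows "sqrt x ^ m = x powr (1 / 2 * real m)"
proof -
  have "sqrt x ^ m = (x powr (1 / 2)) ^ m" using assms by (simp add: powr_half_sqrt)
  also have "\<dots> = x powr (1 / 2 * real m)" using assms by (subst powr_power) (simp_all add: mult.commute)
  finally show ?thesis .
qed

context space_time_brownian
begin

section \<open>Hulls on equidistant grids\<close>

abbreviation grid_hull :: "nat \<Rightarrow> 'w \<Rightarrow> (real ^ 'd) set" where
  "grid_hull n \<omega> \<equiv> convex hull ((\<lambda>j. curve \<omega> (real j / real n)) ` {..n})"

definition increment :: "nat \<Rightarrow> nat \<Rightarrow> 'w \<Rightarrow> real ^ 'd" where
  "increment n j \<omega> = curve \<omega> (real (Suc j) / real n) - curve \<omega> (real j / real n)"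

text \<open>The law is degenerate in the time coordinate. Since the grid is equidistant, one law
  serves all increments.\<close>

definition increment_law :: "nat \<Rightarrow> (real ^ 'd) measure" where
  "increment_law n = distr (\<Pi>\<^sub>M i\<in>- {k}. density lborel (normal_density 0 (sqrt (1 / real n)))) borel
     (\<lambda>f. \<chi> i. if i = k then 1 / real n else f i)"

lemma lift_measurable: "(\<lambda>f. \<chi> i. if i = k then t else f i) \<in> measurable (\<Pi>\<^sub>M i\<in>- {k}. borel) (borel :: (real^'d) measure)"
proof (rule vec_lambda_measurable)
  fix i show "(\<lambda>f. if i = k then t else f i) \<in> borel_measurable (\<Pi>\<^sub>M i\<in>- {k}. borel)"
    by (cases "i = k") (auto intro: measurable_component_singleton)
qed

lemma iid_increment_law:
  assumes n: "0 < n" shows "iid_product (increment_law n)"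
proof (rule iid_product.intro)
  let ?\<Phi> = "\<lambda>f. \<chi> i. if i = k then 1 / real n else f i :: real^'d"
  let ?N = "density lborel (normal_density 0 (sqrt (1 / real n)))"
  let ?P = "\<Pi>\<^sub>M i\<in>- {k}. ?N"
  have N: "prob_space ?N" using n by (intro prob_space_normal_density) simp
  have \<Phi>: "?\<Phi> \<in> borel_measurable ?P"
    using lift_measurable[of "1 / real n"] by (simp cong: measurable_cong_sets sets_PiM_cong)
  show "prob_space (increment_law n)"
    unfolding increment_law_def by (intro prob_space.prob_space_distr prob_space_PiM N \<Phi>)
  show "sets (increment_law n) = sets borel" by (simp add: increment_law_def)
  let ?d = "DIM(real^'d)"
  have int: "integrable ?P (\<lambda>f. \<bar>if i = k then 1 / real n else f i\<bar> ^ ?d)" for i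
  proof (cases "i = k")
    case True
    have "prob_space ?P" by (intro prob_space_PiM N)
    then show ?thesis
      using True by (simp add: finite_measure.integrable_const prob_space.finite_measure)
  next
    case False
    have "integrable ?N (\<lambda>x. \<bar>x\<bar> ^ ?d)"
      using integrable_normal_moment_abs[of "sqrt (1 / real n)" 0 ?d] n by (simp add: integrable_density)
    then have "integrable (distr ?P ?N (\<lambda>f. f i)) (\<lambda>x. \<bar>x\<bar> ^ ?d)"
      using False by (subst distr_PiM_component) (auto intro: N)
    then show ?thesis
      using False by (subst (asm) integrable_distr_eq) auto
  qed
  have "integrable ?P (\<lambda>f. norm (?\<Phi> f) ^ ?d)"
  proof (rule Bochner_Integration.integrable_bound)
    show "integrable ?P (\<lambda>f. real CARD('d) ^ ?d * (\<Sum>i\<in>UNIV. \<bar>if i = k then 1 / real n else f i\<bar> ^ ?d))"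
      by (intro integrable_mult_right Bochner_Integration.integrable_sum int)
    show "(\<lambda>f. norm (?\<Phi> f) ^ ?d) \<in> borel_measurable ?P"
      proof (rule borel_measurable_power)
      have "(norm :: real^'d \<Rightarrow> real) \<in> borel_measurable borel" by simp
      from measurable_compose[OF \<Phi> this]
      show "(\<lambda>f. norm (?\<Phi> f)) \<in> borel_measurable ?P" .
    qed
    show "AE f in ?P. norm (norm (?\<Phi> f) ^ ?d)
       \<le> norm (real CARD('d) ^ ?d * (\<Sum>i\<in>UNIV. \<bar>if i = k then 1 / real n else f i\<bar> ^ ?d))"
    proof (intro AE_I2)
      fix f :: "'d \<Rightarrow> real"
      let ?x = "\<chi> i. if i = k then 1 / real n else f i :: real^'d"
      have "norm ?x ^ ?d \<le> (\<Sum>i\<in>UNIV. \<bar>?x $ i\<bar>) ^ ?d"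
        by (intro power_mono norm_le_l1_cart) simp
      also have "\<dots> \<le> real CARD('d) ^ ?d * (\<Sum>i\<in>UNIV. \<bar>?x $ i\<bar> ^ ?d)"
        by (intro sum_power_le) auto
      finally show "norm (norm ?x ^ ?d) \<le> norm (real CARD('d) ^ ?d * (\<Sum>i\<in>UNIV. \<bar>if i = k then 1 / real n else f i\<bar> ^ ?d))"
        by (simp add: sum_nonneg abs_mult)
    qed
  qed
  then show "integrable (increment_law n) (\<lambda>x. norm x ^ ?d)"
    unfolding increment_law_def by (subst integrable_distr_eq[OF \<Phi>]) auto
qed

lemma increments_distr:
  assumes n: "0 < n"
  shows "distr M (\<Pi>\<^sub>M j\<in>{..<n}. increment_law n) (\<lambda>\<omega>. \<lambda>j\<in>{..<n}. increment n j \<omega>) = (\<Pi>\<^sub>M j\<in>{..<n}. increment_law n)"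
proof -
  let ?D = "\<lambda>j \<omega>. \<lambda>i\<in>- {k}. B (real (Suc j) / real n) \<omega> i - B (real j / real n) \<omega> i"
  let ?\<Phi> = "\<lambda>f. \<chi> i. if i = k then 1 / real n else f i :: real^'d"
  have indep: "indep_vars (\<lambda>_. \<Pi>\<^sub>M i\<in>- {k}. borel) ?D {..<n}"
    by (rule indep_increments[of "\<lambda>j. real j / real n"]) (auto simp: divide_right_mono)
  have eq: "?\<Phi> (?D j \<omega>) = increment n j \<omega>" for j \<omega>
    by (auto simp: vec_eq_iff increment_def space_time_path_def add_divide_distrib)
  have "indep_vars (\<lambda>_. borel) (\<lambda>j \<omega>. ?\<Phi> (?D j \<omega>)) {..<n}"
    by (rule indep_vars_compose2[OF indep]) (rule lift_measurable)
  then have indep': "indep_vars (\<lambda>_. borel) (increment n) {..<n}"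
    by (simp only: eq)
  have law: "distr M borel (increment n j) = increment_law n" if "j < n" for j
  proof -
    have D_meas: "?D j \<in> measurable M (\<Pi>\<^sub>M i\<in>- {k}. borel)"
      using indep that by (auto simp: indep_vars_def)
    have "real j / real n < real (Suc j) / real n" "real (Suc j) / real n - real j / real n = 1 / real n"
      using n by (simp_all add: divide_strict_right_mono add_divide_distrib)
    then have d: "distr M (\<Pi>\<^sub>M i\<in>- {k}. borel) (?D j) = (\<Pi>\<^sub>M i\<in>- {k}. density lborel (normal_density 0 (sqrt (1 / real n))))"
      using increment_distr[of "real j / real n" "real (Suc j) / real n"] by simp
    have "distr M borel (increment n j) = distr M borel (?\<Phi> \<circ> ?D j)"
      by (rule distr_cong) (simp_all only: eq comp_apply)
    also have "\<dots> = distr (distr M (\<Pi>\<^sub>M i\<in>- {k}. borel) (?D j)) borel ?\<Phi>"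
      by (rule distr_distr[symmetric, OF lift_measurable D_meas])
    finally show ?thesis by (simp only: d increment_law_def)
  qed
  have "distr M (\<Pi>\<^sub>M j\<in>{..<n}. increment_law n) (\<lambda>\<omega>. \<lambda>j\<in>{..<n}. increment n j \<omega>)
      = distr M (\<Pi>\<^sub>M j\<in>{..<n}. borel) (\<lambda>\<omega>. \<lambda>j\<in>{..<n}. increment n j \<omega>)"
    by (rule distr_cong) (auto intro!: sets_PiM_cong simp: increment_law_def)
  also have "\<dots> = (\<Pi>\<^sub>M j\<in>{..<n}. distr M borel (increment n j))"
    by (rule indep_vars_distr_PiM[OF indep']) simp
  also have "\<dots> = (\<Pi>\<^sub>M j\<in>{..<n}. increment_law n)"
    by (intro PiM_cong refl law) simp
  finally show ?thesis .
qed

lemma walk_increment: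
  assumes "i \<le> n"
  shows "walk (\<lambda>j\<in>{..<n}. increment n j \<omega>) i = curve \<omega> (real i / real n) - curve \<omega> 0"
proof -
  have "walk (\<lambda>j\<in>{..<n}. increment n j \<omega>) i = (\<Sum>j<i. curve \<omega> (real (Suc j) / real n) - curve \<omega> (real j / real n))"
    using assms by (simp add: walk_def increment_def)
  also have "\<dots> = curve \<omega> (real i / real n) - curve \<omega> (real 0 / real n)"
    by (rule sum_lessThan_telescope)
  finally show ?thesis by simp
qed

lemma increments_measurable:
  assumes n: "0 < n"
  shows "(\<lambda>\<omega>. \<lambda>j\<in>{..<n}. increment n j \<omega>) \<in> measurable M (\<Pi>\<^sub>M j\<in>{..<n}. increment_law n)"
proof (rule measurable_restrict)
  fix j
  have "increment n j \<in> borel_measurable M"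
    unfolding increment_def[abs_def] by (intro borel_measurable_diff path_measurable) auto
  then show "increment n j \<in> measurable M (increment_law n)"
    by (simp add: increment_law_def cong: measurable_cong_sets)
qed

text \<open>The walk starts at the origin, so its hull is the grid hull translated by the negative
  of the starting point.\<close>

lemma vol_grid_hull: "vol (grid_hull n \<omega>) = wdiff [] n (\<lambda>j\<in>{..<n}. increment n j \<omega>)"
proof -
  have "walk (\<lambda>j\<in>{..<n}. increment n j \<omega>) ` {..n} = (\<lambda>j. - curve \<omega> 0 + curve \<omega> (real j / real n)) ` {..n}"
    by (intro image_cong) (simp_all add: walk_increment)
  also have "\<dots> = (+) (- curve \<omega> 0) ` (\<lambda>j. curve \<omega> (real j / real n)) ` {..n}"
    by (simp only: image_image)
  finally have eq: "walk (\<lambda>j\<in>{..<n}. increment n j \<omega>) ` {..n} = (+) (- curve \<omega> 0) ` (\<lambda>j. curve \<omega> (real j / real n)) ` {..n}" .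
  show ?thesis by (simp only: wdiff_def eq convex_hull_translation measure_translation list.map mdiff.simps)
qed

lemma
  assumes n: "0 < n"
  shows integrable_vol_grid_hull: "integrable M (\<lambda>\<omega>. vol (grid_hull n \<omega>))"
    and integral_vol_grid_hull: "(\<integral>\<omega>. vol (grid_hull n \<omega>) \<partial>M) = (\<Prod>m=1..CARD('d) - 1. chi_mean m) *
      ((\<Sum>j=1..n. sqrt j * root_sum (CARD('d) - 1) j / j) / real n powr ((real CARD('d) + 1) / 2))"
proof -
  interpret iid_product "increment_law n" n by (rule iid_increment_law[OF n])
  let ?X = "\<lambda>\<omega>. \<lambda>j\<in>{..<n}. increment n j \<omega>"
  note X = increments_measurable[OF n]
  have wm: "wdiff [] n \<in> borel_measurable P" by (rule wdiff_measurable) auto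
  have "integrable (distr M P ?X) (wdiff [] n)"
    unfolding increments_distr[OF n] by (rule wdiff_integrable) auto
  then show "integrable M (\<lambda>\<omega>. vol (grid_hull n \<omega>))"
    unfolding vol_grid_hull by (subst (asm) integrable_distr_eq[OF X wm])
  \<comment> \<open>The power of \<open>n\<close> collects \<open>d + 1\<close> factors
    \<open>sqrt n\<close>: \<open>d\<close> from the time gaps and one from the norm of the time
    column.\<close>
  define C where "C = (\<Prod>m=1..CARD('d) - 1. chi_mean m) / real n powr ((real CARD('d) + 1) / 2)"
  define G where "G ks = (\<integral>x. vol (zon (map (walk x) ks)) \<partial>P)" for ks
  have G: "G ks = C * sqrt (real (hd ks)) * gaps ks"
    if ks: "length ks = CARD('d)" "sorted_wrt (<) ks" "set ks \<subseteq> {1..n}" for ks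
  proof -
    \<comment> \<open>The index 0 in front makes the first increment start at time 0.\<close>
    define \<tau> where "\<tau> j = real ((0 # ks) ! j) / real n" for j
    have ne: "ks \<noteq> []" using ks(1) by auto
    have lt: "\<tau> j < \<tau> (Suc j)" if "j < CARD('d)" for j
    proof -
      have "sorted_wrt (<) (0 # ks)" using ks(2,3) by auto
      then have "(0 # ks) ! j < (0 # ks) ! Suc j"
        using sorted_wrt_nth_less[of "(<)" "0 # ks" j "Suc j"] that ks(1) by simp
      then show ?thesis using n by (simp add: \<tau>_def divide_strict_right_mono)
    qed
    have zm: "(\<lambda>x. vol (zon (map (walk x) ks))) \<in> borel_measurable P"
    proof -
      have "vol (zon (map (walk x) ks)) = wdiff ks 0 x" for x :: "nat \<Rightarrow> real^'d"
        unfolding wdiff_def using ks(1) by (intro mdiff_full[symmetric] body_hull) auto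
      moreover have "wdiff ks 0 \<in> borel_measurable P" using ks(3) by (intro wdiff_measurable) auto
      ultimately show ?thesis by simp
    qed
    \<comment> \<open>The walk positions are partial sums of the increments between the selected
      times, so \<open>vol_zon_psums\<close> replaces them by these independent increments.\<close>
    have zon: "vol (zon (map (walk (?X \<omega>)) ks)) = vol (zon (map (\<lambda>j. curve \<omega> (\<tau> (Suc j)) - curve \<omega> (\<tau> j)) [0..<CARD('d)]))" for \<omega>
    proof -
      have "map (walk (?X \<omega>)) ks = map (\<lambda>i. curve \<omega> (real i / real n) - curve \<omega> 0) ks"
        using ks(3) by (intro map_cong refl walk_increment) auto
      also have "\<dots> = psums 0 (map (\<lambda>j. curve \<omega> (\<tau> (Suc j)) - curve \<omega> (\<tau> j)) [0..<length ks])"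
        using psums_differences[of "\<lambda>i. curve \<omega> (real i / real n)" 0 "curve \<omega> 0" ks] by (simp add: \<tau>_def)
      finally show ?thesis
        using vol_zon_psums[of 0 "[]" "map (\<lambda>j. curve \<omega> (\<tau> (Suc j)) - curve \<omega> (\<tau> j)) [0..<length ks]"] ks(1) by simp
    qed
    have "G ks = (\<integral>x. vol (zon (map (walk x) ks)) \<partial>distr M P ?X)"
      unfolding increments_distr[OF n] by (simp add: G_def)
    also have "\<dots> = (\<integral>\<omega>. vol (zon (map (walk (?X \<omega>)) ks)) \<partial>M)"
      by (rule integral_distr[OF X zm])
    also have "\<dots> = (\<Prod>j<CARD('d). sqrt (\<tau> (Suc j) - \<tau> j)) * sqrt (\<tau> (CARD('d)) - \<tau> 0) * (\<Prod>m=1..CARD('d) - 1. chi_mean m)"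
      unfolding zon by (rule integral_vol_zon) (use lt in \<open>simp_all add: \<tau>_def\<close>)
    also have "(\<Prod>j<CARD('d). sqrt (\<tau> (Suc j) - \<tau> j))
        = (\<Prod>j<length ks. sqrt (real ((0 # ks) ! Suc j) - real ((0 # ks) ! j))) / sqrt n ^ CARD('d)"
      by (simp add: \<tau>_def ks(1) diff_divide_distrib[symmetric] real_sqrt_divide prod_dividef del: nth_Cons_Suc)
    also have "sqrt (\<tau> (CARD('d)) - \<tau> 0) = sqrt (real (last ks)) / sqrt n"
      using ne ks(1) by (simp add: \<tau>_def real_sqrt_divide last_conv_nth nth_Cons')
    also have "(\<Prod>j<length ks. sqrt (real ((0 # ks) ! Suc j) - real ((0 # ks) ! j))) / sqrt n ^ CARD('d) * (sqrt (real (last ks)) / sqrt n)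
       = ((\<Prod>j<length ks. sqrt (real ((0 # ks) ! Suc j) - real ((0 # ks) ! j))) * sqrt (real (last ks))) / sqrt n ^ (CARD('d) + 1)"
      by simp
    also have "\<dots> = sqrt (real (hd ks)) * gaps ks / sqrt n ^ (CARD('d) + 1)"
      using gaps_prod[OF ne, of 0] by simp
    also have "sqrt n ^ (CARD('d) + 1) = real n powr ((real CARD('d) + 1) / 2)"
      using sqrt_power_powr[of "real n" "CARD('d) + 1"] n by (simp add: add.commute)
    finally show ?thesis by (simp add: C_def)
  qed
  have "(\<integral>\<omega>. vol (grid_hull n \<omega>) \<partial>M) = (\<integral>x. wdiff [] n x \<partial>distr M P ?X)"
    unfolding vol_grid_hull by (rule integral_distr[symmetric, OF X wm])
  also have "\<dots> = (\<integral>x. wdiff [] n x \<partial>P)" by (simp only: increments_distr[OF n])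
  also have "\<dots> = nsum G (CARD('d)) [] n"
    unfolding G_def by (rule integral_wdiff_nsum) simp_all
  also have "\<dots> = C * (\<Sum>j=1..n. sqrt j * root_sum (CARD('d) - 1) j / j)"
    by (rule nsum_root_sum_Nil[OF G]) simp_all
  finally show "(\<integral>\<omega>. vol (grid_hull n \<omega>) \<partial>M) = (\<Prod>m=1..CARD('d) - 1. chi_mean m) *
      ((\<Sum>j=1..n. sqrt j * root_sum (CARD('d) - 1) j / j) / real n powr ((real CARD('d) + 1) / 2))"
    by (simp add: C_def)
qed

lemma prod_sqrt_2pi: "(\<Prod>m=1..r. sqrt (2 * pi) / (real m + 1)) = sqrt (2 * pi) ^ r / fact (r + 1)"
  by (induction r) (simp_all add: field_simps)

text \<open>The factor \<open>2 / (d + 1)\<close> of the outermost sum turns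
  \<open>sqrt (2 * pi) ^ (d - 1) / d!\<close> into the claimed constant.\<close>

lemma integral_vol_grid_hull_limit:
  "(\<lambda>n. \<integral>\<omega>. vol (grid_hull n \<omega>) \<partial>M) \<longlonglongrightarrow>
    2 powr ((real CARD('d) + 1) / 2) * pi powr ((real CARD('d) - 1) / 2) / fact (CARD('d) + 1)"
proof -
  define d where "d = CARD('d)"
  have d: "0 < d" by (simp add: d_def)
  let ?C = "\<Prod>m=1..d - 1. chi_mean m"
  have "(\<lambda>n. ?C * ((\<Sum>j=1..n. sqrt j * root_sum (d - 1) j / j) / real n powr ((real d + 1) / 2)))
     \<longlonglongrightarrow> ?C * ((\<Prod>m=1..d-1. Beta (real m / 2) (3 / 2)) * 2 / (real d + 1))"
    using root_sum_limit[OF d] by (intro tendsto_mult_left) (simp add: add.commute)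
  moreover have "\<forall>\<^sub>F n in sequentially. ?C * ((\<Sum>j=1..n. sqrt j * root_sum (d - 1) j / j) / real n powr ((real d + 1) / 2))
      = (\<integral>\<omega>. vol (grid_hull n \<omega>) \<partial>M)"
    using eventually_gt_at_top[of 0] by eventually_elim (simp only: integral_vol_grid_hull d_def)
  ultimately have lim: "(\<lambda>n. \<integral>\<omega>. vol (grid_hull n \<omega>) \<partial>M)
      \<longlonglongrightarrow> ?C * ((\<Prod>m=1..d-1. Beta (real m / 2) (3 / 2)) * 2 / (real d + 1))"
    using tendsto_cong by fast
  have "?C * (\<Prod>m=1..d-1. Beta (real m / 2) (3 / 2)) = sqrt (2 * pi) ^ (d - 1) / fact d"
  proof -
    have "?C * (\<Prod>m=1..d-1. Beta (real m / 2) (3 / 2)) = (\<Prod>m=1..d-1. sqrt (2 * pi) / (real m + 1))"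
      unfolding prod.distrib[symmetric] by (intro prod.cong refl chi_mean_Beta) auto
    then show ?thesis using prod_sqrt_2pi[of "d - 1"] d by simp
  qed
  moreover have "?C * (b * 2 / (real d + 1)) = (?C * b) * 2 / (real d + 1)" for b by simp
  ultimately have "?C * ((\<Prod>m=1..d-1. Beta (real m / 2) (3 / 2)) * 2 / (real d + 1)) = sqrt (2 * pi) ^ (d - 1) / fact d * 2 / (real d + 1)"
    by (simp only:)
  also have "\<dots> = 2 * sqrt (2 * pi) ^ (d - 1) / ((real d + 1) * fact d)" by (simp add: mult.commute)
  also have "sqrt (2 * pi) ^ (d - 1) = 2 powr ((real d - 1) / 2) * pi powr ((real d - 1) / 2)"
  proof -
    have "sqrt (2 * pi) ^ (d - 1) = (2 * pi) powr ((1 / 2) * real (d - 1))"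
      by (rule sqrt_power_powr) simp
    also have "(1 / 2) * real (d - 1) = (real d - 1) / 2" using d by (simp add: of_nat_diff)
    finally show ?thesis by (simp add: powr_mult)
  qed
  also have "2 * (2 powr ((real d - 1) / 2) * pi powr ((real d - 1) / 2)) = 2 powr ((real d + 1) / 2) * pi powr ((real d - 1) / 2)"
  proof -
    have "2 * 2 powr ((real d - 1) / 2) = (2::real) powr (1 + (real d - 1) / 2)" by (simp add: powr_add)
    also have "1 + (real d - 1) / 2 = (real d + 1) / 2" by (simp add: field_simps)
    finally show ?thesis by simp
  qed
  also have "(real d + 1) * fact d = fact (d + 1)" by (simp add: algebra_simps)
  finally show ?thesis using lim unfolding d_def by simp
qed

section \<open>From grids to the whole path\<close>

lemma grid_hull_mono:
  assumes "0 < c" shows "grid_hull n \<omega> \<subseteq> grid_hull (n * c) \<omega>"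
proof (intro hull_mono subsetI)
  fix x assume "x \<in> (\<lambda>j. curve \<omega> (real j / real n)) ` {..n}"
  then obtain j where j: "j \<le> n" "x = curve \<omega> (real j / real n)" by auto
  then have "x = curve \<omega> (real (j * c) / real (n * c))" using assms by simp
  moreover have "j * c \<in> {..n * c}" using j(1) by simp
  ultimately show "x \<in> (\<lambda>j. curve \<omega> (real j / real (n * c))) ` {..n * c}" by (rule image_eqI)
qed

text \<open>The union \<open>U\<close> of the dyadic hulls is convex and dense in the full hull
  \<open>H\<close>, so \<open>H - U\<close> lies in the frontier of \<open>U\<close>, and the
  frontier of a convex set is negligible. Powers of two make the grids nested.\<close>

lemma vol_grid_hull_limit:
  assumes cont: "\<forall>i\<in>- {k}. continuous_on {0..} (\<lambda>t. B t \<omega> i)"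
  shows "(\<lambda>q. vol (grid_hull (2 ^ q) \<omega>)) \<longlonglongrightarrow> hull_volume k B \<omega>"
    and "mono (\<lambda>q. vol (grid_hull (2 ^ q) \<omega>))"
proof -
  let ?p = "curve \<omega>"
  define K where "K q = grid_hull (2 ^ q) \<omega>" for q
  define U where "U = (\<Union>q. K q)"
  define H where "H = convex hull (?p ` {0..1})"
  have path_cont: "continuous_on {0..1} ?p"
    unfolding space_time_path_def
  proof (rule continuous_on_vec_lambda)
    fix i
    have "continuous_on {0..1} (\<lambda>t. B t \<omega> i)" if "i \<noteq> k"
      using cont that by (auto intro: continuous_on_subset)
    then show "continuous_on {0..1} (\<lambda>t. if i = k then t else B t \<omega> i)" by (cases "i = k") (auto intro: continuous_on_id)
  qed
  have comp: "compact (?p ` {0..1})" by (intro compact_continuous_image path_cont compact_Icc)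
  \<comment> \<open>The image of the continuous path is compact, so the closure in
    \<open>hull_volume\<close> adds nothing.\<close>
  have hv: "hull_volume k B \<omega> = vol H"
    using comp by (simp add: hull_volume_def H_def closure_closed compact_imp_closed)
  have K_mono: "K q \<subseteq> K (Suc q)" for q
    using grid_hull_mono[where c=2 and n="2 ^ q" and \<omega>=\<omega>] by (simp add: K_def mult.commute)
  have inc: "incseq K" by (intro incseq_SucI K_mono)
  have KH: "K q \<subseteq> H" for q
  proof -
    have "real j / real (2 ^ q) \<in> {0..1}" if "j \<le> 2 ^ q" for j
    proof -
      have "real j \<le> real (2 ^ q)" using that by (simp only: of_nat_le_iff)
      then show ?thesis by simp
    qed
    then show ?thesis unfolding K_def H_def by (intro hull_mono) blast
  qed
  have K_lm: "K q \<in> lmeasurable" for q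
    unfolding K_def using body_hull[of "(\<lambda>j. ?p (real j / real (2 ^ q))) ` {..2 ^ q}"]
    by (intro lmeasurable_compact) (simp only: body_def finite_imageI finite_atMost)
  have H_lm: "H \<in> lmeasurable" unfolding H_def by (intro lmeasurable_compact compact_convex_hull comp)
  show "mono (\<lambda>q. vol (grid_hull (2 ^ q) \<omega>))"
    unfolding K_def[symmetric] by (intro monoI measure_mono_fmeasurable incseqD[OF inc] fmeasurableD K_lm)
  have U_conv: "convex U"
  proof (rule convexI)
    fix x y :: "real^'d" and u v :: real
    assume "x \<in> U" "y \<in> U" and uv: "0 \<le> u" "0 \<le> v" "u + v = 1"
    then obtain a b where "x \<in> K a" "y \<in> K b" by (auto simp: U_def)
    then have "x \<in> K (max a b)" "y \<in> K (max a b)"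
      using incseqD[OF inc, of a "max a b"] incseqD[OF inc, of b "max a b"] by auto
    then have "u *\<^sub>R x + v *\<^sub>R y \<in> K (max a b)" using uv unfolding K_def by (intro convexD convex_convex_hull)
    then show "u *\<^sub>R x + v *\<^sub>R y \<in> U" by (auto simp: U_def)
  qed
  have UH: "U \<subseteq> H" using KH by (auto simp: U_def)
  have "?p t \<in> closure U" if t: "t \<in> {0..1}" for t
  proof -
    \<comment> \<open>Dyadic approximations of \<open>t\<close> from below, which stay in the unit
      interval.\<close>
    define f where "f q = real (nat \<lfloor>t * 2 ^ q\<rfloor>) / 2 ^ q" for q
    have f: "real (nat \<lfloor>t * 2 ^ q\<rfloor>) = of_int \<lfloor>t * 2 ^ q\<rfloor>" for q using t by simp
    have f_bounds: "f q \<le> t" "t - 1 / 2 ^ q \<le> f q" "0 \<le> f q" for q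
    proof -
      have "of_int \<lfloor>t * 2 ^ q\<rfloor> \<le> t * 2 ^ q" "t * 2 ^ q - 1 \<le> of_int \<lfloor>t * 2 ^ q\<rfloor>" by linarith+
      then have "of_int \<lfloor>t * 2 ^ q\<rfloor> / 2 ^ q \<le> t * 2 ^ q / 2 ^ q" "(t * 2 ^ q - 1) / 2 ^ q \<le> of_int \<lfloor>t * 2 ^ q\<rfloor> / 2 ^ q"
        by (intro divide_right_mono; simp)+
      then show "f q \<le> t" "t - 1 / 2 ^ q \<le> f q" unfolding f_def f by (simp_all add: diff_divide_distrib)
      show "0 \<le> f q" by (simp add: f_def)
    qed
    have f_lim: "f \<longlonglongrightarrow> t"
    proof (rule tendsto_sandwich)
      have "(\<lambda>q. (1 / 2) ^ q) \<longlonglongrightarrow> (0::real)" by (rule LIMSEQ_realpow_zero) auto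
      then show "(\<lambda>q. t - 1 / 2 ^ q) \<longlonglongrightarrow> t"
        using tendsto_diff[OF tendsto_const, of "\<lambda>q. (1 / 2) ^ q" 0 sequentially t] by (simp add: power_one_over)
    qed (use f_bounds in auto)
    have "(\<lambda>q. ?p (f q)) \<longlonglongrightarrow> ?p t"
    proof (rule continuous_on_tendsto_compose[OF path_cont f_lim t])
      have "f q \<in> {0..1}" for q using f_bounds(1,3)[of q] t by simp
      then show "\<forall>\<^sub>F q in sequentially. f q \<in> {0..1}" by simp
    qed
    moreover have "?p (f q) \<in> U" for q
    proof -
      have "nat \<lfloor>t * 2 ^ q\<rfloor> \<le> 2 ^ q"
      proof -
        have "f q \<le> 1" using f_bounds(1)[of q] t by simp
        then have "real (nat \<lfloor>t * 2 ^ q\<rfloor>) \<le> real (2 ^ q)" unfolding f_def by (simp add: divide_le_eq_1)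
        then show ?thesis by (simp only: of_nat_le_iff)
      qed
      then have "?p (f q) \<in> (\<lambda>j. ?p (real j / real (2 ^ q))) ` {..2 ^ q}"
        by (intro image_eqI[of _ _ "nat \<lfloor>t * 2 ^ q\<rfloor>"]) (simp_all add: f_def)
      then have "?p (f q) \<in> K q" unfolding K_def by (rule hull_inc)
      then show ?thesis by (auto simp: U_def)
    qed
    ultimately show ?thesis
      unfolding closure_sequential by (intro exI[of _ "\<lambda>q. ?p (f q)"] conjI allI)
  qed
  then have HU: "H \<subseteq> closure U" unfolding H_def
    by (intro hull_minimal convex_closure U_conv) auto
  have "negligible (H - U)"
  proof (rule negligible_subset[OF negligible_convex_frontier[OF U_conv]])
    show "H - U \<subseteq> frontier U" using HU interior_subset[of U] by (auto simp: frontier_def)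
  qed
  then have null: "H - U \<in> null_sets lebesgue" by (simp add: negligible_iff_null_sets)
  have U_meas: "U \<in> sets lebesgue"
    unfolding U_def by (intro sets.countable_UN) (auto intro: fmeasurableD K_lm)
  have "vol H = vol (U \<union> (H - U))" using UH by (simp add: Un_absorb1)
  also have "\<dots> = vol U" by (rule measure_Un_null_set[OF U_meas null])
  finally have "vol H = vol U" .
  moreover have "(\<lambda>q. vol (K q)) \<longlonglongrightarrow> vol U"
    unfolding U_def
  proof (rule Lim_measure_incseq)
    show "range K \<subseteq> sets lebesgue" using K_lm by (auto intro: fmeasurableD)
    have "emeasure lebesgue (\<Union>q. K q) \<le> emeasure lebesgue H"
      using UH H_lm by (intro emeasure_mono) (auto simp: U_def intro: fmeasurableD)
    then show "emeasure lebesgue (\<Union>q. K q) \<noteq> \<infinity>"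
      using fmeasurableD2[OF H_lm] by (metis infinity_ennreal_def top.extremum_unique)
  qed (rule inc)
  ultimately show "(\<lambda>q. vol (grid_hull (2 ^ q) \<omega>)) \<longlonglongrightarrow> hull_volume k B \<omega>"
    by (simp add: hv K_def)
qed

end

text \<open>Changing a function on a null set may destroy measurability over \<open>M\<close>, but
  not over the completion.\<close>

lemma borel_measurable_completion_AE:
  fixes f g :: "'a \<Rightarrow> real"
  assumes f: "f \<in> borel_measurable M" and ae: "AE x in M. f x = g x"
  shows "g \<in> borel_measurable (completion M)"
proof (rule measurableI)
  fix A :: "real set" assume A: "A \<in> sets borel"
  have meas: "f -` A \<inter> space M \<in> sets (completion M)" using measurable_sets[OF f A] by simp
  have same: "AE x in completion M. x \<in> f -` A \<inter> space M \<longleftrightarrow> x \<in> g -` A \<inter> space M"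
    using AE_completion[OF ae] by eventually_elim (simp only: vimage_eq Int_iff)
  have "g -` A \<inter> space M \<subseteq> space (completion M)" by simp
  then have "g -` A \<inter> space M \<in> sets (completion M)"
    by (rule completion.in_sets_AE[OF same meas])
  then show "g -` A \<inter> space (completion M) \<in> sets (completion M)" by simp
qed simp

theorem theorem3p11:
  fixes M :: "'w measure" and k :: "'d::finite" and B :: "real \<Rightarrow> 'w \<Rightarrow> 'd \<Rightarrow> real"
  assumes "standard_brownian_motion M (- {k}) B"
  shows "integrable (completion M) (hull_volume k B) \<and>
         prob_space.expectation (completion M) (hull_volume k B)
           = 2 powr ((real CARD('d) + 1) / 2) * pi powr ((real CARD('d) - 1) / 2)
               / fact (CARD('d) + 1)"
proof -
  interpret standard_brownian_motion M "- {k}" B by fact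
  interpret space_time_brownian M k B by unfold_locales
  let ?V = "\<lambda>q \<omega>. vol (grid_hull (2 ^ q) \<omega>)"
  have int: "integrable M (?V q)" for q by (rule integrable_vol_grid_hull) simp
  have Vm: "?V q \<in> borel_measurable M" for q using int by auto
  have lim: "AE \<omega> in M. (\<lambda>q. ?V q \<omega>) \<longlonglongrightarrow> hull_volume k B \<omega>"
    using continuous_paths by eventually_elim (rule vol_grid_hull_limit(1))
  have mono: "AE \<omega> in M. mono (\<lambda>q. ?V q \<omega>)"
    using continuous_paths by eventually_elim (rule vol_grid_hull_limit(2))
  \<comment> \<open>The limit over all grids is used along the nested ones only, where the volumes
    increase and monotone convergence applies.\<close>
  have "(\<lambda>q. \<integral>\<omega>. ?V q \<omega> \<partial>M) \<longlonglongrightarrow>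
      2 powr ((real CARD('d) + 1) / 2) * pi powr ((real CARD('d) - 1) / 2) / fact (CARD('d) + 1)"
    using filterlim_compose[OF integral_vol_grid_hull_limit, of "\<lambda>q. 2 ^ q"]
    by (simp add: filterlim_subseq strict_mono_def)
  then have ilim: "(\<lambda>q. integral\<^sup>L (completion M) (?V q)) \<longlonglongrightarrow>
      2 powr ((real CARD('d) + 1) / 2) * pi powr ((real CARD('d) - 1) / 2) / fact (CARD('d) + 1)"
    by (simp only: integral_completion[OF Vm])
  \<comment> \<open>Off a null set the hull volume is the limit of measurable functions; on it
    nothing is known, whence the completion.\<close>
  have meas: "hull_volume k B \<in> borel_measurable (completion M)"
  proof (rule borel_measurable_completion_AE)
    show "(\<lambda>\<omega>. lim (\<lambda>q. ?V q \<omega>)) \<in> borel_measurable M"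
      using Vm by (intro borel_measurable_lim_metric)
    show "AE \<omega> in M. lim (\<lambda>q. ?V q \<omega>) = hull_volume k B \<omega>"
      using lim by eventually_elim (rule limI)
  qed
  have intc: "integrable (completion M) (?V q)" for q
    using int integrable_completion[OF Vm] by simp
  show ?thesis
    using integrable_monotone_convergence[OF intc AE_completion[OF mono] AE_completion[OF lim] ilim meas]
      integral_monotone_convergence[OF intc AE_completion[OF mono] AE_completion[OF lim] ilim meas]
    by blast
qed

end
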